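(* Let $A$ be a bialgebra over a field $k$ and let $M,N$ be left-right Hopf modules over $A$. For $n,p\ge 0$ let $C^{n,p}(M,N)=\mathrm{Hom}_k(A^{\otimes n}\otimes M,\,N\otimes A^{\otimes p})$, and let $d_m^{n,p}:C^{n,p}(M,N)\to C^{n+1,p}(M,N)$ and $d_c^{n,p}:C^{n,p}(M,N)\to C^{n,p+1}(M,N)$ be the maps defined in the context. Then $(C^{n,p}(M,N),d_m^{n,p},d_c^{n,p})$ is a double complex, i.e. for all $n,p\ge 0$ $$d_m^{n+1,p}\circ d_m^{n,p}=0,\qquad d_c^{n,p+1}\circ d_c^{n,p}=0,\qquad d_c^{n+1,p}\circ d_m^{n,p}=d_m^{n,p+1}\circ d_c^{n,p}.$$
   Context: $k$ is a field, all linear spaces, tensor products and Homs are over $k$; $A^n$ denotes $A^{\otimes n}$ with $A^0=k$. Sweedler notation: $\Delta(a)=\sum a_1\otimes a_2$, iterated $\sum a_1\otimes\cdots\otimes a_{r}$. A left-right Hopf module over a bialgebra $A$ is a $k$-space $M$ that is a left $A$-module ($a\otimes m\mapsto a\cdot m$) and a right $A$-comodule ($\rho_M(m)=\sum m_0\otimes m_1\in M\otimes A$) with $\sum (a\cdot m)_0\otimes (a\cdot m)_1=\sum a_1\cdot m_0\otimes a_2m_1$ for all $a\in A$, $m\in M$. For $f\in C^{n,p}(M,N)$ write $f(x)=\sum f(x)^0\otimes f(x)^1\otimes\cdots\otimes f(x)^p$ with $f(x)^0\in N$ and $f(x)^j\in A$ for $j\ge1$. Superscripts on $a^1,\dots,a^n\in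 A$ are indices. Maps $b_i^{n,p}:C^{n,p}\to C^{n+1,p}$, $0\le i\le n+1$: - $b_0^{n,p}(f)(a^1\otimes\cdots\otimes a^{n+1}\otimes m)=\sum (a^1)_1\cdot f(x)^0\otimes (a^1)_2f(x)^1\otimes\cdots\otimes(a^1)_{p+1}f(x)^p$, with $x=a^2\otimes\cdots\otimes a^{n+1}\otimes m$; - $b_i^{n,p}(f)(a^1\otimes\cdots\otimes a^{n+1}\otimes m)=f(a^1\otimes\cdots\otimes a^ia^{i+1}\otimes\cdots\otimes a^{n+1}\otimes m)$ for $1\le i\le n$; - $b_{n+1}^{n,p}(f)(a^1\otimes\cdots\otimes a^{n+1}\otimes m)=f(a^1\otimes\cdots\otimes a^n\otimes a^{n+1}\cdot m)$. Maps $c_i^{n,p}:C^{n,p}\to C^{n,p+1}$, $0\le i\le p+1$: - $c_0^{n,p}(f)(x)=\sum (f(x)^0)_0\otimes (f(x)^0)_1\otimes f(x)^1\otimes\cdots\otimes f(x)^p$; - for $1\le i\le p$, $c_i^{n,p}(f)(x)=\sum f(x)^0\otimes\cdots\otimes (f(x)^i)_1\otimes(f(x)^i)_2\otimes\cdots\otimes f(x)^p$ ($\Delta$ applied to the $i$-th $A$-factor); - $c_{p+1}^{n,p}(f)(a^1\otimes\cdots\otimes a^n\otimes m)=\sum f((a^1)_1\otimes\cdots\otimes(a^n)_1\otimes m_0)\otimes (a^1)_2\cdots(a^n)_2m_1$. (Empty products, when $n=0$, equal $1$.) Finally $d_m^{n,p}=\sum_{i=0}^{n+1}(-1)^ib_i^{n,p}$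 and $d_c^{n,p}=\sum_{i=0}^{p+1}(-1)^ic_i^{n,p}$. *)

theory Defs
  imports Complex_Main "HOL-Library.Poly_Mapping" "HOL-Library.Set_Algebras" "HOL-Library.FuncSet"
begin

text \<open>
  Vector spaces over the field \<open>'k\<close> are types of class \<open>ab_group_add\<close> together with a scalar
  multiplication satisfying the library locale \<open>vector_space\<close>. A bialgebra has an underlying type
  of class \<open>ring_1\<close>; the axiom \<open>0 \<noteq> 1\<close> of that class is no restriction, because the counit maps
  the unit of the algebra to the unit of the field.
\<close>

section \<open>Tensor products\<close>

text \<open>
  We use the tensor product of one space \<open>V\<close> with \<open>p\<close> copies of a space \<open>A\<close>, for all \<open>p\<close>. It is
  the quotient of the free vector space on the tuples \<open>(v, [a\<^sub>1, \<dots>, a\<^sub>p])\<close> by the subspace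
  expressing multilinearity, and its elements are cosets. All \<open>p\<close> share one type. Both
  \<open>N \<otimes> A\<^sup>p\<close> and \<open>A\<^sup>n \<otimes> M\<close> are instances; in the latter the tuple
  \<open>a\<^sub>1, \<dots>, a\<^sub>n, m\<close> is stored as \<open>(m, [a\<^sub>1, \<dots>, a\<^sub>n])\<close>.
\<close>

type_synonym ('v, 'a, 'k) tensor = "('v \<times> 'a list \<Rightarrow>\<^sub>0 'k) set"

definition free_scale :: "'k::field \<Rightarrow> ('x \<Rightarrow>\<^sub>0 'k) \<Rightarrow> ('x \<Rightarrow>\<^sub>0 'k)" where
  "free_scale c t = Poly_Mapping.map ((*) c) t"

definition multilinear_relations ::
  "('k::field \<Rightarrow> 'a::ab_group_add \<Rightarrow> 'a) \<Rightarrow> ('k \<Rightarrow> 'v::ab_group_add \<Rightarrow> 'v) \<Rightarrow> nat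
    \<Rightarrow> ('v \<times> 'a list \<Rightarrow>\<^sub>0 'k) set" where
  "multilinear_relations sA sV p =
     {Poly_Mapping.single (v + w, as) 1 - Poly_Mapping.single (v, as) 1
        - Poly_Mapping.single (w, as) 1 | v w as. length as = p}
   \<union> {Poly_Mapping.single (sV c v, as) 1 - Poly_Mapping.single (v, as) c
        | c v as. length as = p}
   \<union> {Poly_Mapping.single (v, as[i := a + b]) 1 - Poly_Mapping.single (v, as[i := a]) 1
        - Poly_Mapping.single (v, as[i := b]) 1 | v as i a b. length as = p \<and> i < p}
   \<union> {Poly_Mapping.single (v, as[i := sA c a]) 1 - Poly_Mapping.single (v, as[i := a]) c
        | c v as i a. length as = p \<and> i < p}"

definition tensor_null ::
  "('k::field \<Rightarrow> 'a::ab_group_add \<Rightarrow> 'a) \<Rightarrow> ('k \<Rightarrow> 'v::ab_group_add \<Rightarrow> 'v) \<Rightarrow> nat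
    \<Rightarrow> ('v, 'a, 'k) tensor" where
  "tensor_null sA sV p = module.span free_scale (multilinear_relations sA sV p)"

definition tensor_space ::
  "('k::field \<Rightarrow> 'a::ab_group_add \<Rightarrow> 'a) \<Rightarrow> ('k \<Rightarrow> 'v::ab_group_add \<Rightarrow> 'v) \<Rightarrow> nat
    \<Rightarrow> ('v, 'a, 'k) tensor set" where
  "tensor_space sA sV p =
     {t +o tensor_null sA sV p | t. \<forall>(v, as) \<in> Poly_Mapping.keys t. length as = p}"

definition pure ::
  "('k::field \<Rightarrow> 'a::ab_group_add \<Rightarrow> 'a) \<Rightarrow> ('k \<Rightarrow> 'v::ab_group_add \<Rightarrow> 'v) \<Rightarrow> 'v \<Rightarrow> 'a list
    \<Rightarrow> ('v, 'a, 'k) tensor" where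
  "pure sA sV v as = Poly_Mapping.single (v, as) 1 +o tensor_null sA sV (length as)"

text \<open>
  Cosets are added elementwise, by the addition on sets from \<open>Set_Algebras\<close>; the zero vector of
  \<open>V \<otimes> A\<^sup>p\<close> is the coset \<open>tensor_null sA sV p\<close>, not \<open>0 = {0}\<close>. Adding the null space below has
  an effect only where the scalar is zero or a sum is empty.
\<close>

definition tensor_scale ::
  "('k::field \<Rightarrow> 'a::ab_group_add \<Rightarrow> 'a) \<Rightarrow> ('k \<Rightarrow> 'v::ab_group_add \<Rightarrow> 'v) \<Rightarrow> nat
    \<Rightarrow> 'k \<Rightarrow> ('v, 'a, 'k) tensor \<Rightarrow> ('v, 'a, 'k) tensor" where
  "tensor_scale sA sV p c X = free_scale c ` X + tensor_null sA sV p"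

text \<open>
  Sweedler-style sums: a tensor \<open>X = \<Sum> v \<otimes> a\<^sub>1 \<otimes> \<dots> \<otimes> a\<^sub>q\<close> is written out by choosing a
  representative in the free space, and the terms \<open>g (v, [a\<^sub>1, \<dots>, a\<^sub>q])\<close> are summed up with the
  coefficients of that representative. For multilinear \<open>g\<close> the result does not depend on the choice and
  is the value at \<open>X\<close> of the linear map induced by \<open>g\<close>. The values of \<open>g\<close> lie in a space with
  scalar multiplication \<open>s\<close> for \<open>vec_sweedler s\<close>, and in \<open>V \<otimes> A\<^sup>p\<close> for \<open>sweedler sA sV p\<close>.
\<close>

definition vec_sweedler ::
  "('k::field \<Rightarrow> 'w::comm_monoid_add \<Rightarrow> 'w) \<Rightarrow> ('u, 'a, 'k) tensor \<Rightarrow> ('u \<times> 'a list \<Rightarrow> 'w) \<Rightarrow> 'w" where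
  "vec_sweedler s X g =
     (let t = (SOME t. t \<in> X) in \<Sum>x \<in> Poly_Mapping.keys t. s (Poly_Mapping.lookup t x) (g x))"

definition sweedler ::
  "('k::field \<Rightarrow> 'a::ab_group_add \<Rightarrow> 'a) \<Rightarrow> ('k \<Rightarrow> 'v::ab_group_add \<Rightarrow> 'v) \<Rightarrow> nat
    \<Rightarrow> ('u, 'a, 'k) tensor \<Rightarrow> ('u \<times> 'a list \<Rightarrow> ('v, 'a, 'k) tensor) \<Rightarrow> ('v, 'a, 'k) tensor" where
  "sweedler sA sV p X g = vec_sweedler (tensor_scale sA sV p) X g + tensor_null sA sV p"

definition linear_into_tensor ::
  "('k::field \<Rightarrow> 'a::ab_group_add \<Rightarrow> 'a) \<Rightarrow> ('k \<Rightarrow> 'v::ab_group_add \<Rightarrow> 'v) \<Rightarrow> nat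
    \<Rightarrow> ('k \<Rightarrow> 'w::ab_group_add \<Rightarrow> 'w) \<Rightarrow> ('w \<Rightarrow> ('v, 'a, 'k) tensor) \<Rightarrow> bool" where
  "linear_into_tensor sA sV p sW \<phi> \<longleftrightarrow>
     (\<forall>x. \<phi> x \<in> tensor_space sA sV p) \<and>
     (\<forall>x y. \<phi> (x + y) = \<phi> x + \<phi> y) \<and>
     (\<forall>c x. \<phi> (sW c x) = tensor_scale sA sV p c (\<phi> x))"

section \<open>Bialgebras and left-right Hopf modules\<close>

record (overloaded) ('k, 'a) bialg =
  scl :: "'k \<Rightarrow> 'a \<Rightarrow> 'a"
  comul :: "'a \<Rightarrow> ('a, 'a, 'k) tensor"
  counit :: "'a \<Rightarrow> 'k"

record (overloaded) ('k, 'a, 'm) hopf_mod =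
  mscl :: "'k \<Rightarrow> 'm \<Rightarrow> 'm"
  act :: "'a \<Rightarrow> 'm \<Rightarrow> 'm"
  coact :: "'m \<Rightarrow> ('m, 'a, 'k) tensor"

definition bialgebra :: "('k::field, 'a::ring_1) bialg \<Rightarrow> bool" where
  "bialgebra A \<longleftrightarrow>
     vector_space (scl A) \<and>
     (\<forall>c a b. scl A c a * b = scl A c (a * b)) \<and>
     (\<forall>c a b. a * scl A c b = scl A c (a * b)) \<and>
     linear_into_tensor (scl A) (scl A) 1 (scl A) (comul A) \<and>
     Vector_Spaces.linear (scl A) (*) (counit A) \<and>
     (\<forall>a. sweedler (scl A) (scl A) 2 (comul A a)
            (\<lambda>(u, ws). sweedler (scl A) (scl A) 2 (comul A u)
              (\<lambda>(x, ys). pure (scl A) (scl A) x (ys @ ws)))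
        = sweedler (scl A) (scl A) 2 (comul A a)
            (\<lambda>(u, ws). sweedler (scl A) (scl A) 2 (comul A (hd ws))
              (\<lambda>(x, ys). pure (scl A) (scl A) u (x # ys)))) \<and>
     (\<forall>a. vec_sweedler (scl A) (comul A a) (\<lambda>(u, ws). scl A (counit A u) (hd ws)) = a) \<and>
     (\<forall>a. vec_sweedler (scl A) (comul A a) (\<lambda>(u, ws). scl A (counit A (hd ws)) u) = a) \<and>
     (\<forall>a b. comul A (a * b) =
        sweedler (scl A) (scl A) 1 (comul A a)
          (\<lambda>(u, us). sweedler (scl A) (scl A) 1 (comul A b)
            (\<lambda>(w, ws). pure (scl A) (scl A) (u * w) (map2 (*) us ws)))) \<and>
     comul A 1 = pure (scl A) (scl A) 1 [1] \<and>
     (\<forall>a b. counit A (a * b) = counit A a * counit A b) \<and>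
     counit A 1 = 1"

definition hopf_module ::
  "('k::field, 'a::ring_1) bialg \<Rightarrow> ('k, 'a, 'm::ab_group_add) hopf_mod \<Rightarrow> bool" where
  "hopf_module A M \<longleftrightarrow>
     vector_space (mscl M) \<and>
     (\<forall>a x y. act M a (x + y) = act M a x + act M a y) \<and>
     (\<forall>a b x. act M (a + b) x = act M a x + act M b x) \<and>
     (\<forall>c a x. act M a (mscl M c x) = mscl M c (act M a x)) \<and>
     (\<forall>c a x. act M (scl A c a) x = mscl M c (act M a x)) \<and>
     (\<forall>a b x. act M (a * b) x = act M a (act M b x)) \<and>
     (\<forall>x. act M 1 x = x) \<and>
     linear_into_tensor (scl A) (mscl M) 1 (mscl M) (coact M) \<and>
     (\<forall>m. sweedler (scl A) (mscl M) 2 (coact M m)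
            (\<lambda>(x, ws). sweedler (scl A) (mscl M) 2 (coact M x)
              (\<lambda>(y, vs). pure (scl A) (mscl M) y (vs @ ws)))
        = sweedler (scl A) (mscl M) 2 (coact M m)
            (\<lambda>(x, ws). sweedler (scl A) (mscl M) 2 (comul A (hd ws))
              (\<lambda>(u, us). pure (scl A) (mscl M) x (u # us)))) \<and>
     (\<forall>m. vec_sweedler (mscl M) (coact M m) (\<lambda>(x, ws). mscl M (counit A (hd ws)) x) = m) \<and>
     (\<forall>a m. coact M (act M a m) =
        sweedler (scl A) (mscl M) 1 (comul A a)
          (\<lambda>(u, us). sweedler (scl A) (mscl M) 1 (coact M m)
            (\<lambda>(x, ws). pure (scl A) (mscl M) (act M u x) (map2 (*) us ws))))"

section \<open>The cochain spaces\<close>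

definition cochains ::
  "('k::field, 'a::ring_1) bialg \<Rightarrow> ('k, 'a, 'm::ab_group_add) hopf_mod
    \<Rightarrow> ('k, 'a, 'n::ab_group_add) hopf_mod \<Rightarrow> nat \<Rightarrow> nat
    \<Rightarrow> (('m, 'a, 'k) tensor \<Rightarrow> ('n, 'a, 'k) tensor) set" where
  "cochains A M N n p =
     {f \<in> tensor_space (scl A) (mscl M) n \<rightarrow>\<^sub>E tensor_space (scl A) (mscl N) p.
        (\<forall>X \<in> tensor_space (scl A) (mscl M) n. \<forall>Y \<in> tensor_space (scl A) (mscl M) n.
           f (X + Y) = f X + f Y) \<and>
        (\<forall>c. \<forall>X \<in> tensor_space (scl A) (mscl M) n.
           f (tensor_scale (scl A) (mscl M) n c X) = tensor_scale (scl A) (mscl N) p c (f X))}"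

definition cochain_zero ::
  "('k::field, 'a::ring_1) bialg \<Rightarrow> ('k, 'a, 'm::ab_group_add) hopf_mod
    \<Rightarrow> ('k, 'a, 'n::ab_group_add) hopf_mod \<Rightarrow> nat \<Rightarrow> nat
    \<Rightarrow> ('m, 'a, 'k) tensor \<Rightarrow> ('n, 'a, 'k) tensor" where
  "cochain_zero A M N n p =
     (\<lambda>X \<in> tensor_space (scl A) (mscl M) n. tensor_null (scl A) (mscl N) p)"

definition cochain_add ::
  "('k::field, 'a::ring_1) bialg \<Rightarrow> ('k, 'a, 'm::ab_group_add) hopf_mod \<Rightarrow> nat
    \<Rightarrow> (('m, 'a, 'k) tensor \<Rightarrow> ('n::ab_group_add, 'a, 'k) tensor)
    \<Rightarrow> (('m, 'a, 'k) tensor \<Rightarrow> ('n, 'a, 'k) tensor)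
    \<Rightarrow> ('m, 'a, 'k) tensor \<Rightarrow> ('n, 'a, 'k) tensor" where
  "cochain_add A M n f g = (\<lambda>X \<in> tensor_space (scl A) (mscl M) n. f X + g X)"

definition cochain_scale ::
  "('k::field, 'a::ring_1) bialg \<Rightarrow> ('k, 'a, 'm::ab_group_add) hopf_mod
    \<Rightarrow> ('k, 'a, 'n::ab_group_add) hopf_mod \<Rightarrow> nat \<Rightarrow> nat \<Rightarrow> 'k
    \<Rightarrow> (('m, 'a, 'k) tensor \<Rightarrow> ('n, 'a, 'k) tensor)
    \<Rightarrow> ('m, 'a, 'k) tensor \<Rightarrow> ('n, 'a, 'k) tensor" where
  "cochain_scale A M N n p c f =
     (\<lambda>X \<in> tensor_space (scl A) (mscl M) n. tensor_scale (scl A) (mscl N) p c (f X))"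

definition cochain_linear ::
  "('k::field, 'a::ring_1) bialg \<Rightarrow> ('k, 'a, 'm::ab_group_add) hopf_mod
    \<Rightarrow> ('k, 'a, 'n::ab_group_add) hopf_mod \<Rightarrow> nat \<Rightarrow> nat \<Rightarrow> nat \<Rightarrow> nat
    \<Rightarrow> ((('m, 'a, 'k) tensor \<Rightarrow> ('n, 'a, 'k) tensor) \<Rightarrow> ('m, 'a, 'k) tensor \<Rightarrow> ('n, 'a, 'k) tensor)
    \<Rightarrow> bool" where
  "cochain_linear A M N n p n' p' D \<longleftrightarrow>
     D \<in> cochains A M N n p \<rightarrow> cochains A M N n' p' \<and>
     (\<forall>f \<in> cochains A M N n p. \<forall>g \<in> cochains A M N n p.
        D (cochain_add A M n f g) = cochain_add A M n' (D f) (D g)) \<and>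
     (\<forall>c. \<forall>f \<in> cochains A M N n p.
        D (cochain_scale A M N n p c f) = cochain_scale A M N n' p' c (D f))"

section \<open>The differentials\<close>

text \<open>\<open>comul_iter A p a\<close> is \<open>\<Sum> a\<^sub>1 \<otimes> \<dots> \<otimes> a\<^bsub>p+1\<^esub>\<close>.\<close>

primrec comul_iter :: "('k::field, 'a::ring_1) bialg \<Rightarrow> nat \<Rightarrow> 'a \<Rightarrow> ('a, 'a, 'k) tensor" where
  "comul_iter A 0 a = pure (scl A) (scl A) a []"
| "comul_iter A (Suc p) a =
     sweedler (scl A) (scl A) (Suc p) (comul A a)
       (\<lambda>(u, ws). sweedler (scl A) (scl A) (Suc p) (comul_iter A p (hd ws))
         (\<lambda>(x, ys). pure (scl A) (scl A) u (x # ys)))"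

text \<open>
  \<open>codiag A M [a\<^sup>1, \<dots>, a\<^sup>n] m\<close> is the tensor
  \<open>\<Sum> (a\<^sup>1)\<^sub>1 \<otimes> \<dots> \<otimes> (a\<^sup>n)\<^sub>1 \<otimes> m\<^sub>0 \<otimes> (a\<^sup>1)\<^sub>2 \<cdots> (a\<^sup>n)\<^sub>2 m\<^sub>1\<close>, in which a term is stored as the tuple
  \<open>(m\<^sub>0, [(a\<^sup>1)\<^sub>1, \<dots>, (a\<^sup>n)\<^sub>1, (a\<^sup>1)\<^sub>2 \<cdots> (a\<^sup>n)\<^sub>2 m\<^sub>1])\<close>.
\<close>

primrec codiag :: "('k::field, 'a::ring_1) bialg \<Rightarrow> ('k, 'a, 'm::ab_group_add) hopf_mod
    \<Rightarrow> 'a list \<Rightarrow> 'm \<Rightarrow> ('m, 'a, 'k) tensor" where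
  "codiag A M [] m = coact M m"
| "codiag A M (a # as) m =
     sweedler (scl A) (mscl M) (Suc (Suc (length as))) (comul A a)
       (\<lambda>(u, ws). sweedler (scl A) (mscl M) (Suc (Suc (length as))) (codiag A M as m)
         (\<lambda>(x, ys). pure (scl A) (mscl M) x (u # butlast ys @ [hd ws * last ys])))"

text \<open>
  In \<open>b_map\<close> and \<open>c_map\<close> tensor factors are numbered from \<open>1\<close> but list positions from \<open>0\<close>.
\<close>

definition b_map ::
  "('k::field, 'a::ring_1) bialg \<Rightarrow> ('k, 'a, 'm::ab_group_add) hopf_mod
    \<Rightarrow> ('k, 'a, 'n::ab_group_add) hopf_mod \<Rightarrow> nat \<Rightarrow> nat \<Rightarrow> nat
    \<Rightarrow> (('m, 'a, 'k) tensor \<Rightarrow> ('n, 'a, 'k) tensor)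
    \<Rightarrow> ('m, 'a, 'k) tensor \<Rightarrow> ('n, 'a, 'k) tensor" where
  "b_map A M N n p i f =
     (\<lambda>X \<in> tensor_space (scl A) (mscl M) (n + 1).
        sweedler (scl A) (mscl N) p X (\<lambda>(m, as).
          if i = 0 then
            sweedler (scl A) (mscl N) p (comul_iter A p (hd as)) (\<lambda>(u, us).
              sweedler (scl A) (mscl N) p (f (pure (scl A) (mscl M) m (tl as))) (\<lambda>(y, bs).
                pure (scl A) (mscl N) (act N u y) (map2 (*) us bs)))
          else if i \<le> n then
            f (pure (scl A) (mscl M) m (take (i - 1) as @ (as ! (i - 1) * as ! i) # drop (i + 1) as))
          else f (pure (scl A) (mscl M) (act M (last as) m) (butlast as))))"

definition c_map ::
  "('k::field, 'a::ring_1) bialg \<Rightarrow> ('k, 'a, 'm::ab_group_add) hopf_mod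
    \<Rightarrow> ('k, 'a, 'n::ab_group_add) hopf_mod \<Rightarrow> nat \<Rightarrow> nat \<Rightarrow> nat
    \<Rightarrow> (('m, 'a, 'k) tensor \<Rightarrow> ('n, 'a, 'k) tensor)
    \<Rightarrow> ('m, 'a, 'k) tensor \<Rightarrow> ('n, 'a, 'k) tensor" where
  "c_map A M N n p i f =
     (\<lambda>X \<in> tensor_space (scl A) (mscl M) n.
        if i = 0 then
          sweedler (scl A) (mscl N) (p + 1) (f X) (\<lambda>(y, bs).
            sweedler (scl A) (mscl N) (p + 1) (coact N y) (\<lambda>(z, ws).
              pure (scl A) (mscl N) z (ws @ bs)))
        else if i \<le> p then
          sweedler (scl A) (mscl N) (p + 1) (f X) (\<lambda>(y, bs).
            sweedler (scl A) (mscl N) (p + 1) (comul A (bs ! (i - 1))) (\<lambda>(u, ws).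
              pure (scl A) (mscl N) y (take (i - 1) bs @ u # ws @ drop i bs)))
        else
          sweedler (scl A) (mscl N) (p + 1) X (\<lambda>(m, as).
            sweedler (scl A) (mscl N) (p + 1) (codiag A M as m) (\<lambda>(x, ws).
              sweedler (scl A) (mscl N) (p + 1) (f (pure (scl A) (mscl M) x (butlast ws))) (\<lambda>(y, bs).
                pure (scl A) (mscl N) y (bs @ [last ws])))))"

definition d_m ::
  "('k::field, 'a::ring_1) bialg \<Rightarrow> ('k, 'a, 'm::ab_group_add) hopf_mod
    \<Rightarrow> ('k, 'a, 'n::ab_group_add) hopf_mod \<Rightarrow> nat \<Rightarrow> nat
    \<Rightarrow> (('m, 'a, 'k) tensor \<Rightarrow> ('n, 'a, 'k) tensor)
    \<Rightarrow> ('m, 'a, 'k) tensor \<Rightarrow> ('n, 'a, 'k) tensor" where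
  "d_m A M N n p f =
     (\<lambda>X \<in> tensor_space (scl A) (mscl M) (n + 1).
        \<Sum>i = 0..n + 1. tensor_scale (scl A) (mscl N) p ((- 1) ^ i) (b_map A M N n p i f X))"

definition d_c ::
  "('k::field, 'a::ring_1) bialg \<Rightarrow> ('k, 'a, 'm::ab_group_add) hopf_mod
    \<Rightarrow> ('k, 'a, 'n::ab_group_add) hopf_mod \<Rightarrow> nat \<Rightarrow> nat
    \<Rightarrow> (('m, 'a, 'k) tensor \<Rightarrow> ('n, 'a, 'k) tensor)
    \<Rightarrow> ('m, 'a, 'k) tensor \<Rightarrow> ('n, 'a, 'k) tensor" where
  "d_c A M N n p f =
     (\<lambda>X \<in> tensor_space (scl A) (mscl M) n.
        \<Sum>i = 0..p + 1. tensor_scale (scl A) (mscl N) (p + 1) ((- 1) ^ i) (c_map A M N n p i f X))"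

end

theory Submission
  imports Defs
begin

text \<open>
  A Sweedler sum behaves like a monadic bind whose unit is the pure tensor, provided its body is
  multilinear. Hence linear maps out of \<open>V \<otimes> A\<^sup>p\<close> may be compared on pure tensors, or on
  \<open>(V \<otimes> A\<^bsup>p-1\<^esup>) \<otimes> A\<close>, which turns every identity into an induction on the number of factors.

  The space \<open>N \<otimes> A\<^sup>p\<close> is a left module by the diagonal action and carries coface maps \<open>\<delta>\<^sub>j\<close>
  (\<open>0 \<le> j \<le> p\<close>), which are linear over \<open>A\<close>; the space \<open>A\<^sup>n \<otimes> M\<close> is a right comodule by the codiagonal
  coaction \<open>\<rho>\<close> and carries face maps \<open>\<mu>\<^sub>i\<close> (\<open>1 \<le> i \<le> n\<close>), which are colinear. In these terms
  \<open>b\<^sub>0 f (a \<otimes> x) = a \<cdot> f x\<close>, \<open>b\<^sub>i f = f \<circ> \<mu>\<^sub>i\<close> for \<open>i > 0\<close>, \<open>c\<^sub>j f = \<delta>\<^sub>j \<circ> f\<close> for \<open>j \<le> p\<close>, and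
  the last \<open>c\<close> is \<open>(f \<otimes> id) \<circ> \<rho>\<close>. So the \<open>b\<^sub>i\<close> and the \<open>c\<^sub>j\<close> are cosimplicial and commute with
  each other.
\<close>

section \<open>Cosets and linear maps\<close>

text \<open>Tensors are sets of representatives: the type has no negatives, its empty sum is
  \<open>{0}\<close> instead of the zero tensor, and a Sweedler sum depends a priori on a chosen
  representative. Linear algebra therefore happens in the free space, linearity is stated relative
  to a carrier, and every change of variables in a Sweedler sum has to be backed by a linearity
  proof.

  The two sides of a cochain recurse from opposite ends. In \<open>N \<otimes> A^p\<close> the
  distinguished factor \<open>N\<close> stands at the left, so induction removes the rightmost
  \<open>A\<close>; in \<open>A^n \<otimes> M\<close> the factor \<open>M\<close> stands at the
  right, so induction removes the leftmost \<open>A\<close>. Either way the induction step sees the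
  tensor product of a smaller space with one copy of \<open>A\<close> and is settled by
  associativity of \<open>A\<close> and by coassociativity and multiplicativity of its
  comultiplication. Associativity and coassociativity of the Hopf modules, and their compatibility,
  enter only in the base cases.\<close>

lemma lookup_free_scale [simp]:
  "Poly_Mapping.lookup (free_scale c t) x = c * Poly_Mapping.lookup t x"
  by (simp add: free_scale_def Poly_Mapping.map.rep_eq when_def)

interpretation fs: vector_space "free_scale :: 'k::field \<Rightarrow> ('x \<Rightarrow>\<^sub>0 'k) \<Rightarrow> ('x \<Rightarrow>\<^sub>0 'k)"
  by unfold_locales (auto intro!: poly_mapping_eqI simp: lookup_add algebra_simps)

text \<open>The linear extension of \<open>r\<close>. By \<open>sw_rep\<close> it is the counterpart
  in the free space of a Sweedler sum, so facts about sums of cosets reduce to facts about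
  vectors.\<close>

definition free_ext :: "('x \<Rightarrow> ('y \<Rightarrow>\<^sub>0 'k::field)) \<Rightarrow> ('x \<Rightarrow>\<^sub>0 'k) \<Rightarrow> ('y \<Rightarrow>\<^sub>0 'k)" where
  "free_ext r t = (\<Sum>x\<in>Poly_Mapping.keys t. free_scale (Poly_Mapping.lookup t x) (r x))"

text \<open>Keys may cancel when vectors are added or scaled. Over a common finite superset, where
  the extra coefficients vanish, linearity of \<open>free_ext\<close> becomes a termwise
  matter.\<close>

lemma free_ext_superset:
  assumes "finite S" "Poly_Mapping.keys t \<subseteq> S"
  shows "free_ext r t = (\<Sum>x\<in>S. free_scale (Poly_Mapping.lookup t x) (r x))"
  unfolding free_ext_def
  by (rule sum.mono_neutral_left) (use assms in \<open>auto simp: in_keys_iff\<close>)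

lemma free_ext_add: "free_ext r (s + t) = free_ext r s + free_ext r t"
proof -
  let ?S = "Poly_Mapping.keys s \<union> Poly_Mapping.keys t"
  have "Poly_Mapping.keys (s + t) \<subseteq> ?S" by (rule Poly_Mapping.keys_add)
  then show ?thesis
    by (simp add: free_ext_superset[where S = ?S] lookup_add fs.scale_left_distrib sum.distrib)
qed

lemma free_ext_scale: "free_ext r (free_scale c t) = free_scale c (free_ext r t)"
proof -
  have "Poly_Mapping.keys (free_scale c t) \<subseteq> Poly_Mapping.keys t"
    by (auto simp: in_keys_iff)
  then show ?thesis
    by (simp add: free_ext_superset[where S = "Poly_Mapping.keys t"] fs.scale_sum_right)
qed

lemma free_ext_diff: "free_ext r (s - t) = free_ext r s - free_ext r t"
  using free_ext_add[of r "s - t" t] by (simp add: algebra_simps)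

lemma free_ext_single: "free_ext r (Poly_Mapping.single x c) = free_scale c (r x)"
  by (cases "c = 0") (simp_all add: free_ext_def)

lemma free_scale_single:
  "free_scale c (Poly_Mapping.single x d) = Poly_Mapping.single x (c * d)"
  by (rule poly_mapping_eqI) (simp add: lookup_single when_def)

lemma free_ext_id: "free_ext (\<lambda>x. Poly_Mapping.single x 1) t = t"
  by (rule poly_mapping_eqI)
     (auto simp: free_ext_def lookup_sum lookup_single when_def in_keys_iff
       if_distrib[where f = "\<lambda>y. _ * y"] cong: if_cong)

lemma free_ext_in_span:
  assumes "t \<in> fs.span S" and "\<And>s. s \<in> S \<Longrightarrow> free_ext r s \<in> fs.span R"
  shows "free_ext r t \<in> fs.span R"
  using assms(1)
proof (induction rule: fs.span_induct_alt)
  case base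
  show ?case by (simp add: free_ext_def fs.span_zero)
next
  case (step c x y)
  then show ?case
    by (simp add: free_ext_add free_ext_scale fs.span_add fs.span_scale assms(2))
qed

locale tensor_calculus =
  fixes sA :: "'k::field \<Rightarrow> 'a::ab_group_add \<Rightarrow> 'a"
begin

abbreviation "T \<equiv> tensor_space sA"
abbreviation "null \<equiv> tensor_null sA"
abbreviation "ts \<equiv> tensor_scale sA"
abbreviation "sw \<equiv> sweedler sA"
abbreviation "pr \<equiv> pure sA"

definition tup :: "nat \<Rightarrow> ('v \<times> 'a list \<Rightarrow>\<^sub>0 'k) \<Rightarrow> bool" where
  "tup p t \<longleftrightarrow> (\<forall>x\<in>Poly_Mapping.keys t. length (snd x) = p)"

text \<open>The lengths of the tuples are controlled separately by \<open>tup\<close>, so the coset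
  arithmetic below carries no length hypotheses.\<close>

definition cl :: "('k \<Rightarrow> 'v::ab_group_add \<Rightarrow> 'v) \<Rightarrow> nat \<Rightarrow> ('v \<times> 'a list \<Rightarrow>\<^sub>0 'k) \<Rightarrow> ('v, 'a, 'k) tensor"
  where "cl sV p t = t +o null sV p"

lemma tup_add: "tup p s \<Longrightarrow> tup p t \<Longrightarrow> tup p (s + t)"
  using Poly_Mapping.keys_add[of s t] by (auto simp: tup_def)

lemma tup_scale: "tup p t \<Longrightarrow> tup p (free_scale c t)"
  by (auto simp: tup_def in_keys_iff)

lemma tup_0: "tup p 0"
  by (simp add: tup_def)

lemma tup_diff: "tup p s \<Longrightarrow> tup p t \<Longrightarrow> tup p (s - t)"
  using Poly_Mapping.keys_diff[of s t] by (auto simp: tup_def)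

lemma tup_single: "length as = p \<Longrightarrow> tup p (Poly_Mapping.single (v, as) c)"
  by (auto simp: tup_def)

text \<open>Each generating relation involves tuples of length \<open>p\<close> only. Hence passing
  to another representative of a coset cannot introduce tuples of a wrong length.\<close>

lemma tup_null: "t \<in> null sV p \<Longrightarrow> tup p t"
  unfolding tensor_null_def
proof (induction rule: fs.span_induct_alt)
  case base
  show ?case by (rule tup_0)
next
  case (step c x y)
  have "tup p x"
    using step(1) unfolding multilinear_relations_def
    by (auto intro!: tup_diff tup_single)
  then show ?case by (intro tup_add tup_scale step)
qed

lemma null_add: "s \<in> null sV p \<Longrightarrow> t \<in> null sV p \<Longrightarrow> s + t \<in> null sV p"
  and null_diff: "s \<in> null sV p \<Longrightarrow> t \<in> null sV p \<Longrightarrow> s - t \<in> null sV p"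
  and null_scale: "t \<in> null sV p \<Longrightarrow> free_scale c t \<in> null sV p"
  and null_0: "0 \<in> null sV p"
  by (simp_all add: tensor_null_def fs.span_add fs.span_diff fs.span_scale fs.span_zero)

lemma in_cl_iff: "s \<in> cl sV p t \<longleftrightarrow> s - t \<in> null sV p"
proof
  assume "s - t \<in> null sV p"
  then have "t + (s - t) \<in> cl sV p t" unfolding cl_def by (rule set_plus_intro2)
  then show "s \<in> cl sV p t" by simp
qed (auto simp: cl_def elt_set_plus_def)

lemma cl_eq_iff: "cl sV p s = cl sV p t \<longleftrightarrow> s - t \<in> null sV p"
proof
  assume "cl sV p s = cl sV p t"
  moreover have "s \<in> cl sV p s" by (simp add: in_cl_iff null_0)
  ultimately show "s - t \<in> null sV p" by (simp add: in_cl_iff)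
next
  assume *: "s - t \<in> null sV p"
  have "x - s \<in> null sV p \<longleftrightarrow> x - t \<in> null sV p" for x
    using null_add[OF _ *, of "x - s"] null_diff[OF _ *, of "x - t"] by auto
  then show "cl sV p s = cl sV p t" by (auto simp: in_cl_iff)
qed

lemma null_eq_cl: "null sV p = cl sV p 0"
  by (auto simp: in_cl_iff)

lemma cl_add: "cl sV p s + cl sV p t = cl sV p (s + t)"
proof (intro set_eqI iffI)
  fix x assume "x \<in> cl sV p s + cl sV p t"
  then obtain y z where "x = y + z" "y - s \<in> null sV p" "z - t \<in> null sV p"
    by (auto elim!: set_plus_elim simp: in_cl_iff)
  then show "x \<in> cl sV p (s + t)"
    using null_add[of "y - s" sV p "z - t"] by (simp add: in_cl_iff algebra_simps)
next
  fix x assume "x \<in> cl sV p (s + t)"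
  then have "(x - t) + t \<in> cl sV p s + cl sV p t"
    by (intro set_plus_intro) (auto simp: in_cl_iff null_0 algebra_simps)
  then show "x \<in> cl sV p s + cl sV p t" by simp
qed

lemma cl_scale: "ts sV p c (cl sV p t) = cl sV p (free_scale c t)"
proof (intro set_eqI iffI)
  fix x assume "x \<in> ts sV p c (cl sV p t)"
  then obtain y z where "x = free_scale c y + z" "y - t \<in> null sV p" "z \<in> null sV p"
    by (auto elim!: set_plus_elim simp: in_cl_iff tensor_scale_def)
  then show "x \<in> cl sV p (free_scale c t)"
    using null_add[OF null_scale[of "y - t" sV p c], of z]
    by (simp add: in_cl_iff fs.scale_right_diff_distrib algebra_simps)
next
  fix x assume "x \<in> cl sV p (free_scale c t)"
  then have "free_scale c t + (x - free_scale c t) \<in> ts sV p c (cl sV p t)"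
    unfolding tensor_scale_def
    by (intro set_plus_intro imageI) (auto simp: in_cl_iff null_0)
  then show "x \<in> ts sV p c (cl sV p t)" by simp
qed

lemma T_iff: "X \<in> T sV p \<longleftrightarrow> (\<exists>t. tup p t \<and> X = cl sV p t)"
  unfolding tensor_space_def tup_def cl_def split_beta by fast

lemma cl_in_T: "tup p t \<Longrightarrow> cl sV p t \<in> T sV p"
  by (auto simp: T_iff)

text \<open>The chosen element differs from a representative by an element of the null space, which
  again consists of \<open>p\<close>-tuples. This is what makes the choice inside
  \<open>vec_sweedler\<close> usable.\<close>

lemma some_rep:
  assumes "X \<in> T sV p"
  shows "tup p (SOME t. t \<in> X)" "X = cl sV p (SOME t. t \<in> X)"
proof -
  obtain t where t: "tup p t" "X = cl sV p t" using assms by (auto simp: T_iff)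
  have "t \<in> X" by (simp add: t in_cl_iff null_0)
  then have "(SOME t. t \<in> X) \<in> X" by (rule someI)
  then have *: "(SOME t. t \<in> X) - t \<in> null sV p" by (simp add: t in_cl_iff)
  show "X = cl sV p (SOME t. t \<in> X)" using * t by (metis cl_eq_iff)
  show "tup p (SOME t. t \<in> X)" using tup_add[OF tup_null[OF *] t(1)] by simp
qed

lemma T_add [intro, simp]: "X \<in> T sV p \<Longrightarrow> Y \<in> T sV p \<Longrightarrow> X + Y \<in> T sV p"
  by (metis T_iff cl_add tup_add)

lemma T_scale [intro, simp]: "X \<in> T sV p \<Longrightarrow> ts sV p c X \<in> T sV p"
  by (auto simp: T_iff cl_scale intro: tup_scale)

lemma T_null [intro, simp]: "null sV p \<in> T sV p"
  unfolding null_eq_cl by (intro cl_in_T tup_0)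

lemma pr_cl: "length as = p \<Longrightarrow> pr sV v as = cl sV p (Poly_Mapping.single (v, as) 1)"
  by (simp add: pure_def cl_def)

lemma pr_in_T [intro, simp]: "length as = p \<Longrightarrow> pr sV v as \<in> T sV p"
  by (simp add: pr_cl cl_in_T tup_single)

lemma add_null: "X \<in> T sV p \<Longrightarrow> X + null sV p = X"
  by (auto simp: T_iff null_eq_cl cl_add)

lemma ts_add: "X \<in> T sV p \<Longrightarrow> Y \<in> T sV p \<Longrightarrow> ts sV p c (X + Y) = ts sV p c X + ts sV p c Y"
  by (auto simp: T_iff cl_add cl_scale fs.scale_right_distrib)

lemma ts_ts: "X \<in> T sV p \<Longrightarrow> ts sV p c (ts sV p d X) = ts sV p (c * d) X"
  by (auto simp: T_iff cl_scale)

text \<open>The carrier \<open>C\<close> lies in a type with nothing but an addition.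
  \<open>C = UNIV\<close> covers maps out of a vector space, \<open>C = T sU q\<close> maps out of a
  tensor space, whose type is not a vector space.\<close>

definition lin :: "'x::plus set \<Rightarrow> ('k \<Rightarrow> 'x \<Rightarrow> 'x) \<Rightarrow> ('k \<Rightarrow> 'v::ab_group_add \<Rightarrow> 'v) \<Rightarrow> nat
    \<Rightarrow> ('x \<Rightarrow> ('v, 'a, 'k) tensor) \<Rightarrow> bool" where
  "lin C s sV p \<phi> \<longleftrightarrow> (\<forall>x\<in>C. \<phi> x \<in> T sV p) \<and> (\<forall>x\<in>C. \<forall>y\<in>C. \<phi> (x + y) = \<phi> x + \<phi> y)
     \<and> (\<forall>c. \<forall>x\<in>C. \<phi> (s c x) = ts sV p c (\<phi> x))"

definition vlin :: "'x::plus set \<Rightarrow> ('k \<Rightarrow> 'x \<Rightarrow> 'x) \<Rightarrow> ('k \<Rightarrow> 'w::plus \<Rightarrow> 'w) \<Rightarrow> ('x \<Rightarrow> 'w) \<Rightarrow> bool" where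
  "vlin C s sW h \<longleftrightarrow> (\<forall>x\<in>C. \<forall>y\<in>C. h (x + y) = h x + h y) \<and> (\<forall>c. \<forall>x\<in>C. h (s c x) = sW c (h x))"

text \<open>One list entry is singled out by splitting the list around it, so that the clause
  applies directly to lists given as concatenations.\<close>

definition mlin :: "('k \<Rightarrow> 'u::ab_group_add \<Rightarrow> 'u) \<Rightarrow> nat \<Rightarrow> ('k \<Rightarrow> 'v::ab_group_add \<Rightarrow> 'v) \<Rightarrow> nat
    \<Rightarrow> ('u \<Rightarrow> 'a list \<Rightarrow> ('v, 'a, 'k) tensor) \<Rightarrow> bool" where
  "mlin sU q sV p g \<longleftrightarrow> (\<forall>as. length as = q \<longrightarrow> lin UNIV sU sV p (\<lambda>u. g u as))
     \<and> (\<forall>u xs ys. Suc (length xs + length ys) = q \<longrightarrow> lin UNIV sA sV p (\<lambda>a. g u (xs @ a # ys)))"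

abbreviation "tlin sU q \<equiv> lin (T sU q) (ts sU q)"

lemma lin_in_T: "lin C s sV p \<phi> \<Longrightarrow> x \<in> C \<Longrightarrow> \<phi> x \<in> T sV p"
  by (simp add: lin_def)

lemma mlin_in_T: "mlin sU q sV p g \<Longrightarrow> length as = q \<Longrightarrow> g u as \<in> T sV p"
  by (simp add: mlin_def lin_def)

text \<open>Without negatives, additivity alone does not give the value at zero; it comes from
  homogeneity at the scalar \<open>0\<close>.\<close>

lemma lin_null:
  assumes "tlin sU q sV p \<phi>"
  shows "\<phi> (null sU q) = null sV p"
proof -
  have "null sU q = ts sU q 0 (null sU q)"
    by (simp add: null_eq_cl cl_scale)
  then have "\<phi> (null sU q) = ts sV p 0 (\<phi> (null sU q))"
    using assms unfolding lin_def by (metis T_null)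
  also have "\<dots> = null sV p"
    using lin_in_T[OF assms T_null] by (auto simp: T_iff null_eq_cl cl_scale)
  finally show ?thesis .
qed

lemma lin_cong: "lin C s sV p \<phi> \<Longrightarrow> (\<And>x. x \<in> C \<Longrightarrow> \<psi> x = \<phi> x) \<Longrightarrow>
    (\<And>x y. x \<in> C \<Longrightarrow> y \<in> C \<Longrightarrow> x + y \<in> C) \<Longrightarrow> (\<And>c x. x \<in> C \<Longrightarrow> s c x \<in> C) \<Longrightarrow> lin C s sV p \<psi>"
  by (simp add: lin_def)

lemma tlin_cong: "tlin sU q sV p \<phi> \<Longrightarrow> (\<And>x. x \<in> T sU q \<Longrightarrow> \<psi> x = \<phi> x) \<Longrightarrow> tlin sU q sV p \<psi>"
  by (erule lin_cong) auto

section \<open>Sweedler sums\<close>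

text \<open>In the empty case the sum is \<open>{0}\<close>, and only the added null space turns it
  into the zero coset; the cosets of further terms absorb it.\<close>

lemma sum_cl:
  assumes "finite S" "\<And>x. x \<in> S \<Longrightarrow> g x = cl sV p (r x)"
  shows "(\<Sum>x\<in>S. ts sV p (c x) (g x)) + null sV p = cl sV p (\<Sum>x\<in>S. free_scale (c x) (r x))"
  using assms
  by (induction S) (simp_all add: null_eq_cl cl_scale cl_add add.assoc)

lemma sw_rep:
  assumes X: "X \<in> T sU q" and g: "\<And>u as. length as = q \<Longrightarrow> g u as = cl sV p (r (u, as))"
  shows "sw sV p X (\<lambda>(u, as). g u as) = cl sV p (free_ext r (SOME t. t \<in> X))"
  unfolding sweedler_def vec_sweedler_def Let_def free_ext_def
  by (rule sum_cl) (use some_rep(1)[OF X] g in \<open>auto simp: tup_def\<close>)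

lemma choose_rep:
  assumes "\<And>u as. length as = q \<Longrightarrow> g u as \<in> T sV p"
  obtains r where "\<And>u as. length as = q \<Longrightarrow> g u as = cl sV p (r (u, as))"
    "\<And>x. length (snd x) = q \<Longrightarrow> tup p (r x)"
proof
  let ?r = "\<lambda>(u, as). SOME t. t \<in> g u as"
  show "g u as = cl sV p (?r (u, as))" if "length as = q" for u as
    using some_rep(2)[OF assms[OF that]] by simp
  show "tup p (?r x)" if "length (snd x) = q" for x
    using some_rep(1)[OF assms[OF that]] by (simp add: split_beta)
qed

lemma tup_ext: "tup q t \<Longrightarrow> (\<And>x. length (snd x) = q \<Longrightarrow> tup p (r x)) \<Longrightarrow> tup p (free_ext r t)"
  unfolding free_ext_def
proof -
  assume a: "tup q t" "\<And>x. length (snd x) = q \<Longrightarrow> tup p (r x)"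
  have "tup p (\<Sum>x\<in>S. free_scale (Poly_Mapping.lookup t x) (r x))"
    if "finite S" "S \<subseteq> Poly_Mapping.keys t" for S
    using that by induction (use a in \<open>auto simp: tup_def[of q] intro!: tup_add tup_0 tup_scale\<close>)
  then show "tup p (\<Sum>x\<in>Poly_Mapping.keys t. free_scale (Poly_Mapping.lookup t x) (r x))" by simp
qed

lemma sw_in_T [intro]:
  assumes "X \<in> T sU q" "\<And>u as. length as = q \<Longrightarrow> g u as \<in> T sV p"
  shows "sw sV p X (\<lambda>(u, as). g u as) \<in> T sV p"
proof -
  obtain r where r: "\<And>u as. length as = q \<Longrightarrow> g u as = cl sV p (r (u, as))"
    "\<And>x. length (snd x) = q \<Longrightarrow> tup p (r x)"
    using choose_rep[where g = g and q = q and p = p and sV = sV] assms(2) by metis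
  have "sw sV p X (\<lambda>(u, as). g u as) = cl sV p (free_ext r (SOME t. t \<in> X))"
    by (rule sw_rep[OF assms(1)]) (rule r(1))
  then show ?thesis
    by (simp add: cl_in_T tup_ext[OF some_rep(1)[OF assms(1)]] r(2))
qed

lemma sw_cong:
  assumes "X \<in> T sU q" "\<And>u as. length as = q \<Longrightarrow> g u as = h u as"
  shows "sw sV p X (\<lambda>(u, as). g u as) = sw sV p X (\<lambda>(u, as). h u as)"
proof -
  have "(\<Sum>x\<in>Poly_Mapping.keys (SOME t. t \<in> X). ts sV p (Poly_Mapping.lookup (SOME t. t \<in> X) x)
       (case x of (u, as) \<Rightarrow> g u as))
    = (\<Sum>x\<in>Poly_Mapping.keys (SOME t. t \<in> X). ts sV p (Poly_Mapping.lookup (SOME t. t \<in> X) x)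
       (case x of (u, as) \<Rightarrow> h u as))"
    by (rule sum.cong) (use some_rep(1)[OF assms(1)] assms(2) in \<open>auto simp: tup_def\<close>)
  then show ?thesis unfolding sweedler_def vec_sweedler_def Let_def by simp
qed

text \<open>All three sums run over the same chosen representative of \<open>X\<close>, so
  additivity holds term by term for arbitrary bodies.\<close>

lemma sw_add:
  assumes X: "X \<in> T sU q" and g: "\<And>u as. length as = q \<Longrightarrow> g u as \<in> T sV p"
    and h: "\<And>u as. length as = q \<Longrightarrow> h u as \<in> T sV p"
  shows "sw sV p X (\<lambda>(u, as). g u as + h u as)
    = sw sV p X (\<lambda>(u, as). g u as) + sw sV p X (\<lambda>(u, as). h u as)"
proof -
  obtain r where r: "\<And>u as. length as = q \<Longrightarrow> g u as = cl sV p (r (u, as))"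
    using choose_rep[where g = g and q = q and p = p and sV = sV] g by metis
  obtain r' where r': "\<And>u as. length as = q \<Longrightarrow> h u as = cl sV p (r' (u, as))"
    using choose_rep[where g = h and q = q and p = p and sV = sV] h by metis
  have "sw sV p X (\<lambda>(u, as). g u as + h u as)
    = cl sV p (free_ext (\<lambda>x. r x + r' x) (SOME t. t \<in> X))"
    by (rule sw_rep[OF X]) (simp add: r r' cl_add)
  moreover have "sw sV p X (\<lambda>(u, as). g u as) = cl sV p (free_ext r (SOME t. t \<in> X))"
    by (rule sw_rep[OF X]) (rule r)
  moreover have "sw sV p X (\<lambda>(u, as). h u as) = cl sV p (free_ext r' (SOME t. t \<in> X))"
    by (rule sw_rep[OF X]) (rule r')
  ultimately show ?thesis
    by (simp add: cl_add free_ext_def fs.scale_right_distrib sum.distrib)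
qed

lemma sw_scale:
  assumes X: "X \<in> T sU q" and g: "\<And>u as. length as = q \<Longrightarrow> g u as \<in> T sV p"
  shows "sw sV p X (\<lambda>(u, as). ts sV p c (g u as)) = ts sV p c (sw sV p X (\<lambda>(u, as). g u as))"
proof -
  obtain r where r: "\<And>u as. length as = q \<Longrightarrow> g u as = cl sV p (r (u, as))"
    using choose_rep[where g = g and q = q and p = p and sV = sV] g by metis
  have "sw sV p X (\<lambda>(u, as). ts sV p c (g u as))
    = cl sV p (free_ext (\<lambda>x. free_scale c (r x)) (SOME t. t \<in> X))"
    by (rule sw_rep[OF X]) (simp add: r cl_scale)
  moreover have "sw sV p X (\<lambda>(u, as). g u as) = cl sV p (free_ext r (SOME t. t \<in> X))"
    by (rule sw_rep[OF X]) (rule r)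
  ultimately show ?thesis
    by (simp add: cl_scale free_ext_def fs.scale_sum_right mult.commute)
qed

lemma lin_sw_body:
  assumes X: "X \<in> T sU q" and g: "\<And>u as. length as = q \<Longrightarrow> lin C s sV p (\<lambda>x. g x u as)"
  shows "lin C s sV p (\<lambda>x. sw sV p X (\<lambda>(u, as). g x u as))"
proof -
  note m = lin_in_T[OF g]
  have "sw sV p X (\<lambda>(u, as). g (x + y) u as)
      = sw sV p X (\<lambda>(u, as). g x u as) + sw sV p X (\<lambda>(u, as). g y u as)"
    if "x \<in> C" "y \<in> C" for x y
  proof -
    have "sw sV p X (\<lambda>(u, as). g (x + y) u as) = sw sV p X (\<lambda>(u, as). g x u as + g y u as)"
      by (rule sw_cong[OF X]) (use g that in \<open>auto simp: lin_def\<close>)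
    also have "\<dots> = sw sV p X (\<lambda>(u, as). g x u as) + sw sV p X (\<lambda>(u, as). g y u as)"
      by (rule sw_add[OF X]) (simp_all add: m that)
    finally show ?thesis .
  qed
  moreover have "sw sV p X (\<lambda>(u, as). g (s c x) u as) = ts sV p c (sw sV p X (\<lambda>(u, as). g x u as))"
    if "x \<in> C" for c x
  proof -
    have "sw sV p X (\<lambda>(u, as). g (s c x) u as) = sw sV p X (\<lambda>(u, as). ts sV p c (g x u as))"
      by (rule sw_cong[OF X]) (use g that in \<open>auto simp: lin_def\<close>)
    also have "\<dots> = ts sV p c (sw sV p X (\<lambda>(u, as). g x u as))"
      by (rule sw_scale[OF X]) (simp_all add: m that)
    finally show ?thesis .
  qed
  moreover have "sw sV p X (\<lambda>(u, as). g x u as) \<in> T sV p" if "x \<in> C" for x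
    by (rule sw_in_T[OF X]) (simp add: m that)
  ultimately show ?thesis
    unfolding lin_def by blast
qed

text \<open>Independence of the representative: two representatives differ by a combination of
  generating relations, and multilinearity of \<open>g\<close> says precisely that
  \<open>free_ext r\<close> sends each of the four kinds of relations into the null space.\<close>

lemma sw_cl:
  assumes g: "mlin sU q sV p g" and t: "tup q t"
    and r: "\<And>u as. length as = q \<Longrightarrow> g u as = cl sV p (r (u, as))"
  shows "sw sV p (cl sU q t) (\<lambda>(u, as). g u as) = cl sV p (free_ext r t)"
proof -
  let ?s = "SOME s. s \<in> cl sU q t"
  have "?s - t \<in> null sU q"
    using some_rep(2)[OF cl_in_T[OF t, of sU]] by (metis cl_eq_iff)
  moreover have "free_ext r d \<in> null sV p" if "d \<in> multilinear_relations sA sU q" for d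
    using that unfolding multilinear_relations_def
  proof (elim UnE CollectE exE conjE)
    fix v w as assume d: "d = Poly_Mapping.single (v + w, as) 1 - Poly_Mapping.single (v, as) 1
        - Poly_Mapping.single (w, as) 1" "length as = q"
    have "g (v + w) as = g v as + g w as" using g d(2) by (simp add: mlin_def lin_def)
    then show ?thesis
      using d by (simp add: r cl_add cl_eq_iff free_ext_diff free_ext_single free_ext_add diff_diff_eq)
  next
    fix c v as assume d: "d = Poly_Mapping.single (sU c v, as) 1 - Poly_Mapping.single (v, as) c"
      "length as = q"
    have "g (sU c v) as = ts sV p c (g v as)" using g d(2) by (simp add: mlin_def lin_def)
    then show ?thesis
      using d by (simp add: r cl_scale cl_eq_iff free_ext_diff free_ext_single)
  next
    fix v as i a b assume d: "d = Poly_Mapping.single (v, as[i := a + b]) 1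
        - Poly_Mapping.single (v, as[i := a]) 1 - Poly_Mapping.single (v, as[i := b]) 1"
      "length as = q" "i < q"
    have "lin UNIV sA sV p (\<lambda>a. g v (as[i := a]))"
      using g d(2,3) by (simp add: mlin_def upd_conv_take_nth_drop)
    then have "g v (as[i := a + b]) = g v (as[i := a]) + g v (as[i := b])" by (simp add: lin_def)
    then show ?thesis
      using d by (simp add: r cl_add cl_eq_iff free_ext_diff free_ext_single free_ext_add diff_diff_eq)
  next
    fix c v as i a assume d: "d = Poly_Mapping.single (v, as[i := sA c a]) 1
        - Poly_Mapping.single (v, as[i := a]) c" "length as = q" "i < q"
    have "lin UNIV sA sV p (\<lambda>a. g v (as[i := a]))"
      using g d(2,3) by (simp add: mlin_def upd_conv_take_nth_drop)
    then have "g v (as[i := sA c a]) = ts sV p c (g v (as[i := a]))" by (simp add: lin_def)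
    then show ?thesis
      using d by (simp add: r cl_scale cl_eq_iff free_ext_diff free_ext_single)
  qed
  ultimately have "free_ext r (?s - t) \<in> null sV p"
    unfolding tensor_null_def by (metis free_ext_in_span)
  moreover have "sw sV p (cl sU q t) (\<lambda>(u, as). g u as) = cl sV p (free_ext r ?s)"
    by (rule sw_rep[OF cl_in_T[OF t]]) (rule r)
  ultimately show ?thesis
    by (simp add: cl_eq_iff free_ext_diff)
qed

text \<open>The existence half of the universal property of the tensor product; \<open>sw_pr\<close>
  identifies the induced map on pure tensors.\<close>

lemma tlin_sw:
  assumes "mlin sU q sV p g"
  shows "tlin sU q sV p (\<lambda>X. sw sV p X (\<lambda>(u, as). g u as))"
proof -
  note m = mlin_in_T[OF assms]
  obtain r where r: "\<And>u as. length as = q \<Longrightarrow> g u as = cl sV p (r (u, as))"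
    using choose_rep[where g = g and q = q and p = p and sV = sV] m by metis
  note * = sw_cl[where r = r, OF assms _ r]
  show ?thesis
    unfolding lin_def
    by (auto intro!: sw_in_T m)
       (auto simp: T_iff * tup_add tup_scale cl_add cl_scale free_ext_add free_ext_scale)
qed

lemma sw_pr:
  assumes "mlin sU q sV p g" "length as = q"
  shows "sw sV p (pr sU u as) (\<lambda>(u, as). g u as) = g u as"
proof -
  note m = mlin_in_T[OF assms(1)]
  obtain r where r: "\<And>u as. length as = q \<Longrightarrow> g u as = cl sV p (r (u, as))"
    using choose_rep[where g = g and q = q and p = p and sV = sV] m by metis
  show ?thesis
    using sw_cl[where r = r, OF assms(1) tup_single r] assms(2)
    by (simp add: pr_cl r free_ext_single)
qed

lemma lin_comp:
  assumes "tlin sU q sV p \<psi>" "lin C s sU q \<phi>"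
  shows "lin C s sV p (\<lambda>x. \<psi> (\<phi> x))"
  using assms by (simp add: lin_def)

lemma lin_sw_arg:
  assumes "lin C s sU q \<phi>" "mlin sU q sV p g"
  shows "lin C s sV p (\<lambda>x. sw sV p (\<phi> x) (\<lambda>(u, as). g u as))"
  by (rule lin_comp[OF tlin_sw[OF assms(2)] assms(1)])

text \<open>Both sums use the same representative of \<open>X\<close>, so it suffices that
  \<open>\<phi>\<close> respects finite linear combinations.\<close>

lemma tlin_sw_swap:
  assumes \<phi>: "tlin sV p sW r \<phi>" and X: "X \<in> T sU q"
    and g: "\<And>u as. length as = q \<Longrightarrow> g u as \<in> T sV p"
  shows "\<phi> (sw sV p X (\<lambda>(u, as). g u as)) = sw sW r X (\<lambda>(u, as). \<phi> (g u as))"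
proof -
  obtain e where e: "\<And>u as. length as = q \<Longrightarrow> g u as = cl sV p (e (u, as))"
      "\<And>x. length (snd x) = q \<Longrightarrow> tup p (e x)"
    using choose_rep[where g = g and q = q and p = p and sV = sV] g by metis
  obtain d where d: "\<And>u as. length as = q \<Longrightarrow> \<phi> (g u as) = cl sW r (d (u, as))"
    using choose_rep[where g = "\<lambda>u as. \<phi> (g u as)" and q = q and p = r and sV = sW] 
      lin_in_T[OF \<phi> g] by metis
  let ?t = "SOME t. t \<in> X"
  let ?c = "Poly_Mapping.lookup ?t"
  \<comment> \<open>The length condition is carried through the induction because
    \<open>\<phi>\<close> is additive only on the tensor space, so every partial sum must be known
    to lie in it.\<close>
  have "\<phi> (cl sV p (\<Sum>x\<in>S. free_scale (?c x) (e x))) = cl sW r (\<Sum>x\<in>S. free_scale (?c x) (d x))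
      \<and> tup p (\<Sum>x\<in>S. free_scale (?c x) (e x))"
    if "finite S" "S \<subseteq> Poly_Mapping.keys ?t" for S
    using that
  proof induction
    case empty
    then show ?case using lin_null[OF \<phi>] by (simp add: null_eq_cl tup_0)
  next
    case (insert x S)
    obtain u as where x: "x = (u, as)" by (cases x)
    have l: "length as = q"
      using insert.prems some_rep(1)[OF X] unfolding tup_def x by fastforce
    have "\<phi> (cl sV p (e x)) = cl sW r (d x)" using d[OF l] e(1)[OF l] by (simp add: x)
    moreover have "tup p (e x)" using e(2) l by (simp add: x)
    ultimately show ?case
      using insert \<phi>
      by (simp add: cl_add[symmetric] cl_scale[symmetric] lin_def cl_in_T tup_add tup_scale)
  qed
  from this[of "Poly_Mapping.keys ?t"]
  have "\<phi> (cl sV p (free_ext e ?t)) = cl sW r (free_ext d ?t)" by (simp add: free_ext_def)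
  moreover have "sw sV p X (\<lambda>(u, as). g u as) = cl sV p (free_ext e ?t)"
    by (rule sw_rep[OF X]) (rule e(1))
  moreover have "sw sW r X (\<lambda>(u, as). \<phi> (g u as)) = cl sW r (free_ext d ?t)"
    by (rule sw_rep[OF X]) (rule d)
  ultimately show ?thesis by simp
qed

text \<open>The uniqueness half of the universal property: a tensor is the Sweedler sum of pure
  tensors over its own representative, and linear maps pass through that sum.\<close>

lemma tlin_pr_eqI:
  assumes \<phi>: "tlin sU q sV p \<phi>" and \<psi>: "tlin sU q sV p \<psi>"
    and eq: "\<And>u as. length as = q \<Longrightarrow> \<phi> (pr sU u as) = \<psi> (pr sU u as)" and X: "X \<in> T sU q"
  shows "\<phi> X = \<psi> X"
proof -
  have "sw sU q X (\<lambda>(u, as). pr sU u as)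
      = cl sU q (free_ext (\<lambda>x. Poly_Mapping.single x 1) (SOME t. t \<in> X))"
    by (rule sw_rep[OF X]) (rule pr_cl)
  also have "\<dots> = X"
    unfolding free_ext_id using some_rep(2)[OF X] by (rule sym)
  finally have X_eq: "sw sU q X (\<lambda>(u, as). pr sU u as) = X" .
  have "\<phi> (sw sU q X (\<lambda>(u, as). pr sU u as)) = sw sV p X (\<lambda>(u, as). \<phi> (pr sU u as))"
    by (rule tlin_sw_swap[OF \<phi> X]) (rule pr_in_T)
  also have "\<dots> = sw sV p X (\<lambda>(u, as). \<psi> (pr sU u as))"
    by (rule sw_cong[OF X]) (rule eq)
  also have "\<dots> = \<psi> (sw sU q X (\<lambda>(u, as). pr sU u as))"
    by (rule tlin_sw_swap[OF \<psi> X, symmetric]) (rule pr_in_T)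
  finally show ?thesis by (simp add: X_eq)
qed

text \<open>The representatives of \<open>X\<close> and \<open>Y\<close> are fixed, and one choice
  \<open>r\<close> of representatives for the values serves both orders; what remains is an exchange
  of two finite sums in the free space.\<close>

lemma sw_commute:
  assumes X: "X \<in> T sU q" and Y: "Y \<in> T sU' q'"
    and g: "\<And>u as v bs. length as = q \<Longrightarrow> length bs = q' \<Longrightarrow> g u as v bs \<in> T sV p"
  shows "sw sV p X (\<lambda>(u, as). sw sV p Y (\<lambda>(v, bs). g u as v bs))
    = sw sV p Y (\<lambda>(v, bs). sw sV p X (\<lambda>(u, as). g u as v bs))"
proof -
  define r where "r = (\<lambda>(u, as) (v, bs). SOME t. t \<in> g u as v bs)"
  have r: "g u as v bs = cl sV p (r (u, as) (v, bs))" if "length as = q" "length bs = q'" for u as v bs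
    using some_rep(2)[OF g[OF that]] by (simp add: r_def)
  let ?s = "SOME t. t \<in> X" and ?t = "SOME t. t \<in> Y"
  have 1: "sw sV p Y (\<lambda>(v, bs). g u as v bs) = cl sV p (free_ext (r (u, as)) ?t)"
    if "length as = q" for u as
    by (rule sw_rep[OF Y]) (simp add: r that)
  have 2: "sw sV p X (\<lambda>(u, as). g u as v bs) = cl sV p (free_ext (\<lambda>x. r x (v, bs)) ?s)"
    if "length bs = q'" for v bs
    by (rule sw_rep[OF X]) (simp add: r that)
  have "sw sV p X (\<lambda>(u, as). sw sV p Y (\<lambda>(v, bs). g u as v bs))
      = cl sV p (free_ext (\<lambda>x. free_ext (r x) ?t) ?s)"
    by (rule sw_rep[OF X]) (rule 1)
  moreover have "sw sV p Y (\<lambda>(v, bs). sw sV p X (\<lambda>(u, as). g u as v bs))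
      = cl sV p (free_ext (\<lambda>y. free_ext (\<lambda>x. r x y) ?s) ?t)"
    by (rule sw_rep[OF Y]) (rule 2)
  moreover have "free_ext (\<lambda>x. free_ext (r x) ?t) ?s = free_ext (\<lambda>y. free_ext (\<lambda>x. r x y) ?s) ?t"
    unfolding free_ext_def fs.scale_sum_right
    by (subst sum.swap) (simp add: mult.commute)
  ultimately show ?thesis by simp
qed

end

section \<open>Tensor factors at either end\<close>

text \<open>Goals about \<open>lin\<close> are mostly solved by descending through the term with
  these rules. Each new operation therefore comes with one rule for every argument in which it is
  linear, and with a rule for membership of its values.\<close>

named_theorems linear_rules

context tensor_calculus
begin

lemma relation_zero: "d \<in> multilinear_relations sA sV p \<Longrightarrow> d \<in> null sV p"
  unfolding tensor_null_def by (rule fs.span_base)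

lemma mlin_pr [linear_rules]: "mlin sV p sV p (pr sV)"
  unfolding mlin_def
proof (intro conjI allI impI)
  fix as :: "'a list" assume l: "length as = p"
  have "pr sV (v + w) as = pr sV v as + pr sV w as" for v w
  proof -
    have "Poly_Mapping.single (v + w, as) 1 - Poly_Mapping.single (v, as) 1
        - Poly_Mapping.single (w, as) 1 \<in> multilinear_relations sA sV p"
      unfolding multilinear_relations_def using l by (intro UnI1) blast
    from relation_zero[OF this] show ?thesis
      unfolding pr_cl[OF l] cl_add cl_eq_iff by (simp add: diff_diff_eq)
  qed
  moreover have "pr sV (sV c v) as = ts sV p c (pr sV v as)" for c v
  proof -
    have "Poly_Mapping.single (sV c v, as) 1 - Poly_Mapping.single (v, as) c
        \<in> multilinear_relations sA sV p"
      unfolding multilinear_relations_def using l by (intro UnI1[OF UnI1[OF UnI2]]) blast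
    from relation_zero[OF this] show ?thesis
      unfolding pr_cl[OF l] cl_scale cl_eq_iff free_scale_single by simp
  qed
  ultimately show "lin UNIV sV sV p (\<lambda>u. pr sV u as)"
    using l by (simp add: lin_def)
next
  fix v and xs ys :: "'a list" assume "Suc (length xs + length ys) = p"
  then have l: "length (xs @ a # ys) = p" for a by simp
  \<comment> \<open>The relations are phrased with list updates, so the slot receives a dummy entry
    that every update overwrites.\<close>
  define as where "as = xs @ undefined # ys"
  have upd: "xs @ a # ys = as[length xs := a]" for a by (simp add: as_def)
  have las: "length as = p" "length xs < p" using l[of undefined] by (auto simp: as_def)
  have "pr sV v (xs @ (a + b) # ys) = pr sV v (xs @ a # ys) + pr sV v (xs @ b # ys)" for a b
  proof -
    have "Poly_Mapping.single (v, xs @ (a + b) # ys) 1 - Poly_Mapping.single (v, xs @ a # ys) 1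
        - Poly_Mapping.single (v, xs @ b # ys) 1 \<in> multilinear_relations sA sV p"
      unfolding multilinear_relations_def upd using las by (intro UnI1[OF UnI2]) blast
    from relation_zero[OF this] show ?thesis
      unfolding pr_cl[OF l] cl_add cl_eq_iff by (simp add: diff_diff_eq)
  qed
  moreover have "pr sV v (xs @ sA c a # ys) = ts sV p c (pr sV v (xs @ a # ys))" for c a
  proof -
    have "Poly_Mapping.single (v, xs @ sA c a # ys) 1 - Poly_Mapping.single (v, xs @ a # ys) c
        \<in> multilinear_relations sA sV p"
      unfolding multilinear_relations_def upd using las by (intro UnI2) blast
    from relation_zero[OF this] show ?thesis
      unfolding pr_cl[OF l] cl_scale cl_eq_iff free_scale_single by simp
  qed
  ultimately show "lin UNIV sA sV p (\<lambda>a. pr sV v (xs @ a # ys))"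
    using l by (simp add: lin_def)
qed

lemmas [linear_rules] = lin_sw_body lin_sw_arg sw_in_T T_add T_scale T_null pr_in_T

lemma vlin_id [linear_rules]: "vlin C s s (\<lambda>x. x)"
  by (simp add: vlin_def)

lemma tlin_id [linear_rules]: "tlin sV p sV p (\<lambda>X. X)"
  by (simp add: lin_def)

lemma lin_vlin: "lin UNIV sU sV p \<phi> \<Longrightarrow> vlin C s sU h \<Longrightarrow> lin C s sV p (\<lambda>x. \<phi> (h x))"
  by (simp add: lin_def vlin_def)

lemma lin_pr [linear_rules]:
  "vlin C s sV h \<Longrightarrow> length as = p \<Longrightarrow> lin C s sV p (\<lambda>x. pr sV (h x) as)"
  by (rule lin_vlin[of sV]) (use mlin_pr[of sV p] in \<open>simp_all add: mlin_def\<close>)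

lemma mlin_0I: "lin UNIV sU sV p (\<lambda>u. g u []) \<Longrightarrow> mlin sU 0 sV p g"
  by (simp add: mlin_def)

text \<open>Multilinearity is proved by freezing the entry at one end and treating it separately.
  Which end is used, here or in \<open>mlin_consI\<close>, follows the recursion of
  \<open>g\<close>.\<close>

lemma mlin_snocI:
  assumes "\<And>b. mlin sU q sV p (\<lambda>u as. g u (as @ [b]))"
    and "\<And>u as. length as = q \<Longrightarrow> lin UNIV sA sV p (\<lambda>b. g u (as @ [b]))"
  shows "mlin sU (Suc q) sV p g"
  unfolding mlin_def
proof (intro conjI allI impI)
  fix as :: "'a list" assume "length as = Suc q"
  then obtain bs b where "as = bs @ [b]" "length bs = q"
    by (metis length_Suc_conv_rev)
  then show "lin UNIV sU sV p (\<lambda>u. g u as)" using assms(1)[of b] by (simp add: mlin_def)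
next
  fix u and xs ys :: "'a list" assume l: "Suc (length xs + length ys) = Suc q"
  show "lin UNIV sA sV p (\<lambda>a. g u (xs @ a # ys))"
  proof (cases ys rule: rev_cases)
    case Nil
    then show ?thesis using assms(2)[of xs u] l by simp
  next
    case (snoc zs b)
    then show ?thesis using assms(1)[of b] l by (simp add: mlin_def)
  qed
qed

lemma mlin_consI:
  assumes "\<And>b. mlin sU q sV p (\<lambda>u as. g u (b # as))"
    and "\<And>u as. length as = q \<Longrightarrow> lin UNIV sA sV p (\<lambda>b. g u (b # as))"
  shows "mlin sU (Suc q) sV p g"
  unfolding mlin_def
proof (intro conjI allI impI)
  fix as :: "'a list" assume "length as = Suc q"
  then obtain bs b where "as = b # bs" "length bs = q"
    by (metis length_Suc_conv)
  then show "lin UNIV sU sV p (\<lambda>u. g u as)" using assms(1)[of b] by (simp add: mlin_def)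
next
  fix u and xs ys :: "'a list" assume l: "Suc (length xs + length ys) = Suc q"
  show "lin UNIV sA sV p (\<lambda>a. g u (xs @ a # ys))"
  proof (cases xs)
    case Nil
    then show ?thesis using assms(2)[of ys u] l by simp
  next
    case (Cons b zs)
    then show ?thesis using assms(1)[of b] l by (simp add: mlin_def)
  qed
qed

lemma mlin_comp: "tlin sV p sW r \<phi> \<Longrightarrow> mlin sU q sV p g \<Longrightarrow> mlin sU q sW r (\<lambda>u as. \<phi> (g u as))"
  by (auto simp: mlin_def intro: lin_comp)

text \<open>\<open>sn\<close> stands for \<open>X \<otimes> b\<close> and \<open>cs\<close> for
  prepending \<open>a\<close> to the list. For tensors in \<open>A^n \<otimes> M\<close>, stored
  with \<open>m\<close> in front, \<open>cs\<close> is \<open>a \<otimes> X\<close> in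
  \<open>A^(n+1) \<otimes> M\<close>, while \<open>sn\<close> yields an element of
  \<open>(A^n \<otimes> M) \<otimes> A\<close> whose last entry is the separate right
  factor.\<close>

definition sn :: "('k \<Rightarrow> 'v::ab_group_add \<Rightarrow> 'v) \<Rightarrow> nat \<Rightarrow> ('v, 'a, 'k) tensor \<Rightarrow> 'a \<Rightarrow> ('v, 'a, 'k) tensor"
  where "sn sV p X b = sw sV (Suc p) X (\<lambda>(y, bs). pr sV y (bs @ [b]))"

definition cs :: "('k \<Rightarrow> 'v::ab_group_add \<Rightarrow> 'v) \<Rightarrow> nat \<Rightarrow> 'a \<Rightarrow> ('v, 'a, 'k) tensor \<Rightarrow> ('v, 'a, 'k) tensor"
  where "cs sV p a X = sw sV (Suc p) X (\<lambda>(y, bs). pr sV y (a # bs))"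

lemma mlin_pr_ends [linear_rules]:
  "mlin sV p sV (Suc p) (\<lambda>y bs. pr sV y (bs @ [b]))"
  "mlin sV p sV (Suc p) (\<lambda>y bs. pr sV y (b # bs))"
proof -
  have "lin UNIV sA sV (Suc p) (\<lambda>a. pr sV u (xs @ a # ys @ [b]))"
    if "Suc (length xs + length ys) = p" for u xs ys
    using mlin_pr[of sV "Suc p"] that by (simp add: mlin_def)
  then show "mlin sV p sV (Suc p) (\<lambda>y bs. pr sV y (bs @ [b]))"
    by (auto simp: mlin_def intro: lin_pr vlin_id)
  have "lin UNIV sA sV (Suc p) (\<lambda>a. pr sV u (b # xs @ a # ys))"
    if "Suc (length xs + length ys) = p" for u xs ys
  proof -
    have "Suc (length (b # xs) + length ys) = Suc p" using that by simp
    then have "lin UNIV sA sV (Suc p) (\<lambda>a. pr sV u ((b # xs) @ a # ys))"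
      using mlin_pr[of sV "Suc p"] unfolding mlin_def by blast
    then show ?thesis by simp
  qed
  then show "mlin sV p sV (Suc p) (\<lambda>y bs. pr sV y (b # bs))"
    by (auto simp: mlin_def intro: lin_pr vlin_id)
qed

lemma sn_pr: "length bs = p \<Longrightarrow> sn sV p (pr sV y bs) b = pr sV y (bs @ [b])"
  unfolding sn_def by (rule sw_pr[OF mlin_pr_ends(1)])

lemma cs_pr: "length bs = p \<Longrightarrow> cs sV p a (pr sV y bs) = pr sV y (a # bs)"
  unfolding cs_def by (rule sw_pr[OF mlin_pr_ends(2)])

lemma lin_sn [linear_rules]: "lin C s sV p \<phi> \<Longrightarrow> lin C s sV (Suc p) (\<lambda>x. sn sV p (\<phi> x) b)"
  unfolding sn_def by (assumption | rule linear_rules)+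

lemma lin_cs [linear_rules]: "lin C s sV p \<phi> \<Longrightarrow> lin C s sV (Suc p) (\<lambda>x. cs sV p a (\<phi> x))"
  unfolding cs_def by (assumption | rule linear_rules)+

lemma lin_sn_right [linear_rules]:
  assumes "Y \<in> T sV p" "vlin C s sA h"
  shows "lin C s sV (Suc p) (\<lambda>x. sn sV p Y (h x))"
  unfolding sn_def
proof (rule lin_vlin[OF _ assms(2)], rule lin_sw_body[OF assms(1)])
  fix u and as :: "'a list" assume "length as = p"
  then show "lin UNIV sA sV (Suc p) (\<lambda>x. pr sV u (as @ [x]))"
    using mlin_pr[of sV "Suc p"] by (simp add: mlin_def)
qed

lemma lin_cs_left [linear_rules]:
  assumes "Y \<in> T sV p" "vlin C s sA h"
  shows "lin C s sV (Suc p) (\<lambda>x. cs sV p (h x) Y)"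
  unfolding cs_def
proof (rule lin_vlin[OF _ assms(2)], rule lin_sw_body[OF assms(1)])
  fix u and as :: "'a list" assume "length as = p"
  then have "Suc (length [] + length as) = Suc p" by simp
  then have "lin UNIV sA sV (Suc p) (\<lambda>a. pr sV u ([] @ a # as))"
    using mlin_pr[of sV "Suc p"] unfolding mlin_def by blast
  then show "lin UNIV sA sV (Suc p) (\<lambda>x. pr sV u (x # as))" by simp
qed

lemma sn_in_T [linear_rules, simp]: "X \<in> T sV p \<Longrightarrow> sn sV p X b \<in> T sV (Suc p)"
  by (rule lin_in_T[OF lin_sn[OF tlin_id]])

lemma cs_in_T [linear_rules, simp]: "X \<in> T sV p \<Longrightarrow> cs sV p b X \<in> T sV (Suc p)"
  by (rule lin_in_T[OF lin_cs[OF tlin_id]])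

text \<open>Here \<open>X\<close> ranges over all tensors with one factor less, not just pure ones,
  so an induction hypothesis about that space applies to it as it stands.\<close>

lemma tlin_sn_eqI:
  assumes "tlin sU (Suc q) sV p \<phi>" "tlin sU (Suc q) sV p \<psi>"
    and "\<And>X b. X \<in> T sU q \<Longrightarrow> \<phi> (sn sU q X b) = \<psi> (sn sU q X b)" and "Z \<in> T sU (Suc q)"
  shows "\<phi> Z = \<psi> Z"
proof (rule tlin_pr_eqI[OF assms(1,2) _ assms(4)])
  fix u and as :: "'a list" assume "length as = Suc q"
  then obtain bs b where *: "as = bs @ [b]" "length bs = q" by (metis length_Suc_conv_rev)
  show "\<phi> (pr sU u as) = \<psi> (pr sU u as)"
    using assms(3)[of "pr sU u bs" b] by (simp add: sn_pr *)
qed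

lemma tlin_cs_eqI:
  assumes "tlin sU (Suc q) sV p \<phi>" "tlin sU (Suc q) sV p \<psi>"
    and "\<And>X b. X \<in> T sU q \<Longrightarrow> \<phi> (cs sU q b X) = \<psi> (cs sU q b X)" and "Z \<in> T sU (Suc q)"
  shows "\<phi> Z = \<psi> Z"
proof (rule tlin_pr_eqI[OF assms(1,2) _ assms(4)])
  fix u and as :: "'a list" assume "length as = Suc q"
  then obtain bs b where *: "as = b # bs" "length bs = q" by (metis length_Suc_conv)
  show "\<phi> (pr sU u as) = \<psi> (pr sU u as)"
    using assms(3)[of "pr sU u bs" b] by (simp add: cs_pr *)
qed

text \<open>The maps induced by bilinear maps on \<open>(U \<otimes> A\<^sup>q) \<otimes> A\<close>, \<open>A \<otimes> (U \<otimes> A\<^sup>q)\<close> and \<open>U \<otimes> A\<close>.\<close>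

definition bindS :: "('k \<Rightarrow> 'u::ab_group_add \<Rightarrow> 'u) \<Rightarrow> ('k \<Rightarrow> 'v::ab_group_add \<Rightarrow> 'v) \<Rightarrow> nat
    \<Rightarrow> ('u, 'a, 'k) tensor \<Rightarrow> (('u, 'a, 'k) tensor \<Rightarrow> 'a \<Rightarrow> ('v, 'a, 'k) tensor) \<Rightarrow> ('v, 'a, 'k) tensor"
  where "bindS sU sV p Z G = sw sV p Z (\<lambda>(v, ws). G (pr sU v (butlast ws)) (last ws))"

definition bindC :: "('k \<Rightarrow> 'u::ab_group_add \<Rightarrow> 'u) \<Rightarrow> ('k \<Rightarrow> 'v::ab_group_add \<Rightarrow> 'v) \<Rightarrow> nat
    \<Rightarrow> ('u, 'a, 'k) tensor \<Rightarrow> ('a \<Rightarrow> ('u, 'a, 'k) tensor \<Rightarrow> ('v, 'a, 'k) tensor) \<Rightarrow> ('v, 'a, 'k) tensor"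
  where "bindC sU sV p Z G = sw sV p Z (\<lambda>(v, ws). G (hd ws) (pr sU v (tl ws)))"

definition bind1 :: "('k \<Rightarrow> 'v::ab_group_add \<Rightarrow> 'v) \<Rightarrow> nat
    \<Rightarrow> ('u, 'a, 'k) tensor \<Rightarrow> ('u \<Rightarrow> 'a \<Rightarrow> ('v, 'a, 'k) tensor) \<Rightarrow> ('v, 'a, 'k) tensor"
  where "bind1 sV p Z g = sw sV p Z (\<lambda>(u, ws). g u (hd ws))"

lemma lin_bindS_arg [linear_rules]:
  assumes "lin C s sU (Suc q) \<phi>" and G1: "\<And>b. tlin sU q sV p (\<lambda>X. G X b)"
    and G2: "\<And>X. X \<in> T sU q \<Longrightarrow> lin UNIV sA sV p (\<lambda>b. G X b)"
  shows "lin C s sV p (\<lambda>x. bindS sU sV p (\<phi> x) G)"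
  unfolding bindS_def
  by (rule lin_sw_arg[OF assms(1)], rule mlin_snocI)
     (simp_all add: mlin_comp[OF G1 mlin_pr] G2)

lemma lin_bindS_body [linear_rules]:
  assumes "Z \<in> T sU (Suc q)" "\<And>X b. X \<in> T sU q \<Longrightarrow> lin C s sV p (\<lambda>x. G x X b)"
  shows "lin C s sV p (\<lambda>x. bindS sU sV p Z (G x))"
  unfolding bindS_def by (intro lin_sw_body[OF assms(1)] assms(2)) simp

lemma bindS_sn:
  assumes G1: "\<And>b. tlin sU q sV p (\<lambda>X. G X b)"
    and G2: "\<And>X. X \<in> T sU q \<Longrightarrow> lin UNIV sA sV p (\<lambda>b. G X b)" and X: "X \<in> T sU q"
  shows "bindS sU sV p (sn sU q X b) G = G X b"
proof (rule tlin_pr_eqI[OF _ _ _ X])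
  show "tlin sU q sV p (\<lambda>X. bindS sU sV p (sn sU q X b) G)"
    by (assumption | rule linear_rules G1 G2)+
  show "tlin sU q sV p (\<lambda>X. G X b)" by (rule G1)
  fix u and as :: "'a list" assume l: "length as = q"
  have "mlin sU (Suc q) sV p (\<lambda>v ws. G (pr sU v (butlast ws)) (last ws))"
    by (rule mlin_snocI) (simp_all add: mlin_comp[OF G1 mlin_pr] G2)
  from sw_pr[OF this, of "as @ [b]" u]
  show "bindS sU sV p (sn sU q (pr sU u as) b) G = G (pr sU u as) b"
    unfolding bindS_def by (simp add: sn_pr l)
qed

lemma lin_bindC_arg [linear_rules]:
  assumes "lin C s sU (Suc q) \<phi>" and G1: "\<And>b. tlin sU q sV p (\<lambda>X. G b X)"
    and G2: "\<And>X. X \<in> T sU q \<Longrightarrow> lin UNIV sA sV p (\<lambda>b. G b X)"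
  shows "lin C s sV p (\<lambda>x. bindC sU sV p (\<phi> x) G)"
  unfolding bindC_def
  by (rule lin_sw_arg[OF assms(1)], rule mlin_consI)
     (simp_all add: mlin_comp[OF G1 mlin_pr] G2)

lemma lin_bindC_body [linear_rules]:
  assumes "Z \<in> T sU (Suc q)" "\<And>X b. X \<in> T sU q \<Longrightarrow> lin C s sV p (\<lambda>x. G x b X)"
  shows "lin C s sV p (\<lambda>x. bindC sU sV p Z (G x))"
  unfolding bindC_def by (intro lin_sw_body[OF assms(1)] assms(2)) simp

lemma bindC_cs:
  assumes G1: "\<And>b. tlin sU q sV p (\<lambda>X. G b X)"
    and G2: "\<And>X. X \<in> T sU q \<Longrightarrow> lin UNIV sA sV p (\<lambda>b. G b X)" and X: "X \<in> T sU q"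
  shows "bindC sU sV p (cs sU q b X) G = G b X"
proof (rule tlin_pr_eqI[OF _ _ _ X])
  show "tlin sU q sV p (\<lambda>X. bindC sU sV p (cs sU q b X) G)"
    by (assumption | rule linear_rules G1 G2)+
  show "tlin sU q sV p (\<lambda>X. G b X)" by (rule G1)
  fix u and as :: "'a list" assume l: "length as = q"
  have "mlin sU (Suc q) sV p (\<lambda>v ws. G (hd ws) (pr sU v (tl ws)))"
    by (rule mlin_consI) (simp_all add: mlin_comp[OF G1 mlin_pr] G2)
  from sw_pr[OF this, of "b # as" u]
  show "bindC sU sV p (cs sU q b (pr sU u as)) G = G b (pr sU u as)"
    unfolding bindC_def by (simp add: cs_pr l)
qed

lemma mlin_1I:
  assumes "\<And>w. lin UNIV sU sV p (\<lambda>u. g u w)" "\<And>u. lin UNIV sA sV p (\<lambda>w. g u w)"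
  shows "mlin sU (Suc 0) sV p (\<lambda>u ws. g u (hd ws))"
  by (rule mlin_consI) (simp_all add: mlin_0I assms)

lemma lin_bind1_arg [linear_rules]:
  assumes "lin C s sU (Suc 0) \<phi>" "\<And>w. lin UNIV sU sV p (\<lambda>u. g u w)"
    "\<And>u. lin UNIV sA sV p (\<lambda>w. g u w)"
  shows "lin C s sV p (\<lambda>x. bind1 sV p (\<phi> x) g)"
  unfolding bind1_def by (rule lin_sw_arg[OF assms(1) mlin_1I[OF assms(2,3)]])

lemma lin_bind1_body [linear_rules]:
  assumes "Z \<in> T sU (Suc 0)" "\<And>u b. lin C s sV p (\<lambda>x. g x u b)"
  shows "lin C s sV p (\<lambda>x. bind1 sV p Z (g x))"
  unfolding bind1_def by (intro lin_sw_body[OF assms(1)] assms(2))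

lemma bind1_in_T [linear_rules]:
  assumes "Z \<in> T sU (Suc 0)" "\<And>u b. g u b \<in> T sV p"
  shows "bind1 sV p Z g \<in> T sV p"
  unfolding bind1_def by (intro sw_in_T[OF assms(1)] assms(2))

lemma bind1_pr:
  assumes "\<And>w. lin UNIV sU sV p (\<lambda>u. g u w)" "\<And>u. lin UNIV sA sV p (\<lambda>w. g u w)"
  shows "bind1 sV p (pr sU u [w]) g = g u w"
  unfolding bind1_def using sw_pr[OF mlin_1I[OF assms], of "[w]" u] by simp

lemma tlin_bind1_swap:
  assumes "tlin sV p sW r \<phi>" "Z \<in> T sU (Suc 0)" "\<And>u w. g u w \<in> T sV p"
  shows "\<phi> (bind1 sV p Z g) = bind1 sW r Z (\<lambda>u w. \<phi> (g u w))"
  unfolding bind1_def by (rule tlin_sw_swap[OF assms(1,2)]) (rule assms(3))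

lemma bind1_commute:
  assumes "X \<in> T sU (Suc 0)" "Y \<in> T sV (Suc 0)" "\<And>u a v b. g u a v b \<in> T sW p"
  shows "bind1 sW p X (\<lambda>u a. bind1 sW p Y (\<lambda>v b. g u a v b))
    = bind1 sW p Y (\<lambda>v b. bind1 sW p X (\<lambda>u a. g u a v b))"
  unfolding bind1_def by (rule sw_commute[OF assms(1,2)]) (rule assms(3))

end

section \<open>Sums over coproducts and coactions\<close>

context tensor_calculus
begin

lemma sw_pr_id: "X \<in> T sU q \<Longrightarrow> sw sU q X (\<lambda>(u, as). pr sU u as) = X"
  by (rule tlin_pr_eqI[where \<psi> = "\<lambda>X. X", OF tlin_sw[OF mlin_pr] tlin_id])
     (simp_all add: sw_pr[OF mlin_pr])

text \<open>Brings a tensor with a single factor \<open>A\<close>, typically a coaction, into a form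
  in which a linear map can be pulled inside and evaluated by its rule for
  \<open>sn\<close>.\<close>

lemma bind1_sn_id:
  assumes "X \<in> T sU (Suc 0)"
  shows "bind1 sU (Suc 0) X (\<lambda>u w. sn sU 0 (pr sU u []) w) = X"
proof -
  have "bind1 sU (Suc 0) X (\<lambda>u w. sn sU 0 (pr sU u []) w) = sw sU (Suc 0) X (\<lambda>(u, as). pr sU u as)"
    unfolding bind1_def
    by (rule sw_cong[OF assms]) (auto simp: sn_pr length_Suc_conv)
  then show ?thesis by (simp add: sw_pr_id assms)
qed

lemma lin_pr_cons [linear_rules]:
  assumes "vlin C s sA h" "p = Suc (length ys)"
  shows "lin C s sV p (\<lambda>x. pr sV v (h x # ys))"
  by (rule lin_vlin[OF _ assms(1)])
     (use mlin_pr[of sV p] assms(2) in \<open>force simp: mlin_def dest: spec[where x = "[]"]\<close>)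

lemma lin_pr_mid [linear_rules]:
  assumes "vlin C s sA h" "p = Suc (length xs + length ys)"
  shows "lin C s sV p (\<lambda>x. pr sV v (xs @ h x # ys))"
  by (rule lin_vlin[OF _ assms(1)]) (use mlin_pr[of sV p] assms(2) in \<open>simp add: mlin_def\<close>)

lemma mlin_cong:
  "mlin sU q sV p g \<Longrightarrow> (\<And>u as. length as = q \<Longrightarrow> h u as = g u as) \<Longrightarrow> mlin sU q sV p h"
  by (auto simp: mlin_def)

lemma tlin_0_eqI:
  assumes "tlin sU 0 sV p \<phi>" "tlin sU 0 sV p \<psi>"
    and "\<And>u. \<phi> (pr sU u []) = \<psi> (pr sU u [])" and "X \<in> T sU 0"
  shows "\<phi> X = \<psi> X"
  using tlin_pr_eqI[OF assms(1,2) _ assms(4)] assms(3) by simp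

text \<open>Both sides of \<open>eq\<close> lie in \<open>V \<otimes> A^2\<close>; applying the
  linear map induced by the trilinear \<open>g\<close> turns the axiom into a rewrite rule for
  arbitrary sums. \<open>V = A\<close> gives coassociativity of the bialgebra, \<open>V = M\<close>
  with a coaction as \<open>F\<close> that of a comodule.\<close>

lemma bind1_coassoc:
  assumes X: "X \<in> T sV (Suc 0)" and F: "\<And>u. F u \<in> T sV (Suc 0)" and G: "\<And>a. G a \<in> T sA (Suc 0)"
    and eq: "sw sV 2 X (\<lambda>(u, ws). sw sV 2 (F u) (\<lambda>(x, ys). pr sV x (ys @ ws)))
      = sw sV 2 X (\<lambda>(u, ws). sw sV 2 (G (hd ws)) (\<lambda>(x, ys). pr sV u (x # ys)))"
    and g1: "\<And>y z. lin UNIV sV sW p (\<lambda>x. g x y z)"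
    and g2: "\<And>x z. lin UNIV sA sW p (\<lambda>y. g x y z)"
    and g3: "\<And>x y. lin UNIV sA sW p (\<lambda>z. g x y z)"
  shows "bind1 sW p X (\<lambda>u w. bind1 sW p (F u) (\<lambda>x y. g x y w))
    = bind1 sW p X (\<lambda>u w. bind1 sW p (G w) (\<lambda>x y. g u x y))"
proof -
  let ?n = "Suc (Suc 0)"
  define \<phi> where "\<phi> = (\<lambda>Z. sw sW p Z (\<lambda>(x, ys). g x (hd ys) (hd (tl ys))))"
  have m: "mlin sV ?n sW p (\<lambda>x ys. g x (hd ys) (hd (tl ys)))"
    by (rule mlin_consI, rule mlin_consI) (auto simp: mlin_0I length_Suc_conv g1 g2 g3)
  have \<phi>: "tlin sV ?n sW p \<phi>" unfolding \<phi>_def by (rule tlin_sw[OF m])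
  have \<phi>_pr: "\<phi> (pr sV x [y, z]) = g x y z" for x y z
    unfolding \<phi>_def using sw_pr[OF m, of "[y, z]" x] by simp
  have "sw sV 2 X (\<lambda>(u, ws). sw sV 2 (F u) (\<lambda>(x, ys). pr sV x (ys @ ws)))
      = bind1 sV ?n X (\<lambda>u w. bind1 sV ?n (F u) (\<lambda>x y. pr sV x [y, w]))"
    unfolding bind1_def numeral_2_eq_2
    by (rule sw_cong[OF X], rule sw_cong[OF F]) (auto simp: length_Suc_conv)
  moreover have "sw sV 2 X (\<lambda>(u, ws). sw sV 2 (G (hd ws)) (\<lambda>(x, ys). pr sV u (x # ys)))
      = bind1 sV ?n X (\<lambda>u w. bind1 sV ?n (G w) (\<lambda>x y. pr sV u [x, y]))"
    unfolding bind1_def numeral_2_eq_2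
    by (rule sw_cong[OF X], rule sw_cong[OF G]) (auto simp: length_Suc_conv)
  ultimately have "\<phi> (bind1 sV ?n X (\<lambda>u w. bind1 sV ?n (F u) (\<lambda>x y. pr sV x [y, w])))
      = \<phi> (bind1 sV ?n X (\<lambda>u w. bind1 sV ?n (G w) (\<lambda>x y. pr sV u [x, y])))"
    using eq by simp
  moreover have "\<phi> (bind1 sV ?n X (\<lambda>u w. bind1 sV ?n (F u) (\<lambda>x y. pr sV x [y, w])))
      = bind1 sW p X (\<lambda>u w. bind1 sW p (F u) (\<lambda>x y. g x y w))"
    by (simp add: tlin_bind1_swap[OF \<phi> X] tlin_bind1_swap[OF \<phi> F] bind1_in_T[OF F] \<phi>_pr)
  moreover have "\<phi> (bind1 sV ?n X (\<lambda>u w. bind1 sV ?n (G w) (\<lambda>x y. pr sV u [x, y])))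
      = bind1 sW p X (\<lambda>u w. bind1 sW p (G w) (\<lambda>x y. g u x y))"
    by (simp add: tlin_bind1_swap[OF \<phi> X] tlin_bind1_swap[OF \<phi> G] bind1_in_T[OF G] \<phi>_pr)
  ultimately show ?thesis by simp
qed

text \<open>Serves two axioms at once: with \<open>f\<close> the product it is multiplicativity of
  the comultiplication, with \<open>f\<close> the action it is the Hopf module
  compatibility.\<close>

lemma bind1_multiplicative:
  assumes X: "X \<in> T sU (Suc 0)" and Y: "Y \<in> T sV (Suc 0)"
    and Z: "Z = sw sV 1 X (\<lambda>(u, us). sw sV 1 Y (\<lambda>(w, ws). pr sV (f u w) (map2 h us ws)))"
    and g1: "\<And>y. lin UNIV sV sW p (\<lambda>x. g x y)" and g2: "\<And>x. lin UNIV sA sW p (\<lambda>y. g x y)"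
  shows "bind1 sW p Z g = bind1 sW p X (\<lambda>u u'. bind1 sW p Y (\<lambda>w w'. g (f u w) (h u' w')))"
proof -
  have "Z = bind1 sV (Suc 0) X (\<lambda>u u'. bind1 sV (Suc 0) Y (\<lambda>w w'. pr sV (f u w) [h u' w']))"
    unfolding bind1_def Z One_nat_def
    by (rule sw_cong[OF X], rule sw_cong[OF Y]) (auto simp: length_Suc_conv)
  moreover have \<phi>: "tlin sV (Suc 0) sW p (\<lambda>Z. bind1 sW p Z g)"
    by (assumption | rule linear_rules g1 g2)+
  ultimately show ?thesis
    by (simp add: tlin_bind1_swap[OF \<phi> X] tlin_bind1_swap[OF \<phi> Y] bind1_in_T[OF Y]
        bind1_pr[where sU = sV and sV = sW and p = p and g = g, OF g1 g2])
qed

text \<open>\<open>rx f\<close> is \<open>f \<otimes> id\<close> on \<open>(U \<otimes> A\<^sup>q) \<otimes> A\<close>.\<close>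

definition rx :: "('k \<Rightarrow> 'u::ab_group_add \<Rightarrow> 'u) \<Rightarrow> ('k \<Rightarrow> 'v::ab_group_add \<Rightarrow> 'v) \<Rightarrow> nat
    \<Rightarrow> (('u, 'a, 'k) tensor \<Rightarrow> ('v, 'a, 'k) tensor) \<Rightarrow> ('u, 'a, 'k) tensor \<Rightarrow> ('v, 'a, 'k) tensor" where
  "rx sU sV p f Z = bindS sU sV (Suc p) Z (\<lambda>X b. sn sV p (f X) b)"

lemma lin_rx [linear_rules]:
  assumes "lin C s sU (Suc q) \<phi>" "tlin sU q sV p f"
  shows "lin C s sV (Suc p) (\<lambda>x. rx sU sV p f (\<phi> x))"
  unfolding rx_def by (assumption | rule linear_rules assms lin_in_T[OF assms(2)])+

lemma rx_sn:
  assumes "tlin sU q sV p f" "X \<in> T sU q"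
  shows "rx sU sV p f (sn sU q X b) = sn sV p (f X) b"
  unfolding rx_def by (rule bindS_sn) (assumption | rule linear_rules assms lin_in_T[OF assms(1)])+

lemma rx_comp:
  assumes f: "tlin sU q sV p f" and g: "tlin sV p sW r g" and Z: "Z \<in> T sU (Suc q)"
  shows "rx sV sW r g (rx sU sV p f Z) = rx sU sW r (\<lambda>X. g (f X)) Z"
proof (rule tlin_sn_eqI[OF _ _ _ Z])
  show "tlin sU (Suc q) sW (Suc r) (\<lambda>Z. rx sV sW r g (rx sU sV p f Z))"
    by (assumption | rule linear_rules f g)+
  show "tlin sU (Suc q) sW (Suc r) (\<lambda>Z. rx sU sW r (\<lambda>X. g (f X)) Z)"
    by (assumption | rule linear_rules lin_comp[OF g f])+
  show "rx sV sW r g (rx sU sV p f (sn sU q X b)) = rx sU sW r (\<lambda>X. g (f X)) (sn sU q X b)"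
    if "X \<in> T sU q" for X b
    by (simp add: rx_sn[OF f that] rx_sn[OF g lin_in_T[OF f that]] rx_sn[OF lin_comp[OF g f] that])
qed

end

section \<open>Bialgebras and Hopf modules\<close>

locale bialg =
  fixes A :: "('k::field, 'a::ring_1) bialg"
  assumes bialgebra: "bialgebra A"
begin

sublocale tensor_calculus "scl A" .

lemma linear_into_tensor_iff: "linear_into_tensor (scl A) sV p sW \<phi> \<longleftrightarrow> lin UNIV sW sV p \<phi>"
  by (simp add: linear_into_tensor_def lin_def)

lemma lin_comul [linear_rules]:
  "vlin C s (scl A) h \<Longrightarrow> lin C s (scl A) (Suc 0) (\<lambda>x. comul A (h x))"
  by (rule lin_vlin[of "scl A"])
     (use bialgebra in \<open>simp_all add: bialgebra_def linear_into_tensor_iff\<close>)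

lemma comul_in_T [linear_rules, simp]: "comul A a \<in> T (scl A) (Suc 0)"
  by (rule lin_in_T[OF lin_comul[OF vlin_id] UNIV_I])

lemma bind1_comul_in_T [simp]:
  "(\<And>u b. g u b \<in> T sV p) \<Longrightarrow> bind1 sV p (comul A a) g \<in> T sV p"
  by (rule bind1_in_T[OF comul_in_T])

lemmas tlin_comul_swap = tlin_bind1_swap[OF _ comul_in_T]

lemma vlin_mult [linear_rules]:
  assumes "vlin C s (scl A) h"
  shows "vlin C s (scl A) (\<lambda>x. a * h x)" "vlin C s (scl A) (\<lambda>x. h x * a)"
  using assms bialgebra by (simp_all add: vlin_def bialgebra_def distrib_left distrib_right)

lemma comul_coassoc:
  assumes "\<And>y z. lin UNIV (scl A) sW p (\<lambda>x. g x y z)"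
    and "\<And>x z. lin UNIV (scl A) sW p (\<lambda>y. g x y z)"
    and "\<And>x y. lin UNIV (scl A) sW p (\<lambda>z. g x y z)"
  shows "bind1 sW p (comul A a) (\<lambda>u w. bind1 sW p (comul A u) (\<lambda>x y. g x y w))
    = bind1 sW p (comul A a) (\<lambda>u w. bind1 sW p (comul A w) (\<lambda>x y. g u x y))"
  by (rule bind1_coassoc[OF comul_in_T comul_in_T comul_in_T _ assms])
     (use bialgebra in \<open>simp add: bialgebra_def\<close>)

lemma comul_mult:
  assumes "\<And>y. lin UNIV (scl A) sW p (\<lambda>x. g x y)" "\<And>x. lin UNIV (scl A) sW p (\<lambda>y. g x y)"
  shows "bind1 sW p (comul A (a * b)) g
    = bind1 sW p (comul A a) (\<lambda>u u'. bind1 sW p (comul A b) (\<lambda>w w'. g (u * w) (u' * w')))"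
  by (rule bind1_multiplicative[OF comul_in_T comul_in_T _ assms])
     (use bialgebra in \<open>simp add: bialgebra_def\<close>)

text \<open>For \<open>V = A\<close> the distinguished component is itself the leftmost factor. To
  form \<open>u \<otimes> X\<close> it has to be moved into the list, unlike in \<open>cs\<close>,
  which leaves it in place.\<close>

definition front :: "nat \<Rightarrow> 'a \<Rightarrow> ('a, 'a, 'k) tensor \<Rightarrow> ('a, 'a, 'k) tensor" where
  "front p u X = sw (scl A) (Suc p) X (\<lambda>(x, ys). pr (scl A) u (x # ys))"

lemma mlin_pr_Cons: "mlin (scl A) p (scl A) (Suc p) (\<lambda>x ys. pr (scl A) u (x # ys))"
proof -
  have "lin UNIV (scl A) (scl A) (Suc p) (\<lambda>a. pr (scl A) u ((x # xs) @ a # ys))"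
    if "Suc (length xs + length ys) = p" for x xs ys
    by (rule lin_pr_mid[OF vlin_id]) (simp add: that)
  then show ?thesis by (auto simp: mlin_def intro!: lin_pr_cons vlin_id)
qed

lemma front_pr: "length ys = p \<Longrightarrow> front p u (pr (scl A) x ys) = pr (scl A) u (x # ys)"
  unfolding front_def by (rule sw_pr[OF mlin_pr_Cons])

lemma lin_front [linear_rules]:
  "lin C s (scl A) p \<phi> \<Longrightarrow> lin C s (scl A) (Suc p) (\<lambda>x. front p u (\<phi> x))"
  unfolding front_def by (rule lin_sw_arg[OF _ mlin_pr_Cons])

lemma lin_front_left [linear_rules]:
  "X \<in> T (scl A) p \<Longrightarrow> vlin C s (scl A) h \<Longrightarrow> lin C s (scl A) (Suc p) (\<lambda>x. front p (h x) X)"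
  unfolding front_def by (assumption | rule linear_rules | simp)+

lemma front_in_T [linear_rules, simp]: "X \<in> T (scl A) p \<Longrightarrow> front p u X \<in> T (scl A) (Suc p)"
  by (rule lin_in_T[OF lin_front[OF tlin_id]])

lemma front_sn:
  assumes "X \<in> T (scl A) p"
  shows "front (Suc p) u (sn (scl A) p X b) = sn (scl A) (Suc p) (front p u X) b"
  by (rule tlin_pr_eqI[OF _ _ _ assms]) (assumption | rule linear_rules | simp add: front_pr sn_pr)+

lemma lin_comul_iter_UNIV: "lin UNIV (scl A) (scl A) p (comul_iter A p)"
proof (induction p)
  case 0
  show ?case by (simp) (rule linear_rules | simp)+
next
  case (Suc p)
  have eq: "comul_iter A (Suc p) = (\<lambda>a. bind1 (scl A) (Suc p) (comul A a) (\<lambda>u w. front p u (comul_iter A p w)))"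
    by (simp add: bind1_def front_def fun_eq_iff)
  show ?case
    unfolding eq
    by (assumption | rule linear_rules lin_vlin[OF Suc] lin_in_T[OF Suc] | simp)+
qed

lemma lin_comul_iter [linear_rules]:
  "vlin C s (scl A) h \<Longrightarrow> lin C s (scl A) p (\<lambda>x. comul_iter A p (h x))"
  by (rule lin_vlin[OF lin_comul_iter_UNIV])

lemma comul_iter_in_T [linear_rules, simp]: "comul_iter A p a \<in> T (scl A) p"
  by (rule lin_in_T[OF lin_comul_iter_UNIV UNIV_I])

lemma comul_iter_Suc:
  "comul_iter A (Suc p) a = bind1 (scl A) (Suc p) (comul A a) (\<lambda>u w. front p u (comul_iter A p w))"
  by (simp add: bind1_def front_def)

text \<open>The definition of \<open>comul_iter\<close> iterates on the second component of the
  coproduct. The action on \<open>M \<otimes> A^p\<close> is analysed from its last factor, which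
  requires iterating on the first component; coassociativity converts one into the other.\<close>

lemma comul_iter_snoc:
  "comul_iter A (Suc p) a = bind1 (scl A) (Suc p) (comul A a) (\<lambda>u w. sn (scl A) p (comul_iter A p u) w)"
proof (induction p arbitrary: a)
  case 0
  show ?case by (simp add: comul_iter_Suc front_pr sn_pr del: comul_iter.simps(2))
next
  case (Suc p)
  let ?n = "Suc (Suc p)"
  have front: "tlin (scl A) (Suc p) (scl A) ?n (front (Suc p) u)" for u
    by (rule linear_rules)+
  have sn: "tlin (scl A) (Suc p) (scl A) ?n (\<lambda>X. sn (scl A) (Suc p) X w)" for w
    by (rule linear_rules)+
  have "comul_iter A ?n a = bind1 (scl A) ?n (comul A a) (\<lambda>u w. bind1 (scl A) ?n (comul A w)
      (\<lambda>x y. sn (scl A) (Suc p) (front p u (comul_iter A p x)) y))"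
    by (subst comul_iter_Suc) (simp add: Suc tlin_comul_swap[OF front] front_sn del: comul_iter.simps(2))
  also have "\<dots> = bind1 (scl A) ?n (comul A a) (\<lambda>u w. bind1 (scl A) ?n (comul A u)
      (\<lambda>x y. sn (scl A) (Suc p) (front p x (comul_iter A p y)) w))"
    by (rule comul_coassoc[symmetric]) (assumption | rule linear_rules)+
  also have "\<dots> = bind1 (scl A) ?n (comul A a) (\<lambda>u w. sn (scl A) (Suc p) (comul_iter A (Suc p) u) w)"
    by (simp add: comul_iter_Suc tlin_comul_swap[OF sn] del: comul_iter.simps(2))
  finally show ?case .
qed

end

section \<open>Left-right Hopf modules\<close>

locale hopf = bialg A for A :: "('k::field, 'a::ring_1) bialg" +
  fixes M :: "('k, 'a, 'm::ab_group_add) hopf_mod"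
  assumes hopf_module: "hopf_module A M"
begin

abbreviation "sM \<equiv> mscl M"

lemma lin_coact [linear_rules]: "vlin C s sM h \<Longrightarrow> lin C s sM (Suc 0) (\<lambda>x. coact M (h x))"
  by (rule lin_vlin[of sM])
     (use hopf_module in \<open>simp_all add: hopf_module_def linear_into_tensor_iff\<close>)

lemma coact_in_T [linear_rules, simp]: "coact M m \<in> T sM (Suc 0)"
  by (rule lin_in_T[OF lin_coact[OF vlin_id] UNIV_I])

lemma bind1_coact_in_T [simp]:
  "(\<And>u b. g u b \<in> T sV p) \<Longrightarrow> bind1 sV p (coact M a) g \<in> T sV p"
  by (rule bind1_in_T[OF coact_in_T])

lemmas tlin_coact_swap = tlin_bind1_swap[OF _ coact_in_T]

lemma vlin_act [linear_rules]:
  "vlin C s sM h \<Longrightarrow> vlin C s sM (\<lambda>x. act M a (h x))"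
  "vlin C s (scl A) h' \<Longrightarrow> vlin C s sM (\<lambda>x. act M (h' x) m)"
  using hopf_module by (simp_all add: vlin_def hopf_module_def)

lemma act_mult: "act M (a * b) x = act M a (act M b x)"
  using hopf_module by (simp add: hopf_module_def)

lemma coact_coassoc:
  assumes "\<And>y z. lin UNIV sM sW p (\<lambda>x. g x y z)"
    and "\<And>x z. lin UNIV (scl A) sW p (\<lambda>y. g x y z)"
    and "\<And>x y. lin UNIV (scl A) sW p (\<lambda>z. g x y z)"
  shows "bind1 sW p (coact M m) (\<lambda>u w. bind1 sW p (coact M u) (\<lambda>x y. g x y w))
    = bind1 sW p (coact M m) (\<lambda>u w. bind1 sW p (comul A w) (\<lambda>x y. g u x y))"
  by (rule bind1_coassoc[OF coact_in_T coact_in_T comul_in_T _ assms])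
     (use hopf_module in \<open>simp add: hopf_module_def\<close>)

lemma coact_act:
  assumes "\<And>y. lin UNIV sM sW p (\<lambda>x. g x y)" "\<And>x. lin UNIV (scl A) sW p (\<lambda>y. g x y)"
  shows "bind1 sW p (coact M (act M a m)) g
    = bind1 sW p (comul A a) (\<lambda>u u'. bind1 sW p (coact M m) (\<lambda>w w'. g (act M u w) (u' * w')))"
  by (rule bind1_multiplicative[OF comul_in_T coact_in_T _ assms])
     (use hopf_module in \<open>simp add: hopf_module_def\<close>)

end

context hopf
begin

subsection \<open>The action on \<open>M \<otimes> A\<^sup>p\<close>\<close>

definition tri :: "nat \<Rightarrow> 'a \<Rightarrow> ('m, 'a, 'k) tensor \<Rightarrow> ('m, 'a, 'k) tensor" where
  "tri p a Y = sw sM p (comul_iter A p a) (\<lambda>(u, us). sw sM p Y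
     (\<lambda>(y, bs). pr sM (act M u y) (map2 (*) us bs)))"

lemma map2_split:
  assumes "length bs = Suc (length xs + length ys)"
  obtains cs c ds where "bs = cs @ c # ds" "length cs = length xs" "length ds = length ys"
  using assms that[of "take (length xs) bs" "bs ! length xs" "drop (Suc (length xs)) bs"]
  by (simp add: id_take_nth_drop[symmetric])

lemma mlin_shuffle_left [linear_rules]:
  assumes "length bs = p"
  shows "mlin (scl A) p sM p (\<lambda>u us. pr sM (act M u y) (map2 (*) us bs))"
  unfolding mlin_def
proof (intro conjI allI impI)
  fix us :: "'a list" assume "length us = p"
  then show "lin UNIV (scl A) sM p (\<lambda>u. pr sM (act M u y) (map2 (*) us bs))"
    using assms by (intro linear_rules) simp
next
  fix u and xs ys :: "'a list" assume *: "Suc (length xs + length ys) = p"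
  with assms obtain cs c ds where "bs = cs @ c # ds" "length cs = length xs" "length ds = length ys"
    by (metis map2_split)
  then show "lin UNIV (scl A) sM p (\<lambda>a. pr sM (act M u y) (map2 (*) (xs @ a # ys) bs))"
    using * by (simp, intro linear_rules) simp
qed

lemma mlin_shuffle_right [linear_rules]:
  assumes "length us = p"
  shows "mlin sM p sM p (\<lambda>y bs. pr sM (act M u y) (map2 (*) us bs))"
  unfolding mlin_def
proof (intro conjI allI impI)
  fix bs :: "'a list" assume "length bs = p"
  then show "lin UNIV sM sM p (\<lambda>y. pr sM (act M u y) (map2 (*) us bs))"
    using assms by (intro linear_rules) simp
next
  fix y and xs ys :: "'a list" assume *: "Suc (length xs + length ys) = p"
  with assms obtain cs c ds where "us = cs @ c # ds" "length cs = length xs" "length ds = length ys"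
    by (metis map2_split)
  then show "lin UNIV (scl A) sM p (\<lambda>a. pr sM (act M u y) (map2 (*) us (xs @ a # ys)))"
    using * by (simp, intro linear_rules) simp
qed

lemma lin_tri [linear_rules]: "lin C s sM p \<phi> \<Longrightarrow> lin C s sM p (\<lambda>x. tri p a (\<phi> x))"
  unfolding tri_def by (assumption | rule linear_rules)+

lemma mlin_tri_left:
  assumes Y: "Y \<in> T sM p"
  shows "mlin (scl A) p sM p (\<lambda>u us. sw sM p Y (\<lambda>(y, bs). pr sM (act M u y) (map2 (*) us bs)))"
  unfolding mlin_def
proof (intro conjI allI impI)
  fix us :: "'a list" assume l: "length us = p"
  show "lin UNIV (scl A) sM p (\<lambda>u. sw sM p Y (\<lambda>(y, bs). pr sM (act M u y) (map2 (*) us bs)))"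
    by (rule lin_sw_body[OF Y]) (use mlin_shuffle_left l in \<open>auto simp: mlin_def\<close>)
next
  fix u and xs ys :: "'a list" assume l: "Suc (length xs + length ys) = p"
  show "lin UNIV (scl A) sM p
      (\<lambda>a. sw sM p Y (\<lambda>(y, bs). pr sM (act M u y) (map2 (*) (xs @ a # ys) bs)))"
    by (rule lin_sw_body[OF Y]) (use mlin_shuffle_left l in \<open>simp add: mlin_def\<close>)
qed

lemma lin_tri_left [linear_rules]:
  "Y \<in> T sM p \<Longrightarrow> vlin C s (scl A) h \<Longrightarrow> lin C s sM p (\<lambda>x. tri p (h x) Y)"
  unfolding tri_def by (assumption | rule linear_rules mlin_tri_left)+

lemma tri_in_T [linear_rules, simp]: "Y \<in> T sM p \<Longrightarrow> tri p a Y \<in> T sM p"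
  by (rule lin_in_T[OF lin_tri[OF tlin_id]])

lemma tri_pr:
  assumes "length bs = p"
  shows "tri p a (pr sM y bs)
    = sw sM p (comul_iter A p a) (\<lambda>(u, us). pr sM (act M u y) (map2 (*) us bs))"
  unfolding tri_def
  by (rule sw_cong[OF comul_iter_in_T]) (rule sw_pr[OF mlin_shuffle_right assms])

lemma tri_Nil: "tri 0 a (pr sM y []) = pr sM (act M a y) []"
  using sw_pr[OF mlin_shuffle_left[of "[]" 0], of "[]" a y] by (simp add: tri_pr)

text \<open>\<open>M \<otimes> A^(p+1)\<close> is the tensor product of the modules
  \<open>M \<otimes> A^p\<close> and \<open>A\<close>. This recursion replaces the iterated
  coproduct in all later proofs about the action.\<close>

lemma tri_sn:
  assumes "Y \<in> T sM p"
  shows "tri (Suc p) a (sn sM p Y b)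
    = bind1 sM (Suc p) (comul A a) (\<lambda>u w. sn sM p (tri p u Y) (w * b))"
proof (rule tlin_pr_eqI[OF _ _ _ assms])
  show "tlin sM p sM (Suc p) (\<lambda>Y. tri (Suc p) a (sn sM p Y b))"
    by (assumption | rule linear_rules)+
  show "tlin sM p sM (Suc p) (\<lambda>Y. bind1 sM (Suc p) (comul A a) (\<lambda>u w. sn sM p (tri p u Y) (w * b)))"
    by (assumption | rule linear_rules)+
  fix y and bs :: "'a list" assume l: "length bs = p"
  \<comment> \<open>For fixed \<open>y\<close>, \<open>bs\<close> and \<open>b\<close>, the maps
    \<open>\<phi>\<close> and, below, \<open>\<psi>\<close> are linear on \<open>A^(p+2)\<close> and
    \<open>A^(p+1)\<close>; at the iterated coproducts their values are the actions on
    \<open>y \<otimes> bs \<otimes> b\<close> and on \<open>y \<otimes> bs\<close>.\<close>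
  define \<phi> where "\<phi> = (\<lambda>Z. sw sM (Suc p) Z (\<lambda>(u, us). pr sM (act M u y) (map2 (*) us (bs @ [b]))))"
  have m: "mlin (scl A) (Suc p) sM (Suc p) (\<lambda>u us. pr sM (act M u y) (map2 (*) us (bs @ [b])))"
    by (rule linear_rules) (simp add: l)
  have \<phi>: "tlin (scl A) (Suc p) sM (Suc p) \<phi>" unfolding \<phi>_def by (rule tlin_sw[OF m])
  define \<psi> where "\<psi> = (\<lambda>Z. sw sM p Z (\<lambda>(u, us). pr sM (act M u y) (map2 (*) us bs)))"
  have \<psi>: "tlin (scl A) p sM p \<psi>" unfolding \<psi>_def by (rule tlin_sw[OF mlin_shuffle_left[OF l]])
  have \<phi>_sn: "\<phi> (sn (scl A) p Z w) = sn sM p (\<psi> Z) (w * b)" if "Z \<in> T (scl A) p" for Z w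
  proof (rule tlin_pr_eqI[OF _ _ _ that])
    show "tlin (scl A) p sM (Suc p) (\<lambda>Z. \<phi> (sn (scl A) p Z w))"
      by (assumption | rule lin_comp[OF \<phi>] linear_rules)+
    show "tlin (scl A) p sM (Suc p) (\<lambda>Z. sn sM p (\<psi> Z) (w * b))"
      by (assumption | rule \<psi> linear_rules)+
    fix u and us :: "'a list" assume l': "length us = p"
    have "\<phi> (pr (scl A) u (us @ [w])) = pr sM (act M u y) (map2 (*) us bs @ [w * b])"
      unfolding \<phi>_def using sw_pr[OF m, of "us @ [w]" u] l l' by simp
    moreover have "\<psi> (pr (scl A) u us) = pr sM (act M u y) (map2 (*) us bs)"
      unfolding \<psi>_def using sw_pr[OF mlin_shuffle_left[OF l] l'] .
    ultimately show "\<phi> (sn (scl A) p (pr (scl A) u us) w) = sn sM p (\<psi> (pr (scl A) u us)) (w * b)"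
      using l l' by (simp add: sn_pr)
  qed
  have "tri (Suc p) a (sn sM p (pr sM y bs) b) = \<phi> (comul_iter A (Suc p) a)"
    by (simp add: sn_pr tri_pr l \<phi>_def del: comul_iter.simps)
  also have "\<dots> = bind1 sM (Suc p) (comul A a) (\<lambda>u w. sn sM p (\<psi> (comul_iter A p u)) (w * b))"
    unfolding comul_iter_snoc by (simp add: tlin_comul_swap[OF \<phi>] \<phi>_sn)
  also have "\<dots> = bind1 sM (Suc p) (comul A a) (\<lambda>u w. sn sM p (tri p u (pr sM y bs)) (w * b))"
    by (simp add: tri_pr l \<psi>_def)
  finally show "tri (Suc p) a (sn sM p (pr sM y bs) b)
      = bind1 sM (Suc p) (comul A a) (\<lambda>u w. sn sM p (tri p u (pr sM y bs)) (w * b))" .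
qed

lemma tlin_tri: "tlin sM p sM p (tri p a)"
  by (rule linear_rules)+

text \<open>The diagonal action on a tensor product is associative because the comultiplication is
  multiplicative; the base case is the module axiom of \<open>M\<close>.\<close>

lemma tri_mult: "X \<in> T sM p \<Longrightarrow> tri p (a * b) X = tri p a (tri p b X)"
proof (induction p arbitrary: a b X)
  case 0
  show ?case
    by (rule tlin_0_eqI[OF _ _ _ 0]) (rule linear_rules | simp add: tri_Nil act_mult)+
next
  case (Suc p)
  show ?case
  proof (rule tlin_sn_eqI[OF _ _ _ Suc.prems])
    show "tlin sM (Suc p) sM (Suc p) (tri (Suc p) (a * b))" by (rule linear_rules)+
    show "tlin sM (Suc p) sM (Suc p) (\<lambda>X. tri (Suc p) a (tri (Suc p) b X))" by (rule linear_rules)+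
    fix Y c assume Y: "Y \<in> T sM p"
    have "tri (Suc p) (a * b) (sn sM p Y c) = bind1 sM (Suc p) (comul A (a * b))
        (\<lambda>u w. sn sM p (tri p u Y) (w * c))"
      by (rule tri_sn[OF Y])
    also have "\<dots> = bind1 sM (Suc p) (comul A a) (\<lambda>u u'. bind1 sM (Suc p) (comul A b)
        (\<lambda>w w'. sn sM p (tri p (u * w) Y) (u' * w' * c)))"
      by (rule comul_mult) (assumption | rule linear_rules Y tri_in_T[OF Y])+
    \<comment> \<open>In the iterated action \<open>b\<close> acts first, so its coproduct becomes
      the outer sum.\<close>
    also have "\<dots> = bind1 sM (Suc p) (comul A b) (\<lambda>w w'. bind1 sM (Suc p) (comul A a)
        (\<lambda>u u'. sn sM p (tri p (u * w) Y) (u' * w' * c)))"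
      by (rule bind1_commute[OF comul_in_T comul_in_T]) (simp add: Y)
    also have "\<dots> = tri (Suc p) a (tri (Suc p) b (sn sM p Y c))"
      by (simp add: tri_sn Y tlin_comul_swap[OF tlin_tri] Suc.IH mult.assoc)
    finally show "tri (Suc p) (a * b) (sn sM p Y c) = tri (Suc p) a (tri (Suc p) b (sn sM p Y c))" .
  qed
qed

subsection \<open>The cofaces of \<open>M \<otimes> A\<^sup>p\<close>\<close>

text \<open>Intended for \<open>j \<le> p\<close>. The last operator of \<open>c_map\<close> uses
  the coaction of the source of a cochain and is not of this form.\<close>

definition coface_gen :: "nat \<Rightarrow> nat \<Rightarrow> 'm \<Rightarrow> 'a list \<Rightarrow> ('m, 'a, 'k) tensor" where
  "coface_gen p j y bs = (if j = 0
     then bind1 sM (Suc p) (coact M y) (\<lambda>z w. pr sM z (w # bs))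
     else bind1 sM (Suc p) (comul A (bs ! (j - 1))) (\<lambda>u w. pr sM y (take (j - 1) bs @ u # w # drop j bs)))"

definition coface :: "nat \<Rightarrow> nat \<Rightarrow> ('m, 'a, 'k) tensor \<Rightarrow> ('m, 'a, 'k) tensor" where
  "coface p j X = sw sM (Suc p) X (\<lambda>(y, bs). coface_gen p j y bs)"

text \<open>Together with \<open>coface_gen_last\<close> this is a recursion on \<open>p\<close>: a
  coface with \<open>j \<le> p\<close> does not see the appended factor, and the top one sees
  nothing else.\<close>

lemma coface_gen_snoc:
  assumes "length bs = p" "j \<le> p"
  shows "coface_gen (Suc p) j y (bs @ [b]) = sn sM (Suc p) (coface_gen p j y bs) b"
proof -
  have sn: "tlin sM (Suc p) sM (Suc (Suc p)) (\<lambda>X. sn sM (Suc p) X b)"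
    by (rule linear_rules)+
  show ?thesis
    using assms
    by (auto simp: coface_gen_def tlin_comul_swap[OF sn] tlin_coact_swap[OF sn] sn_pr nth_append)
qed

lemma coface_gen_last:
  assumes "length bs = p"
  shows "coface_gen (Suc p) (Suc p) y (bs @ [b])
    = bind1 sM (Suc (Suc p)) (comul A b) (\<lambda>u w. sn sM (Suc p) (sn sM p (pr sM y bs) u) w)"
  using assms by (simp add: coface_gen_def sn_pr nth_append)

lemma mlin_coface_gen: "j \<le> p \<Longrightarrow> mlin sM p sM (Suc p) (coface_gen p j)"
proof (induction p)
  case 0
  then show ?case
    by (auto simp: coface_gen_def intro!: mlin_0I linear_rules)
next
  case (Suc p)
  show ?case
  proof (cases "j \<le> p")
    case True
    note IH = Suc.IH[OF True]
    have "mlin sM p sM (Suc (Suc p)) (\<lambda>y bs. sn sM (Suc p) (coface_gen p j y bs) b)" for b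
      by (rule mlin_comp[OF _ IH]) (rule linear_rules)+
    then have 1: "mlin sM p sM (Suc (Suc p)) (\<lambda>y bs. coface_gen (Suc p) j y (bs @ [b]))" for b
      by (rule mlin_cong) (simp add: coface_gen_snoc True)
    show ?thesis
    proof (rule mlin_snocI[OF 1])
      fix y and bs :: "'a list" assume l: "length bs = p"
      have "lin UNIV (scl A) sM (Suc (Suc p)) (\<lambda>b. sn sM (Suc p) (coface_gen p j y bs) b)"
        by (rule linear_rules mlin_in_T[OF IH l])+
      then show "lin UNIV (scl A) sM (Suc (Suc p)) (\<lambda>b. coface_gen (Suc p) j y (bs @ [b]))"
        by (simp add: coface_gen_snoc True l)
    qed
  next
    case False
    then have j: "j = Suc p" using Suc.prems by simp
    have "tlin sM p sM (Suc (Suc p))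
        (\<lambda>X. bind1 sM (Suc (Suc p)) (comul A b) (\<lambda>u w. sn sM (Suc p) (sn sM p X u) w))" for b
      by (assumption | rule linear_rules)+
    from mlin_comp[OF this mlin_pr]
    have 1: "mlin sM p sM (Suc (Suc p)) (\<lambda>y bs. coface_gen (Suc p) j y (bs @ [b]))" for b
      by (rule mlin_cong) (simp add: coface_gen_last j)
    show ?thesis
    proof (rule mlin_snocI[OF 1])
      fix y and bs :: "'a list" assume l: "length bs = p"
      have "lin UNIV (scl A) sM (Suc (Suc p))
        (\<lambda>b. bind1 sM (Suc (Suc p)) (comul A b) (\<lambda>u w. sn sM (Suc p) (sn sM p (pr sM y bs) u) w))"
        by (assumption | rule linear_rules l)+
      then show "lin UNIV (scl A) sM (Suc (Suc p)) (\<lambda>b. coface_gen (Suc p) j y (bs @ [b]))"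
        by (simp add: coface_gen_last j l)
    qed
  qed
qed

lemma lin_coface [linear_rules]:
  "lin C s sM p \<phi> \<Longrightarrow> j \<le> p \<Longrightarrow> lin C s sM (Suc p) (\<lambda>x. coface p j (\<phi> x))"
  unfolding coface_def by (rule lin_sw_arg[OF _ mlin_coface_gen])

lemma tlin_coface: "j \<le> p \<Longrightarrow> tlin sM p sM (Suc p) (coface p j)"
  by (rule lin_coface[OF tlin_id])

lemma coface_in_T [linear_rules, simp]: "X \<in> T sM p \<Longrightarrow> j \<le> p \<Longrightarrow> coface p j X \<in> T sM (Suc p)"
  by (rule lin_in_T[OF tlin_coface])

lemma coface_pr: "length bs = p \<Longrightarrow> j \<le> p \<Longrightarrow> coface p j (pr sM y bs) = coface_gen p j y bs"
  unfolding coface_def by (rule sw_pr[OF mlin_coface_gen])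

lemma coface_Nil: "coface 0 0 (pr sM y []) = coact M y"
  using bind1_sn_id[OF coact_in_T[of y]] by (simp add: coface_pr coface_gen_def sn_pr)

lemma coface_sn:
  assumes "X \<in> T sM p" "j \<le> p"
  shows "coface (Suc p) j (sn sM p X b) = sn sM (Suc p) (coface p j X) b"
proof -
  have snoc: "coface (Suc p) j (pr sM y (bs @ [b])) = sn sM (Suc p) (coface_gen p j y bs) b"
    if "length bs = p" for y bs
    using coface_pr[of "bs @ [b]" "Suc p" j y] assms(2) that by (simp add: coface_gen_snoc)
  show ?thesis
    by (rule tlin_pr_eqI[OF _ _ _ assms(1)])
       (assumption | rule linear_rules le_SucI assms(2) | simp add: assms(2) sn_pr coface_pr snoc)+
qed

text \<open>The top coface is \<open>id \<otimes> \<Delta>\<close> with respect to the last factor.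
  As \<open>X\<close> is arbitrary, the meaning of the other factors is irrelevant, and the same
  operator serves for \<open>(A^n \<otimes> M) \<otimes> A\<close>.\<close>

lemma coface_last_sn:
  assumes "X \<in> T sM p"
  shows "coface (Suc p) (Suc p) (sn sM p X b)
    = bind1 sM (Suc (Suc p)) (comul A b) (\<lambda>u w. sn sM (Suc p) (sn sM p X u) w)"
proof (rule tlin_pr_eqI[OF _ _ _ assms])
  show "tlin sM p sM (Suc (Suc p)) (\<lambda>X. coface (Suc p) (Suc p) (sn sM p X b))"
    by (rule linear_rules | simp)+
  show "tlin sM p sM (Suc (Suc p))
      (\<lambda>X. bind1 sM (Suc (Suc p)) (comul A b) (\<lambda>u w. sn sM (Suc p) (sn sM p X u) w))"
    by (rule linear_rules)+
  fix y and bs :: "'a list" assume "length bs = p"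
  then show "coface (Suc p) (Suc p) (sn sM p (pr sM y bs) b)
      = bind1 sM (Suc (Suc p)) (comul A b) (\<lambda>u w. sn sM (Suc p) (sn sM p (pr sM y bs) u) w)"
    using coface_gen_last[of bs p y b] coface_pr[of "bs @ [b]" "Suc p" "Suc p" y]
    by (simp add: sn_pr)
qed

lemma tlin_sn: "tlin sM p sM (Suc p) (\<lambda>X. sn sM p X b)"
  by (rule linear_rules)+

lemma coact_eq_bind1: "coact M y = bind1 sM (Suc 0) (coact M y) (\<lambda>z w. sn sM 0 (pr sM z []) w)"
  by (rule bind1_sn_id[OF coact_in_T, symmetric])

text \<open>The base case is coassociativity of the coaction. In the step, cofaces acting on
  different factors commute, and two cofaces meeting in the last factor are compared by
  coassociativity of the comultiplication.\<close>

lemma coface_coface: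
  "X \<in> T sM p \<Longrightarrow> i < j \<Longrightarrow> j \<le> Suc p
    \<Longrightarrow> coface (Suc p) j (coface p i X) = coface (Suc p) i (coface p (j - 1) X)"
proof (induction p arbitrary: i j X)
  case 0
  then have ij: "i = 0" "j = Suc 0" by auto
  let ?n = "Suc (Suc 0)"
  have c: "tlin sM (Suc 0) sM ?n (coface (Suc 0) i)" if "i \<le> Suc 0" for i
    by (rule tlin_coface[OF that])
  have "coface (Suc 0) (Suc 0) (coface 0 0 (pr sM y [])) = coface (Suc 0) 0 (coface 0 0 (pr sM y []))" for y
  proof -
    have "coface (Suc 0) (Suc 0) (coact M y) = bind1 sM ?n (coact M y) (\<lambda>z w. bind1 sM ?n (comul A w)
        (\<lambda>u v. sn sM (Suc 0) (sn sM 0 (pr sM z []) u) v))"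
      by (subst coact_eq_bind1) (simp add: tlin_coact_swap[OF c] coface_last_sn)
    also have "\<dots> = bind1 sM ?n (coact M y) (\<lambda>z w. bind1 sM ?n (coact M z)
        (\<lambda>x v. sn sM (Suc 0) (sn sM 0 (pr sM x []) v) w))"
      by (rule coact_coassoc[symmetric]) (assumption | rule linear_rules | simp)+
    also have "\<dots> = bind1 sM ?n (coact M y) (\<lambda>z w. sn sM (Suc 0)
        (bind1 sM (Suc 0) (coact M z) (\<lambda>x v. sn sM 0 (pr sM x []) v)) w)"
      by (simp add: tlin_coact_swap[OF tlin_sn])
    also have "\<dots> = bind1 sM ?n (coact M y) (\<lambda>z w. coface (Suc 0) 0 (sn sM 0 (pr sM z []) w))"
      by (simp add: coface_sn coface_Nil coact_eq_bind1[symmetric])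
    also have "\<dots> = coface (Suc 0) 0 (bind1 sM (Suc 0) (coact M y) (\<lambda>z w. sn sM 0 (pr sM z []) w))"
      by (simp add: tlin_coact_swap[OF c])
    finally show ?thesis
      by (simp add: coface_Nil coact_eq_bind1[symmetric])
  qed
  then have "coface (Suc 0) (Suc 0) (coface 0 0 X) = coface (Suc 0) 0 (coface 0 0 X)"
    by (rule tlin_0_eqI[rotated 2, OF _ 0(1)]) (rule linear_rules | simp)+
  then show ?case by (simp add: ij)
next
  case (Suc p)
  let ?n = "Suc (Suc (Suc p))"
  have j1: "j - 1 \<le> Suc p" "i \<le> Suc p" using Suc.prems by auto
  have c: "tlin sM (Suc (Suc p)) sM ?n (coface (Suc (Suc p)) i)" if "i \<le> Suc (Suc p)" for i
    by (rule tlin_coface[OF that])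
  show ?case
  proof (rule tlin_sn_eqI[OF _ _ _ Suc.prems(1)])
    show "tlin sM (Suc p) sM ?n (\<lambda>X. coface (Suc (Suc p)) j (coface (Suc p) i X))"
      using Suc.prems by (intro linear_rules) auto
    show "tlin sM (Suc p) sM ?n (\<lambda>X. coface (Suc (Suc p)) i (coface (Suc p) (j - 1) X))"
      using Suc.prems by (intro linear_rules) auto
    fix Y b assume Y: "Y \<in> T sM p"
    \<comment> \<open>The cases tell whether none, exactly one or both of the two cofaces act on the
      last factor \<open>b\<close>.\<close>
    consider (lower) "j \<le> Suc p" | (top) "j = Suc (Suc p)" "i \<le> p" | (both) "j = Suc (Suc p)" "i = Suc p"
      using Suc.prems by linarith
    then show "coface (Suc (Suc p)) j (coface (Suc p) i (sn sM p Y b))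
        = coface (Suc (Suc p)) i (coface (Suc p) (j - 1) (sn sM p Y b))"
    proof cases
      case lower
      then have "i \<le> p" "j - 1 \<le> p" using Suc.prems by auto
      then show ?thesis
        using lower by (simp add: coface_sn Y Suc.IH[OF Y Suc.prems(2) lower])
    next
      case top
      then show ?thesis
        by (simp add: coface_sn coface_last_sn Y tlin_comul_swap[OF c])
    next
      case both
      have "coface (Suc (Suc p)) (Suc (Suc p)) (coface (Suc p) (Suc p) (sn sM p Y b))
          = bind1 sM ?n (comul A b) (\<lambda>u w. bind1 sM ?n (comul A w)
            (\<lambda>x y. sn sM (Suc (Suc p)) (sn sM (Suc p) (sn sM p Y u) x) y))"
        by (simp add: coface_last_sn Y tlin_comul_swap[OF c])
      also have "\<dots> = bind1 sM ?n (comul A b) (\<lambda>u w. bind1 sM ?n (comul A u)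
            (\<lambda>x y. sn sM (Suc (Suc p)) (sn sM (Suc p) (sn sM p Y x) y) w))"
        by (rule comul_coassoc[symmetric]) (assumption | rule linear_rules Y | simp add: Y)+
      also have "\<dots> = coface (Suc (Suc p)) (Suc p) (coface (Suc p) (Suc p) (sn sM p Y b))"
        by (simp add: coface_last_sn coface_sn Y tlin_comul_swap[OF c] tlin_comul_swap[OF tlin_sn])
      finally show ?thesis by (simp add: both)
    qed
  qed
qed

text \<open>Linearity of the cofaces over \<open>A\<close>. For \<open>M\<close> itself it is the
  Hopf module compatibility; a coface away from the last factor follows by induction, and the top
  one needs multiplicativity of the comultiplication together with coassociativity.\<close>

lemma coface_tri:
  "Y \<in> T sM p \<Longrightarrow> j \<le> p \<Longrightarrow> coface p j (tri p a Y) = tri (Suc p) a (coface p j Y)"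
proof (induction p arbitrary: a j Y)
  case 0
  have "coface 0 0 (tri 0 a (pr sM y [])) = tri (Suc 0) a (coface 0 0 (pr sM y []))" for y
  proof -
    have "coface 0 0 (tri 0 a (pr sM y [])) =
       bind1 sM (Suc 0) (coact M (act M a y)) (\<lambda>z w. sn sM 0 (pr sM z []) w)"
      by (simp add: tri_Nil coface_Nil coact_eq_bind1[symmetric])
    also have "\<dots> = bind1 sM (Suc 0) (comul A a) (\<lambda>u u'. bind1 sM (Suc 0) (coact M y)
        (\<lambda>w w'. sn sM 0 (pr sM (act M u w) []) (u' * w')))"
      by (rule coact_act) (assumption | rule linear_rules | simp)+
    also have "\<dots> = bind1 sM (Suc 0) (coact M y) (\<lambda>w w'. bind1 sM (Suc 0) (comul A a)
        (\<lambda>u u'. sn sM 0 (pr sM (act M u w) []) (u' * w')))"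
      by (rule bind1_commute[OF comul_in_T coact_in_T]) simp
    also have "\<dots> = tri (Suc 0) a (bind1 sM (Suc 0) (coact M y) (\<lambda>z w. sn sM 0 (pr sM z []) w))"
      by (simp add: tlin_coact_swap[OF tlin_tri] tri_sn tri_Nil)
    finally show ?thesis
      by (simp add: coface_Nil coact_eq_bind1[symmetric])
  qed
  then have "coface 0 0 (tri 0 a Y) = tri (Suc 0) a (coface 0 0 Y)"
    by (rule tlin_0_eqI[rotated 2, OF _ 0(1)]) (rule linear_rules | simp)+
  then show ?case using 0(2) by simp
next
  case (Suc p)
  let ?n = "Suc (Suc p)"
  have c: "tlin sM (Suc p) sM ?n (coface (Suc p) j)" if "j \<le> Suc p" for j
    by (rule tlin_coface[OF that])
  show ?case
  proof (rule tlin_sn_eqI[OF _ _ _ Suc.prems(1)])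
    show "tlin sM (Suc p) sM ?n (\<lambda>Y. coface (Suc p) j (tri (Suc p) a Y))"
      using Suc.prems by (intro linear_rules) auto
    show "tlin sM (Suc p) sM ?n (\<lambda>Y. tri ?n a (coface (Suc p) j Y))"
      using Suc.prems by (intro linear_rules) auto
    fix Y b assume Y: "Y \<in> T sM p"
    show "coface (Suc p) j (tri (Suc p) a (sn sM p Y b)) = tri ?n a (coface (Suc p) j (sn sM p Y b))"
    proof (cases "j \<le> p")
      case True
      then show ?thesis
        using Suc.prems by (simp add: tri_sn coface_sn Y tlin_comul_swap[OF c] Suc.IH)
    next
      case False
      then have j: "j = Suc p" using Suc.prems by simp
      have "coface (Suc p) (Suc p) (tri (Suc p) a (sn sM p Y b))
          = bind1 sM ?n (comul A a) (\<lambda>u w. bind1 sM ?n (comul A (w * b))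
              (\<lambda>x y. sn sM (Suc p) (sn sM p (tri p u Y) x) y))"
        by (simp add: tri_sn coface_last_sn Y tlin_comul_swap[OF c])
      also have "\<dots> = bind1 sM ?n (comul A a) (\<lambda>u w. bind1 sM ?n (comul A w) (\<lambda>v v'. bind1 sM ?n (comul A b)
              (\<lambda>x y. sn sM (Suc p) (sn sM p (tri p u Y) (v * x)) (v' * y))))"
        by (subst comul_mult) (assumption | rule linear_rules Y refl | simp add: Y)+
      \<comment> \<open>So far the second component of \<open>a\<close> is split again. Splitting
        the first one instead gives the pattern of two successive applications of
        \<open>tri_sn\<close>.\<close>
      also have "\<dots> = bind1 sM ?n (comul A a) (\<lambda>u w. bind1 sM ?n (comul A u) (\<lambda>v v'. bind1 sM ?n (comul A b)
              (\<lambda>x y. sn sM (Suc p) (sn sM p (tri p v Y) (v' * x)) (w * y))))"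
        by (rule comul_coassoc[symmetric]) (assumption | rule linear_rules Y | simp add: Y)+
      \<comment> \<open>In two exchanges the coproduct of \<open>b\<close> moves to the outside,
        since on the right-hand side the coface is applied before the action.\<close>
      also have "\<dots> = bind1 sM ?n (comul A a) (\<lambda>u w. bind1 sM ?n (comul A b) (\<lambda>x y. bind1 sM ?n (comul A u)
              (\<lambda>v v'. sn sM (Suc p) (sn sM p (tri p v Y) (v' * x)) (w * y))))"
        by (subst bind1_commute[OF comul_in_T comul_in_T]) (simp_all add: Y)
      also have "\<dots> = bind1 sM ?n (comul A b) (\<lambda>x y. bind1 sM ?n (comul A a) (\<lambda>u w. bind1 sM ?n (comul A u)
              (\<lambda>v v'. sn sM (Suc p) (sn sM p (tri p v Y) (v' * x)) (w * y))))"
        by (rule bind1_commute[OF comul_in_T comul_in_T]) (simp add: Y)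
      also have "\<dots> = tri ?n a (coface (Suc p) (Suc p) (sn sM p Y b))"
        by (simp add: coface_last_sn tri_sn Y tlin_comul_swap[OF tlin_tri] tlin_comul_swap[OF tlin_sn])
      finally show ?thesis by (simp add: j)
    qed
  qed
qed

end

context hopf
begin

subsection \<open>The codiagonal coaction and the faces of \<open>A\<^sup>n \<otimes> M\<close>\<close>

text \<open>
  The map \<open>Y \<otimes> h \<mapsto> (u \<otimes> Y) \<otimes> w h\<close>: the codiagonal coaction on \<open>a \<otimes> Y\<close> is the sum of its values at the
  coaction of \<open>Y\<close>, with \<open>u = a\<^sub>1\<close> and \<open>w = a\<^sub>2\<close>.
\<close>

definition coact_cons :: "nat \<Rightarrow> 'a \<Rightarrow> 'a \<Rightarrow> ('m, 'a, 'k) tensor \<Rightarrow> ('m, 'a, 'k) tensor" where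
  "coact_cons n u w Z = bindS sM sM (Suc (Suc n)) Z (\<lambda>Y h. sn sM (Suc n) (cs sM n u Y) (w * h))"

lemma lin_coact_cons [linear_rules]:
  "lin C s sM (Suc n) \<phi> \<Longrightarrow> lin C s sM (Suc (Suc n)) (\<lambda>x. coact_cons n u w (\<phi> x))"
  unfolding coact_cons_def by (assumption | rule linear_rules)+

lemma lin_coact_cons_left [linear_rules]:
  assumes "Z \<in> T sM (Suc n)" "vlin C s (scl A) h"
  shows "lin C s sM (Suc (Suc n)) (\<lambda>x. coact_cons n (h x) w Z)"
    and "lin C s sM (Suc (Suc n)) (\<lambda>x. coact_cons n u (h x) Z)"
  unfolding coact_cons_def by (assumption | rule linear_rules assms)+

lemma tlin_coact_cons: "tlin sM (Suc n) sM (Suc (Suc n)) (coact_cons n u w)"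
  by (rule linear_rules)+

lemma coact_cons_in_T [linear_rules, simp]:
  "Z \<in> T sM (Suc n) \<Longrightarrow> coact_cons n u w Z \<in> T sM (Suc (Suc n))"
  by (rule lin_in_T[OF tlin_coact_cons])

lemma coact_cons_sn:
  "Y \<in> T sM n \<Longrightarrow> coact_cons n u w (sn sM n Y h) = sn sM (Suc n) (cs sM n u Y) (w * h)"
  unfolding coact_cons_def by (rule bindS_sn) (assumption | rule linear_rules)+

lemma codiag_in_T [simp]: "length as = n \<Longrightarrow> codiag A M as m \<in> T sM (Suc n)"
  and codiag_Cons: "length as = n \<Longrightarrow> codiag A M (a # as) m
    = bind1 sM (Suc (Suc n)) (comul A a) (\<lambda>u w. coact_cons n u w (codiag A M as m))"
proof -
  \<comment> \<open>Recursion and membership depend on each other: the body of the inner sum may be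
    rewritten only once the tail is known to be a tensor, and membership for the longer list is read
    off the rewritten form.\<close>
  have *: "codiag A M (a # as) m
      = bind1 sM (Suc (Suc n)) (comul A a) (\<lambda>u w. coact_cons n u w (codiag A M as m))"
    if n: "n = length as" and T: "codiag A M as m \<in> T sM (Suc n)" for n a as
  proof -
    have "pr sM x (u # butlast ys @ [w * last ys])
        = sn sM (Suc n) (cs sM n u (pr sM x (butlast ys))) (w * last ys)"
      if "length ys = Suc n" for x ys u w
      using that by (simp add: cs_pr sn_pr)
    then have "sw sM (Suc (Suc n)) (codiag A M as m) (\<lambda>(x, ys). pr sM x (u # butlast ys @ [w * last ys]))
        = coact_cons n u w (codiag A M as m)" for u w
      unfolding coact_cons_def bindS_def by (rule sw_cong[OF T])
    then show ?thesis by (simp add: bind1_def n)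
  qed
  have T: "codiag A M as m \<in> T sM (Suc (length as))" for as
  proof (induction as)
    case (Cons a as)
    then show ?case using *[OF refl Cons, of a] by (simp del: codiag.simps(2))
  qed simp
  then show "length as = n \<Longrightarrow> codiag A M as m \<in> T sM (Suc n)" by metis
  show "length as = n \<Longrightarrow> codiag A M (a # as) m
    = bind1 sM (Suc (Suc n)) (comul A a) (\<lambda>u w. coact_cons n u w (codiag A M as m))"
    using *[of n as a] T[of as] by blast
qed

lemma mlin_codiag: "mlin sM n sM (Suc n) (\<lambda>m as. codiag A M as m)"
proof (induction n)
  case 0
  show ?case by (rule mlin_0I) (simp, rule linear_rules, rule linear_rules)
next
  case (Suc n)
  have t: "tlin sM (Suc n) sM (Suc (Suc n))
      (\<lambda>X. bind1 sM (Suc (Suc n)) (comul A a) (\<lambda>u w. coact_cons n u w X))" for a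
    by (assumption | rule linear_rules)+
  have 1: "mlin sM n sM (Suc (Suc n)) (\<lambda>m as. codiag A M (a # as) m)" for a
    by (rule mlin_cong[OF mlin_comp[OF t[of a] Suc]]) (simp add: codiag_Cons del: codiag.simps(2))
  show ?case
  proof (rule mlin_consI[OF 1])
    fix m and as :: "'a list" assume l: "length as = n"
    show "lin UNIV (scl A) sM (Suc (Suc n)) (\<lambda>b. codiag A M (b # as) m)"
      unfolding codiag_Cons[OF l] by (rule linear_rules codiag_in_T l)+
  qed
qed

definition rho :: "nat \<Rightarrow> ('m, 'a, 'k) tensor \<Rightarrow> ('m, 'a, 'k) tensor" where
  "rho n X = sw sM (Suc n) X (\<lambda>(m, as). codiag A M as m)"

lemma lin_rho [linear_rules]: "lin C s sM n \<phi> \<Longrightarrow> lin C s sM (Suc n) (\<lambda>x. rho n (\<phi> x))"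
  unfolding rho_def by (rule lin_sw_arg[OF _ mlin_codiag])

lemma tlin_rho: "tlin sM n sM (Suc n) (rho n)"
  by (rule linear_rules)+

lemma rho_in_T [linear_rules, simp]: "X \<in> T sM n \<Longrightarrow> rho n X \<in> T sM (Suc n)"
  by (rule lin_in_T[OF tlin_rho])

lemma rho_pr: "length as = n \<Longrightarrow> rho n (pr sM m as) = codiag A M as m"
  unfolding rho_def by (rule sw_pr[OF mlin_codiag])

lemma rho_Nil: "rho 0 (pr sM m []) = coact M m"
  by (simp add: rho_pr)

text \<open>\<open>A^(n+1) \<otimes> M\<close> is the tensor product of the comodules
  \<open>A\<close> and \<open>A^n \<otimes> M\<close>; this is the dual of \<open>tri_sn\<close>,
  with the new factor on the left.\<close>

lemma rho_cs:
  "X \<in> T sM n \<Longrightarrow> rho (Suc n) (cs sM n a X)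
    = bind1 sM (Suc (Suc n)) (comul A a) (\<lambda>u w. coact_cons n u w (rho n X))"
  by (rule tlin_pr_eqI[where sU = sM and q = n])
     (assumption | rule linear_rules | simp add: cs_pr rho_pr codiag_Cons del: codiag.simps(2))+

text \<open>The map \<open>Y \<otimes> h \<otimes> h' \<mapsto> (x \<otimes> Y) \<otimes> y h \<otimes> z h'\<close>.\<close>

definition coact_cons2 :: "nat \<Rightarrow> 'a \<Rightarrow> 'a \<Rightarrow> 'a \<Rightarrow> ('m, 'a, 'k) tensor \<Rightarrow> ('m, 'a, 'k) tensor" where
  "coact_cons2 n x y z Z =
     bindS sM sM (Suc (Suc (Suc n))) Z (\<lambda>Y h. sn sM (Suc (Suc n)) (coact_cons n x y Y) (z * h))"

lemma lin_coact_cons2 [linear_rules]: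
  "lin C s sM (Suc (Suc n)) \<phi> \<Longrightarrow> lin C s sM (Suc (Suc (Suc n))) (\<lambda>v. coact_cons2 n x y z (\<phi> v))"
  unfolding coact_cons2_def by (assumption | rule linear_rules)+

lemma lin_coact_cons2_left [linear_rules]:
  assumes "Z \<in> T sM (Suc (Suc n))" "vlin C s (scl A) h"
  shows "lin C s sM (Suc (Suc (Suc n))) (\<lambda>v. coact_cons2 n (h v) y z Z)"
    and "lin C s sM (Suc (Suc (Suc n))) (\<lambda>v. coact_cons2 n x (h v) z Z)"
    and "lin C s sM (Suc (Suc (Suc n))) (\<lambda>v. coact_cons2 n x y (h v) Z)"
  unfolding coact_cons2_def by (assumption | rule linear_rules assms)+

lemma tlin_coact_cons2: "tlin sM (Suc (Suc n)) sM (Suc (Suc (Suc n))) (coact_cons2 n x y z)"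
  by (rule linear_rules)+

lemma coact_cons2_in_T [linear_rules, simp]:
  "Z \<in> T sM (Suc (Suc n)) \<Longrightarrow> coact_cons2 n x y z Z \<in> T sM (Suc (Suc (Suc n)))"
  by (rule lin_in_T[OF tlin_coact_cons2])

lemma coact_cons2_sn:
  "Y \<in> T sM (Suc n) \<Longrightarrow>
    coact_cons2 n x y z (sn sM (Suc n) Y h) = sn sM (Suc (Suc n)) (coact_cons n x y Y) (z * h)"
  unfolding coact_cons2_def by (rule bindS_sn) (assumption | rule linear_rules)+

text \<open>Coacting a second time splits the component \<open>u\<close> that was put in front,
  while \<open>w\<close> stays in the outermost right factor. The counterpart
  \<open>coface_coact_cons\<close> splits \<open>w\<close> instead; both end in
  \<open>coact_cons2\<close>, so that coassociativity can compare them.\<close>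

lemma rx_rho_coact_cons:
  assumes Z: "Z \<in> T sM (Suc n)"
  shows "rx sM sM (Suc (Suc n)) (rho (Suc n)) (coact_cons n u w Z)
    = bind1 sM (Suc (Suc (Suc n))) (comul A u)
        (\<lambda>x y. coact_cons2 n x y w (rx sM sM (Suc n) (rho n) Z))"
proof (rule tlin_sn_eqI[OF _ _ _ Z])
  show "tlin sM (Suc n) sM (Suc (Suc (Suc n)))
      (\<lambda>Z. rx sM sM (Suc (Suc n)) (rho (Suc n)) (coact_cons n u w Z))"
    by (assumption | rule linear_rules)+
  show "tlin sM (Suc n) sM (Suc (Suc (Suc n)))
      (\<lambda>Z. bind1 sM (Suc (Suc (Suc n))) (comul A u)
        (\<lambda>x y. coact_cons2 n x y w (rx sM sM (Suc n) (rho n) Z)))"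
    by (assumption | rule linear_rules tlin_rho)+
  fix Y h assume Y: "Y \<in> T sM n"
  show "rx sM sM (Suc (Suc n)) (rho (Suc n)) (coact_cons n u w (sn sM n Y h))
    = bind1 sM (Suc (Suc (Suc n))) (comul A u)
        (\<lambda>x y. coact_cons2 n x y w (rx sM sM (Suc n) (rho n) (sn sM n Y h)))"
    by (simp add: coact_cons_sn rx_sn[OF tlin_rho] Y rho_cs coact_cons2_sn tlin_comul_swap[OF tlin_sn])
qed

text \<open>The last factor is a product \<open>w * h\<close>, so multiplicativity of the
  comultiplication separates the part belonging to \<open>w\<close> from the comultiplication
  applied to \<open>Z\<close>.\<close>

lemma coface_coact_cons:
  assumes Z: "Z \<in> T sM (Suc n)"
  shows "coface (Suc (Suc n)) (Suc (Suc n)) (coact_cons n u w Z)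
    = bind1 sM (Suc (Suc (Suc n))) (comul A w)
        (\<lambda>x y. coact_cons2 n u x y (coface (Suc n) (Suc n) Z))"
proof (rule tlin_sn_eqI[OF _ _ _ Z])
  show "tlin sM (Suc n) sM (Suc (Suc (Suc n)))
      (\<lambda>Z. coface (Suc (Suc n)) (Suc (Suc n)) (coact_cons n u w Z))"
    by (assumption | rule linear_rules order.refl)+
  show "tlin sM (Suc n) sM (Suc (Suc (Suc n)))
      (\<lambda>Z. bind1 sM (Suc (Suc (Suc n))) (comul A w)
        (\<lambda>x y. coact_cons2 n u x y (coface (Suc n) (Suc n) Z)))"
    by (assumption | rule linear_rules order.refl)+
  fix Y h assume Y: "Y \<in> T sM n"
  have "coface (Suc (Suc n)) (Suc (Suc n)) (coact_cons n u w (sn sM n Y h))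
    = bind1 sM (Suc (Suc (Suc n))) (comul A (w * h))
        (\<lambda>x y. sn sM (Suc (Suc n)) (sn sM (Suc n) (cs sM n u Y) x) y)"
    by (simp add: coact_cons_sn Y coface_last_sn)
  also have "\<dots> = bind1 sM (Suc (Suc (Suc n))) (comul A w) (\<lambda>x y. bind1 sM (Suc (Suc (Suc n))) (comul A h)
        (\<lambda>x' y'. sn sM (Suc (Suc n)) (sn sM (Suc n) (cs sM n u Y) (x * x')) (y * y')))"
    by (rule comul_mult) (assumption | rule linear_rules Y | simp add: Y)+
  also have "\<dots> = bind1 sM (Suc (Suc (Suc n))) (comul A w)
        (\<lambda>x y. coact_cons2 n u x y (coface (Suc n) (Suc n) (sn sM n Y h)))"
    by (simp add: coface_last_sn Y coact_cons2_sn coact_cons_sn tlin_comul_swap[OF tlin_coact_cons2])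
  finally show "coface (Suc (Suc n)) (Suc (Suc n)) (coact_cons n u w (sn sM n Y h))
    = bind1 sM (Suc (Suc (Suc n))) (comul A w)
        (\<lambda>x y. coact_cons2 n u x y (coface (Suc n) (Suc n) (sn sM n Y h)))" .
qed

text \<open>Comodule coassociativity of \<open>A^n \<otimes> M\<close>, with the top coface in the
  role of \<open>id \<otimes> \<Delta>\<close>. The step is the usual argument that a tensor product
  of comodules over a bialgebra is a comodule.\<close>

lemma rho_coassoc:
  "X \<in> T sM n \<Longrightarrow> rx sM sM (Suc n) (rho n) (rho n X) = coface (Suc n) (Suc n) (rho n X)"
proof (induction n arbitrary: X)
  case 0
  have c: "tlin sM (Suc 0) sM (Suc (Suc 0)) (rx sM sM (Suc 0) (rho 0))"
    "tlin sM (Suc 0) sM (Suc (Suc 0)) (coface (Suc 0) (Suc 0))"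
    by (assumption | rule linear_rules tlin_rho order.refl)+
  have eq: "rx sM sM (Suc 0) (rho 0) (rho 0 (pr sM m [])) = coface (Suc 0) (Suc 0) (rho 0 (pr sM m []))" for m
  proof -
    have "rx sM sM (Suc 0) (rho 0) (coact M m) = bind1 sM (Suc (Suc 0)) (coact M m)
        (\<lambda>z w. sn sM (Suc 0) (coact M z) w)"
      by (subst coact_eq_bind1) (simp add: tlin_coact_swap[OF c(1)] rx_sn[OF tlin_rho] rho_Nil)
    also have "\<dots> = bind1 sM (Suc (Suc 0)) (coact M m) (\<lambda>z w. sn sM (Suc 0) 
        (bind1 sM (Suc 0) (coact M z) (\<lambda>x v. sn sM 0 (pr sM x []) v)) w)"
      by (simp add: coact_eq_bind1[symmetric])
    also have "\<dots> = bind1 sM (Suc (Suc 0)) (coact M m) (\<lambda>z w. bind1 sM (Suc (Suc 0)) (coact M z)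
        (\<lambda>x v. sn sM (Suc 0) (sn sM 0 (pr sM x []) v) w))"
      by (simp add: tlin_coact_swap[OF tlin_sn])
    also have "\<dots> = bind1 sM (Suc (Suc 0)) (coact M m) (\<lambda>z w. bind1 sM (Suc (Suc 0)) (comul A w)
        (\<lambda>u v. sn sM (Suc 0) (sn sM 0 (pr sM z []) u) v))"
      by (rule coact_coassoc) (assumption | rule linear_rules | simp)+
    also have "\<dots> = coface (Suc 0) (Suc 0) (bind1 sM (Suc 0) (coact M m) (\<lambda>z w. sn sM 0 (pr sM z []) w))"
      by (simp add: tlin_coact_swap[OF c(2)] coface_last_sn)
    finally show ?thesis by (simp add: rho_Nil coact_eq_bind1[symmetric])
  qed
  show ?case
    by (rule tlin_0_eqI[OF _ _ _ 0]) (assumption | rule linear_rules tlin_rho order.refl eq)+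
next
  case (Suc n)
  let ?n = "Suc (Suc (Suc n))"
  have c: "tlin sM (Suc (Suc n)) sM ?n (rx sM sM (Suc (Suc n)) (rho (Suc n)))"
    "tlin sM (Suc (Suc n)) sM ?n (coface (Suc (Suc n)) (Suc (Suc n)))"
    by (assumption | rule linear_rules tlin_rho order.refl)+
  show ?case
  proof (rule tlin_cs_eqI[OF _ _ _ Suc.prems])
    show "tlin sM (Suc n) sM ?n (\<lambda>X. rx sM sM (Suc (Suc n)) (rho (Suc n)) (rho (Suc n) X))"
      by (assumption | rule linear_rules tlin_rho)+
    show "tlin sM (Suc n) sM ?n (\<lambda>X. coface (Suc (Suc n)) (Suc (Suc n)) (rho (Suc n) X))"
      by (assumption | rule linear_rules order.refl)+
    fix X a assume X: "X \<in> T sM n"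
    have Y: "coface (Suc n) (Suc n) (rho n X) \<in> T sM (Suc (Suc n))" by (simp add: X)
    have "rx sM sM (Suc (Suc n)) (rho (Suc n)) (rho (Suc n) (cs sM n a X))
        = bind1 sM ?n (comul A a) (\<lambda>u w. bind1 sM ?n (comul A u)
            (\<lambda>x y. coact_cons2 n x y w (coface (Suc n) (Suc n) (rho n X))))"
      by (simp add: rho_cs X tlin_comul_swap[OF c(1)] rx_rho_coact_cons Suc.IH)
    also have "\<dots> = bind1 sM ?n (comul A a) (\<lambda>u w. bind1 sM ?n (comul A w)
            (\<lambda>x y. coact_cons2 n u x y (coface (Suc n) (Suc n) (rho n X))))"
      by (rule comul_coassoc) (assumption | rule linear_rules Y)+
    also have "\<dots> = coface (Suc (Suc n)) (Suc (Suc n)) (rho (Suc n) (cs sM n a X))"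
      by (simp add: rho_cs X tlin_comul_swap[OF c(2)] coface_coact_cons)
    finally show "rx sM sM (Suc (Suc n)) (rho (Suc n)) (rho (Suc n) (cs sM n a X))
        = coface (Suc (Suc n)) (Suc (Suc n)) (rho (Suc n) (cs sM n a X))" .
  qed
qed

section \<open>Face maps of \<open>A^n \<otimes> M\<close>\<close>

definition face_gen :: "nat \<Rightarrow> nat \<Rightarrow> 'm \<Rightarrow> 'a list \<Rightarrow> ('m, 'a, 'k) tensor" where
  "face_gen n i m as = (if i \<le> n
     then pr sM m (take (i - 1) as @ (as ! (i - 1) * as ! i) # drop (i + 1) as)
     else pr sM (act M (last as) m) (butlast as))"

definition face :: "nat \<Rightarrow> nat \<Rightarrow> ('m, 'a, 'k) tensor \<Rightarrow> ('m, 'a, 'k) tensor" where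
  "face n i X = sw sM n X (\<lambda>(m, as). face_gen n i m as)"

lemma face_gen_Cons:
  assumes "length as = Suc n" "i \<noteq> 0" "i \<le> Suc n"
  shows "face_gen (Suc n) (Suc i) m (a # as) = cs sM n a (face_gen n i m as)"
proof (cases "i \<le> n")
  case True
  then show ?thesis using assms by (cases i) (auto simp: face_gen_def cs_pr)
next
  case False
  then show ?thesis using assms by (auto simp: face_gen_def cs_pr)
qed

lemma face_gen_first: "face_gen (Suc n) (Suc 0) m (a # b # as) = pr sM m (a * b # as)"
  by (simp add: face_gen_def)

lemma face_gen_act: "face_gen 0 (Suc 0) m [a] = pr sM (act M a m) []"
  by (simp add: face_gen_def)

lemma mlin_face_gen: "i \<noteq> 0 \<Longrightarrow> i \<le> Suc n \<Longrightarrow> mlin sM (Suc n) sM n (face_gen n i)"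
proof (induction n arbitrary: i)
  case 0
  then have i: "i = Suc 0" by simp
  show ?case
    unfolding i
    by (rule mlin_consI, rule mlin_0I) (simp_all add: face_gen_act lin_pr vlin_act vlin_id)
next
  case (Suc n)
  show ?case
  proof (cases "i = Suc 0")
    case True
    show ?thesis
      unfolding True
    \<comment> \<open>The first face combines the two leading entries, so both are split off before
      it takes a recognisable form.\<close>
    proof (rule mlin_consI, rule mlin_consI)
      show "mlin sM n sM (Suc n) (\<lambda>m as. face_gen (Suc n) (Suc 0) m (a # b # as))" for a b
        unfolding face_gen_first by (rule linear_rules)
      show "lin UNIV (scl A) sM (Suc n) (\<lambda>b. face_gen (Suc n) (Suc 0) m (a # b # as))"
        if "length as = n" for m a as
        unfolding face_gen_first by (rule linear_rules)+ (simp add: that)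
      show "lin UNIV (scl A) sM (Suc n) (\<lambda>a. face_gen (Suc n) (Suc 0) m (a # as))"
        if l: "length as = Suc n" for m as
      proof -
        obtain b bs where as: "as = b # bs" "length bs = n" using l by (metis length_Suc_conv)
        show ?thesis unfolding as(1) face_gen_first by (rule linear_rules)+ (simp add: as(2))
      qed
    qed
  next
    case False
    then obtain j where j: "i = Suc j" "j \<noteq> 0" "j \<le> Suc n"
      using Suc.prems by (cases i) auto
    note IH = Suc.IH[OF j(2,3)]
    have 1: "mlin sM (Suc n) sM (Suc n) (\<lambda>m as. face_gen (Suc n) i m (a # as))" for a
      unfolding j(1)
      by (rule mlin_cong[OF mlin_comp[OF lin_cs[OF tlin_id] IH]]) (simp add: face_gen_Cons j(2,3))
    show ?thesis
    proof (rule mlin_consI[OF 1])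
      fix m and as :: "'a list" assume l: "length as = Suc n"
      show "lin UNIV (scl A) sM (Suc n) (\<lambda>b. face_gen (Suc n) i m (b # as))"
        unfolding j(1) face_gen_Cons[OF l j(2,3)]
        by (rule linear_rules mlin_in_T[OF IH l])+
    qed
  qed
qed

lemma lin_face [linear_rules]:
  "lin C s sM (Suc n) \<phi> \<Longrightarrow> i \<noteq> 0 \<Longrightarrow> i \<le> Suc n \<Longrightarrow> lin C s sM n (\<lambda>x. face n i (\<phi> x))"
  unfolding face_def by (rule lin_sw_arg[OF _ mlin_face_gen])

lemma tlin_face: "i \<noteq> 0 \<Longrightarrow> i \<le> Suc n \<Longrightarrow> tlin sM (Suc n) sM n (face n i)"
  by (rule lin_face[OF tlin_id])

lemma face_in_T [linear_rules, simp]: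
  "X \<in> T sM (Suc n) \<Longrightarrow> i \<noteq> 0 \<Longrightarrow> i \<le> Suc n \<Longrightarrow> face n i X \<in> T sM n"
  by (rule lin_in_T[OF tlin_face])

lemma face_pr:
  "length as = Suc n \<Longrightarrow> i \<noteq> 0 \<Longrightarrow> i \<le> Suc n \<Longrightarrow> face n i (pr sM m as) = face_gen n i m as"
  unfolding face_def by (rule sw_pr[OF mlin_face_gen])

lemma face_cs:
  assumes "X \<in> T sM (Suc n)" "i \<noteq> 0" "i \<le> Suc n"
  shows "face (Suc n) (Suc i) (cs sM (Suc n) a X) = cs sM n a (face n i X)"
  by (rule tlin_pr_eqI[OF _ _ _ assms(1)])
     (assumption | rule linear_rules nat.distinct(2) assms(2,3) Suc_le_mono[THEN iffD2]
       | simp add: assms(2,3) cs_pr face_pr face_gen_Cons)+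

lemma face_first_cs:
  assumes "X \<in> T sM n"
  shows "face (Suc n) (Suc 0) (cs sM (Suc n) a (cs sM n b X)) = cs sM n (a * b) X"
  by (rule tlin_pr_eqI[OF _ _ _ assms])
     (assumption | rule linear_rules nat.distinct(2) | simp add: cs_pr face_pr face_gen_first)+

lemma face_act: "face 0 (Suc 0) (cs sM 0 a (pr sM m [])) = pr sM (act M a m) []"
  by (simp add: cs_pr face_pr face_gen_act)

text \<open>Peeling factors from the left until both faces are visible leaves three situations:
  disjoint faces commute, adjacent products agree by associativity of \<open>A\<close>, and in the
  base case a product followed by the action is the module axiom.\<close>

lemma face_face:
  "X \<in> T sM (Suc (Suc n)) \<Longrightarrow> 0 < i \<Longrightarrow> i < j \<Longrightarrow> j \<le> Suc (Suc n)
    \<Longrightarrow> face n i (face (Suc n) j X) = face n (j - 1) (face (Suc n) i X)"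
proof (induction n arbitrary: i j X)
  case 0
  then have ij: "i = Suc 0" "j = Suc (Suc 0)" by auto
  have "face 0 (Suc 0) (face (Suc 0) (Suc (Suc 0)) X) = face 0 (Suc 0) (face (Suc 0) (Suc 0) X)"
    if "X \<in> T sM (Suc (Suc 0))" for X
  proof (rule tlin_cs_eqI[OF _ _ _ that])
    show "tlin sM (Suc (Suc 0)) sM 0 (\<lambda>X. face 0 (Suc 0) (face (Suc 0) (Suc (Suc 0)) X))"
      by (rule linear_rules | simp)+
    show "tlin sM (Suc (Suc 0)) sM 0 (\<lambda>X. face 0 (Suc 0) (face (Suc 0) (Suc 0) X))"
      by (rule linear_rules | simp)+
    fix Y a assume "Y \<in> T sM (Suc 0)"
    then show "face 0 (Suc 0) (face (Suc 0) (Suc (Suc 0)) (cs sM (Suc 0) a Y))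
      = face 0 (Suc 0) (face (Suc 0) (Suc 0) (cs sM (Suc 0) a Y))"
    proof (rule tlin_cs_eqI[rotated 3])
      show "tlin sM (Suc 0) sM 0 (\<lambda>Y. face 0 (Suc 0) (face (Suc 0) (Suc (Suc 0)) (cs sM (Suc 0) a Y)))"
        by (rule linear_rules | simp)+
      show "tlin sM (Suc 0) sM 0 (\<lambda>Y. face 0 (Suc 0) (face (Suc 0) (Suc 0) (cs sM (Suc 0) a Y)))"
        by (rule linear_rules | simp)+
      fix Y b assume Y: "Y \<in> T sM 0"
      have eq: "face 0 (Suc 0) (face (Suc 0) (Suc (Suc 0)) (cs sM (Suc 0) a (cs sM 0 b (pr sM m []))))
        = face 0 (Suc 0) (face (Suc 0) (Suc 0) (cs sM (Suc 0) a (cs sM 0 b (pr sM m []))))" for m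
        by (simp add: face_cs face_first_cs face_act act_mult)
      show "face 0 (Suc 0) (face (Suc 0) (Suc (Suc 0)) (cs sM (Suc 0) a (cs sM 0 b Y)))
        = face 0 (Suc 0) (face (Suc 0) (Suc 0) (cs sM (Suc 0) a (cs sM 0 b Y)))"
        by (rule tlin_0_eqI[OF _ _ _ Y]) (rule linear_rules eq | simp)+
    qed
  qed
  then show ?case using 0 by (simp add: ij)
next
  case (Suc n)
  let ?P = "\<lambda>X. face (Suc n) i (face (Suc (Suc n)) j X) = face (Suc n) (j - 1) (face (Suc (Suc n)) i X)"
  obtain j' where j: "j = Suc j'" "j' \<noteq> 0" "j' \<le> Suc (Suc n)" "i \<le> j'"
    using Suc.prems by (cases j) auto
  have i: "i \<noteq> 0" "i \<le> Suc (Suc n)" using Suc.prems by auto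
  have lins: "tlin sM (Suc (Suc (Suc n))) sM (Suc n) (\<lambda>X. face (Suc n) i (face (Suc (Suc n)) j X))"
      "tlin sM (Suc (Suc (Suc n))) sM (Suc n) (\<lambda>X. face (Suc n) (j - 1) (face (Suc (Suc n)) i X))"
    using i j by (auto intro!: linear_rules)
  have cs: "lin (T sM q) (ts sM q) sM (Suc q) (cs sM q a)" for q a
    by (rule linear_rules)+
  show ?case
  proof (rule tlin_cs_eqI[OF lins _ Suc.prems(1)])
    fix Y a assume Y: "Y \<in> T sM (Suc (Suc n))"
    show "?P (cs sM (Suc (Suc n)) a Y)"
    proof (cases "i = Suc 0")
      case False
      then obtain i' where i': "i = Suc i'" "i' \<noteq> 0" "i' \<le> Suc n" "i' < j'" using i j Suc.prems
        by (cases i) auto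
      then obtain k where k: "j' = Suc k" "k \<noteq> 0" "k \<le> Suc n" using j by (cases j') auto
      have "face n i' (face (Suc n) j' Y) = face n (j' - 1) (face (Suc n) i' Y)"
        by (rule Suc.IH[OF Y]) (use i' j in auto)
      then show ?thesis
        using i' j k by (simp add: face_cs Y)
    next
      case True
      show ?thesis
      proof (rule tlin_cs_eqI[OF lin_comp[OF lins(1) cs] lin_comp[OF lins(2) cs] _ Y])
        fix Z b assume Z: "Z \<in> T sM (Suc n)"
        show "?P (cs sM (Suc (Suc n)) a (cs sM (Suc n) b Z))"
        \<comment> \<open>A later face only touches factors beyond \<open>a\<close> and
          \<open>b\<close> and commutes with forming \<open>a * b\<close>; for \<open>j' = 1\<close>
          the two bracketings of \<open>a * b * c\<close> are compared, which needs a third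
          factor.\<close>
        proof (cases "j' = Suc 0")
          case False
          then obtain k where k: "j' = Suc k" "k \<noteq> 0" "k \<le> Suc n" using j by (cases j') auto
          then show ?thesis
            by (simp add: True j(1) face_cs face_first_cs Z)
        next
          case j': True
          show ?thesis
          proof (rule tlin_cs_eqI[OF lin_comp[OF lin_comp[OF lins(1) cs] cs]
                lin_comp[OF lin_comp[OF lins(2) cs] cs] _ Z])
            fix W c assume W: "W \<in> T sM n"
            then show "?P (cs sM (Suc (Suc n)) a (cs sM (Suc n) b (cs sM n c W)))"
              by (simp add: True j(1) j' face_cs face_first_cs mult.assoc)
          qed
        qed
      qed
    qed
  qed
qed

lemma rx_face_coact_cons:
  assumes Z: "Z \<in> T sM (Suc (Suc n))" and i: "i \<noteq> 0" "i \<le> Suc n"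
  shows "rx sM sM (Suc n) (face (Suc n) (Suc i)) (coact_cons (Suc n) u w Z)
    = coact_cons n u w (rx sM sM n (face n i) Z)"
proof (rule tlin_sn_eqI[OF _ _ _ Z])
  have f: "tlin sM (Suc n) sM n (face n i)" "tlin sM (Suc (Suc n)) sM (Suc n) (face (Suc n) (Suc i))"
    using i by (auto intro!: tlin_face)
  show "tlin sM (Suc (Suc n)) sM (Suc (Suc n))
      (\<lambda>Z. rx sM sM (Suc n) (face (Suc n) (Suc i)) (coact_cons (Suc n) u w Z))"
    by (assumption | rule linear_rules f)+
  show "tlin sM (Suc (Suc n)) sM (Suc (Suc n)) (\<lambda>Z. coact_cons n u w (rx sM sM n (face n i) Z))"
    by (assumption | rule linear_rules f)+
  fix Y h assume Y: "Y \<in> T sM (Suc n)"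
  show "rx sM sM (Suc n) (face (Suc n) (Suc i)) (coact_cons (Suc n) u w (sn sM (Suc n) Y h))
    = coact_cons n u w (rx sM sM n (face n i) (sn sM (Suc n) Y h))"
    by (simp add: coact_cons_sn Y rx_sn[OF f(1)] rx_sn[OF f(2)] face_cs i)
qed

text \<open>Colinearity of the faces. The action map \<open>A \<otimes> M \<rightarrow> M\<close> is
  colinear by the Hopf module compatibility and the product
  \<open>A \<otimes> A \<rightarrow> A\<close> by multiplicativity of the comultiplication; all
  other faces leave the first factor alone.\<close>

lemma rho_face:
  "X \<in> T sM (Suc n) \<Longrightarrow> i \<noteq> 0 \<Longrightarrow> i \<le> Suc n
    \<Longrightarrow> rho n (face n i X) = rx sM sM n (face n i) (rho (Suc n) X)"
proof (induction n arbitrary: i X)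
  case 0
  then have i: "i = Suc 0" by simp
  have f: "tlin sM (Suc 0) sM 0 (face 0 (Suc 0))" by (rule tlin_face) simp_all
  have c: "tlin sM (Suc (Suc 0)) sM (Suc 0) (rx sM sM 0 (face 0 (Suc 0)))"
    by (rule linear_rules f)+
  have eq: "rho 0 (face 0 (Suc 0) (cs sM 0 a (pr sM m [])))
      = rx sM sM 0 (face 0 (Suc 0)) (rho (Suc 0) (cs sM 0 a (pr sM m [])))" for a m
  proof -
    have "rho 0 (face 0 (Suc 0) (cs sM 0 a (pr sM m [])))
        = bind1 sM (Suc 0) (coact M (act M a m)) (\<lambda>z w. sn sM 0 (pr sM z []) w)"
      by (simp add: face_act rho_Nil coact_eq_bind1[symmetric])
    also have "\<dots> = bind1 sM (Suc 0) (comul A a) (\<lambda>u u'. bind1 sM (Suc 0) (coact M m)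
        (\<lambda>w w'. sn sM 0 (pr sM (act M u w) []) (u' * w')))"
      by (rule coact_act) (assumption | rule linear_rules | simp)+
    also have "\<dots> = bind1 sM (Suc 0) (comul A a) (\<lambda>u u'. bind1 sM (Suc 0) (coact M m)
        (\<lambda>w w'. rx sM sM 0 (face 0 (Suc 0)) (coact_cons 0 u u' (sn sM 0 (pr sM w []) w'))))"
      by (simp add: coact_cons_sn rx_sn[OF f] face_act)
    also have "\<dots> = bind1 sM (Suc 0) (comul A a) (\<lambda>u u'. rx sM sM 0 (face 0 (Suc 0)) (coact_cons 0 u u'
        (bind1 sM (Suc 0) (coact M m) (\<lambda>w w'. sn sM 0 (pr sM w []) w'))))"
      by (simp add: tlin_coact_swap[OF tlin_coact_cons] tlin_coact_swap[OF c])
    also have "\<dots> = rx sM sM 0 (face 0 (Suc 0)) (rho (Suc 0) (cs sM 0 a (pr sM m [])))"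
      by (simp add: coact_eq_bind1[symmetric] rho_cs rho_Nil tlin_comul_swap[OF c])
    finally show ?thesis .
  qed
  show ?case
    unfolding i
  proof (rule tlin_cs_eqI[OF _ _ _ 0(1)])
    show "tlin sM (Suc 0) sM (Suc 0) (\<lambda>X. rho 0 (face 0 (Suc 0) X))"
      by (rule linear_rules f | simp)+
    show "tlin sM (Suc 0) sM (Suc 0) (\<lambda>X. rx sM sM 0 (face 0 (Suc 0)) (rho (Suc 0) X))"
      by (rule linear_rules f)+
    show "rho 0 (face 0 (Suc 0) (cs sM 0 a Y)) = rx sM sM 0 (face 0 (Suc 0)) (rho (Suc 0) (cs sM 0 a Y))"
      if "Y \<in> T sM 0" for Y a
      by (rule tlin_0_eqI[OF _ _ _ that]) (rule linear_rules f eq | simp)+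
  qed
next
  case (Suc n)
  let ?n = "Suc (Suc n)"
  have f: "tlin sM ?n sM (Suc n) (face (Suc n) i)" by (rule tlin_face[OF Suc.prems(2,3)])
  have c: "tlin sM (Suc ?n) sM ?n (rx sM sM (Suc n) (face (Suc n) i))"
    by (rule linear_rules f)+
  have lins: "tlin sM ?n sM ?n (\<lambda>X. rho (Suc n) (face (Suc n) i X))"
    "tlin sM ?n sM ?n (\<lambda>X. rx sM sM (Suc n) (face (Suc n) i) (rho ?n X))"
    by (rule linear_rules f Suc.prems(2,3))+
  have cs: "tlin sM q sM (Suc q) (cs sM q a)" for q a
    by (rule linear_rules)+
  show ?case
  proof (rule tlin_cs_eqI[OF lins _ Suc.prems(1)])
    fix Y a assume Y: "Y \<in> T sM (Suc n)"
    show "rho (Suc n) (face (Suc n) i (cs sM (Suc n) a Y))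
      = rx sM sM (Suc n) (face (Suc n) i) (rho ?n (cs sM (Suc n) a Y))"
    proof (cases "i = Suc 0")
      case False
      then obtain j where j: "i = Suc j" "j \<noteq> 0" "j \<le> Suc n" using Suc.prems by (cases i) auto
      show ?thesis
        unfolding j(1)
        by (simp add: face_cs rho_cs Y tlin_comul_swap[OF c[unfolded j(1)]]
            rx_face_coact_cons Suc.IH j(2,3))
    next
      case True
      \<comment> \<open>Two prependings followed by a product of the first two factors are one
        prepending with the products of the components.\<close>
      have rx_first: "rx sM sM (Suc n) (face (Suc n) (Suc 0)) (coact_cons (Suc n) u w (coact_cons n u' w' Z))
          = coact_cons n (u * u') (w * w') Z" if "Z \<in> T sM (Suc n)" for Z u w u' w'
      proof (rule tlin_sn_eqI[OF _ _ _ that])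
        note f1 = f[unfolded True]
        show "tlin sM (Suc n) sM ?n (\<lambda>Z. rx sM sM (Suc n) (face (Suc n) (Suc 0))
            (coact_cons (Suc n) u w (coact_cons n u' w' Z)))"
          by (rule linear_rules f1)+
        show "tlin sM (Suc n) sM ?n (coact_cons n (u * u') (w * w'))"
          by (rule linear_rules)+
        show "rx sM sM (Suc n) (face (Suc n) (Suc 0)) (coact_cons (Suc n) u w (coact_cons n u' w' (sn sM n V h)))
            = coact_cons n (u * u') (w * w') (sn sM n V h)" if "V \<in> T sM n" for V h
          by (simp add: coact_cons_sn that rx_sn[OF f1] face_first_cs mult.assoc)
      qed
      show ?thesis
      proof (rule tlin_cs_eqI[OF lin_comp[OF lins(1) cs] lin_comp[OF lins(2) cs] _ Y])
        fix V b assume V: "V \<in> T sM n"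
        have R: "rho n V \<in> T sM (Suc n)" by (simp add: V)
        have "rho (Suc n) (face (Suc n) i (cs sM (Suc n) a (cs sM n b V)))
            = bind1 sM ?n (comul A (a * b)) (\<lambda>u w. coact_cons n u w (rho n V))"
          by (simp add: True face_first_cs V rho_cs)
        also have "\<dots> = bind1 sM ?n (comul A a) (\<lambda>u u'. bind1 sM ?n (comul A b)
            (\<lambda>w w'. coact_cons n (u * w) (u' * w') (rho n V)))"
          by (rule comul_mult) (assumption | rule linear_rules R)+
        also have "\<dots> = rx sM sM (Suc n) (face (Suc n) i) (rho ?n (cs sM (Suc n) a (cs sM n b V)))"
          by (simp add: rho_cs V tlin_comul_swap[OF c[unfolded True]] tlin_comul_swap[OF tlin_coact_cons]
              rx_first True)
        finally show "rho (Suc n) (face (Suc n) i (cs sM (Suc n) a (cs sM n b V)))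
            = rx sM sM (Suc n) (face (Suc n) i) (rho ?n (cs sM (Suc n) a (cs sM n b V)))" .
      qed
    qed
  qed
qed

end

section \<open>Alternating sums\<close>

context tensor_calculus
begin

lemma lin_add: "lin C s sV p \<phi> \<Longrightarrow> lin C s sV p \<psi> \<Longrightarrow> lin C s sV p (\<lambda>x. \<phi> x + \<psi> x)"
  by (simp add: lin_def ts_add ac_simps)

lemma lin_ts: "lin C s sV p \<phi> \<Longrightarrow> lin C s sV p (\<lambda>x. ts sV p c (\<phi> x))"
  by (simp add: lin_def ts_add ts_ts mult.commute)

text \<open>The index set must be nonempty, since the empty sum \<open>{0}\<close> is not a tensor
  in general. The sums in the differentials always contain the index \<open>0\<close>.\<close>

lemma lin_sum:
  "finite I \<Longrightarrow> I \<noteq> {} \<Longrightarrow> (\<And>i. i \<in> I \<Longrightarrow> lin C s sV p (\<phi> i)) \<Longrightarrow> lin C s sV p (\<lambda>x. \<Sum>i\<in>I. \<phi> i x)"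
  by (induction I rule: finite_ne_induct) (simp_all add: lin_add)

lemma sum_in_T: "finite I \<Longrightarrow> I \<noteq> {} \<Longrightarrow> (\<And>i. i \<in> I \<Longrightarrow> X i \<in> T sV p) \<Longrightarrow> (\<Sum>i\<in>I. X i) \<in> T sV p"
  by (induction I rule: finite_ne_induct) simp_all

lemma ts_sum: "finite I \<Longrightarrow> I \<noteq> {} \<Longrightarrow> (\<And>i. i \<in> I \<Longrightarrow> X i \<in> T sV p)
    \<Longrightarrow> ts sV p c (\<Sum>i\<in>I. X i) = (\<Sum>i\<in>I. ts sV p c (X i))"
  by (induction I rule: finite_ne_induct) (simp_all add: ts_add sum_in_T)

text \<open>
  Tensors are sets, which have no additive inverses, so the cancellation takes place between
  representatives. Equal cosets have equal chosen representatives.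
\<close>

lemma alternating_sum_null:
  assumes T: "\<And>i j. j \<le> Suc m \<Longrightarrow> i \<le> m \<Longrightarrow> G j i \<in> T sV p"
    and simplicial: "\<And>i j. i < j \<Longrightarrow> j \<le> Suc m \<Longrightarrow> G j i = G i (j - 1)"
  shows "(\<Sum>j = 0..Suc m. \<Sum>i = 0..m. ts sV p ((- 1) ^ j) (ts sV p ((- 1) ^ i) (G j i))) = null sV p"
proof -
  define r where "r = (\<lambda>j i. SOME t. t \<in> G j i)"
  define h where "h = (\<lambda>(j, i). free_scale ((- 1) ^ (j + i)) (r j i))"
  let ?S = "{0..Suc m} \<times> {0..m}"
  let ?A = "{(j, i). i < j \<and> j \<le> Suc m}" and ?B = "{(j, i). j \<le> i \<and> i \<le> m}"
  have S: "?S = ?A \<union> ?B" "?A \<inter> ?B = {}" by auto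
  have fin: "finite ?A" "finite ?B"
    by (rule finite_subset[of _ ?S]; force)+
  \<comment> \<open>The simplicial identity pairs \<open>(j, i)\<close> above the diagonal with
    \<open>(i, j - 1)\<close>; the index sum drops by one, which reverses the sign.\<close>
  have "sum h ?A = (\<Sum>x\<in>?B. - h x)"
  proof (rule sum.reindex_bij_witness[where i = "\<lambda>(j, i). (Suc i, j)" and j = "\<lambda>(j, i). (i, j - 1)"])
    fix x assume "x \<in> ?A"
    then obtain i k where x: "x = (Suc k, i)" "i \<le> k" "k \<le> m"
      by (cases x) (metis (mono_tags, lifting) Suc_le_mono case_prodD less_Suc_eq_le mem_Collect_eq
          not0_implies_Suc not_less_zero)
    have "r (Suc k) i = r i k" using simplicial[of i "Suc k"] x by (simp add: r_def)
    then show "- h (case x of (j, i) \<Rightarrow> (i, j - 1)) = h x"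
      by (simp add: x(1) h_def fs.scale_minus_left add.commute)
  qed auto
  then have zero: "sum h ?S = 0"
    unfolding S(1) by (simp add: sum.union_disjoint[OF fin S(2)] sum_negf)
  have "(\<Sum>j = 0..Suc m. \<Sum>i = 0..m. ts sV p ((- 1) ^ j) (ts sV p ((- 1) ^ i) (G j i)))
      = (\<Sum>j = 0..Suc m. \<Sum>i = 0..m. ts sV p ((- 1) ^ (j + i)) (G j i))"
    by (intro sum.cong refl) (simp add: ts_ts T power_add)
  also have "\<dots> = (\<Sum>(j, i)\<in>?S. ts sV p ((- 1) ^ (j + i)) (G j i))"
    by (rule sum.cartesian_product)
  also have "\<dots> = (\<Sum>x\<in>?S. ts sV p ((- 1) ^ (fst x + snd x)) (G (fst x) (snd x)))" (is "_ = ?sum")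
    by (simp add: split_beta)
  \<comment> \<open>Harmless for a nonempty sum of tensors, and it gives the sum the shape required
    by \<open>sum_cl\<close>.\<close>
  also have "?sum = ?sum + null sV p"
    by (rule add_null[symmetric], rule sum_in_T) (auto intro!: T_scale T)
  also have "\<dots> = cl sV p (\<Sum>x\<in>?S. free_scale ((- 1) ^ (fst x + snd x)) (r (fst x) (snd x)))"
    by (rule sum_cl) (auto simp: r_def intro!: some_rep(2)[OF T])
  also have "\<dots> = null sV p"
    using zero by (simp add: h_def split_beta null_eq_cl)
  finally show ?thesis .
qed

lemma rx_cong:
  assumes "Z \<in> T sU (Suc q)" "\<And>X. X \<in> T sU q \<Longrightarrow> f X = g X"
  shows "rx sU sV p f Z = rx sU sV p g Z"
  unfolding rx_def bindS_def by (rule sw_cong[OF assms(1)]) (simp add: assms(2))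

lemma sn_add: "X \<in> T sV p \<Longrightarrow> Y \<in> T sV p \<Longrightarrow> sn sV p (X + Y) b = sn sV p X b + sn sV p Y b"
  using lin_sn[OF tlin_id, of sV p b] by (simp add: lin_def)

lemma sn_ts: "X \<in> T sV p \<Longrightarrow> sn sV p (ts sV p c X) b = ts sV (Suc p) c (sn sV p X b)"
  using lin_sn[OF tlin_id, of sV p b] by (simp add: lin_def)

lemma rx_add:
  assumes f: "tlin sU q sV p f" and g: "tlin sU q sV p g" and Z: "Z \<in> T sU (Suc q)"
  shows "rx sU sV p (\<lambda>X. f X + g X) Z = rx sU sV p f Z + rx sU sV p g Z"
proof (rule tlin_sn_eqI[OF _ _ _ Z])
  show "tlin sU (Suc q) sV (Suc p) (rx sU sV p (\<lambda>X. f X + g X))"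
    by (rule linear_rules lin_add f g)+
  show "tlin sU (Suc q) sV (Suc p) (\<lambda>Z. rx sU sV p f Z + rx sU sV p g Z)"
    by (rule linear_rules lin_add f g)+
  show "rx sU sV p (\<lambda>X. f X + g X) (sn sU q X b) = rx sU sV p f (sn sU q X b) + rx sU sV p g (sn sU q X b)"
    if "X \<in> T sU q" for X b
    by (simp add: rx_sn[OF lin_add[OF f g] that] rx_sn[OF f that] rx_sn[OF g that] sn_add
        lin_in_T[OF f that] lin_in_T[OF g that])
qed

lemma rx_ts:
  assumes f: "tlin sU q sV p f" and Z: "Z \<in> T sU (Suc q)"
  shows "rx sU sV p (\<lambda>X. ts sV p c (f X)) Z = ts sV (Suc p) c (rx sU sV p f Z)"
proof (rule tlin_sn_eqI[OF _ _ _ Z])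
  show "tlin sU (Suc q) sV (Suc p) (rx sU sV p (\<lambda>X. ts sV p c (f X)))"
    by (rule linear_rules lin_ts f)+
  show "tlin sU (Suc q) sV (Suc p) (\<lambda>Z. ts sV (Suc p) c (rx sU sV p f Z))"
    by (rule linear_rules lin_ts f)+
  show "rx sU sV p (\<lambda>X. ts sV p c (f X)) (sn sU q X b) = ts sV (Suc p) c (rx sU sV p f (sn sU q X b))"
    if "X \<in> T sU q" for X b
    by (simp add: rx_sn[OF lin_ts[OF f] that] rx_sn[OF f that] sn_ts lin_in_T[OF f that])
qed

end

section \<open>The double complex\<close>

locale hopf_pair = bialg A + M: hopf A M + N: hopf A N
  for A :: "('k::field, 'a::ring_1) bialg"
    and M :: "('k, 'a, 'm::ab_group_add) hopf_mod"
    and N :: "('k, 'a, 'n::ab_group_add) hopf_mod"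
begin

section \<open>Cochains as extensional linear maps\<close>

abbreviation "TM \<equiv> T (mscl M)"
abbreviation "coch \<equiv> cochains A M N"
abbreviation "flin n p f \<equiv> tlin (mscl M) n (mscl N) p f"

lemma coch_iff: "f \<in> coch n p \<longleftrightarrow> flin n p f \<and> f \<in> extensional (TM n)"
  by (auto simp: cochains_def lin_def PiE_def)

lemma restrict_coch: "flin n p f \<Longrightarrow> (\<lambda>X\<in>TM n. f X) \<in> coch n p"
  unfolding coch_iff by (rule conjI) (erule tlin_cong, simp_all)

lemma coch_eqI: "f \<in> coch n p \<Longrightarrow> g \<in> coch n p \<Longrightarrow> (\<And>X. X \<in> TM n \<Longrightarrow> f X = g X) \<Longrightarrow> f = g"
  unfolding coch_iff by (blast intro: extensionalityI)

lemma cochain_add_coch: "f \<in> coch n p \<Longrightarrow> g \<in> coch n p \<Longrightarrow> cochain_add A M n f g \<in> coch n p"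
  unfolding cochain_add_def by (rule restrict_coch, rule lin_add) (simp_all add: coch_iff)

lemma cochain_scale_coch: "f \<in> coch n p \<Longrightarrow> cochain_scale A M N n p c f \<in> coch n p"
  unfolding cochain_scale_def by (rule restrict_coch, rule lin_ts) (simp add: coch_iff)

lemma coch_in_T: "f \<in> coch n p \<Longrightarrow> X \<in> TM n \<Longrightarrow> f X \<in> T (mscl N) p"
  by (auto simp: coch_iff intro: lin_in_T)

text \<open>A sum of cochains is a restricted pointwise sum rather than a sum in the function type,
  so linearity of \<open>D\<close> is applied one summand at a time through
  \<open>cochain_add\<close> and \<open>cochain_scale\<close>.\<close>

lemma cochain_linear_sum:
  assumes D: "cochain_linear A M N n p n' p' D" and "finite I" "I \<noteq> {}"
    and "\<And>i. i \<in> I \<Longrightarrow> F i \<in> coch n p" and X: "X \<in> TM n'"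
  shows "D (\<lambda>X\<in>TM n. \<Sum>i\<in>I. ts (mscl N) p (c i) (F i X)) X = (\<Sum>i\<in>I. ts (mscl N) p' (c i) (D (F i) X))"
proof -
  have sc: "(\<lambda>X\<in>TM n. ts (mscl N) p (c i) (F i X)) = cochain_scale A M N n p (c i) (F i)" for i
    by (simp add: cochain_scale_def)
  have D_scale: "D (cochain_scale A M N n p (c i) (F i)) X = ts (mscl N) p' (c i) (D (F i) X)"
    if "F i \<in> coch n p" for i
    using D that X by (simp add: cochain_linear_def cochain_scale_def)
  show ?thesis
    using assms(2-4)
  proof (induction I rule: finite_ne_induct)
    case (singleton i)
    then show ?case using D_scale[of i] by (simp add: sc)
  next
    case (insert i I)
    define S where "S = (\<lambda>X\<in>TM n. \<Sum>i\<in>I. ts (mscl N) p (c i) (F i X))"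
    have S: "S \<in> coch n p"
      unfolding S_def using insert by (intro restrict_coch lin_sum lin_ts) (auto simp: coch_iff)
    have "D S X = (\<Sum>i\<in>I. ts (mscl N) p' (c i) (D (F i) X))"
      unfolding S_def by (rule insert.IH) (simp add: insert.prems)
    moreover have "(\<lambda>X\<in>TM n. \<Sum>i\<in>insert i I. ts (mscl N) p (c i) (F i X))
        = cochain_add A M n (cochain_scale A M N n p (c i) (F i)) S"
      using insert by (auto simp: S_def cochain_add_def cochain_scale_def fun_eq_iff)
    moreover have "D (cochain_add A M n (cochain_scale A M N n p (c i) (F i)) S)
        = cochain_add A M n' (D (cochain_scale A M N n p (c i) (F i))) (D S)"
      using D S insert.prems by (simp add: cochain_linear_def cochain_scale_coch)
    moreover have "cochain_add A M n' (D (cochain_scale A M N n p (c i) (F i))) (D S) X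
        = ts (mscl N) p' (c i) (D (F i) X) + D S X"
      using X D_scale[of i] insert.prems by (simp add: cochain_add_def)
    ultimately show ?case
      using insert.hyps by simp
  qed
qed

text \<open>The common form of both differentials: an alternating sum of the operators
  \<open>D 0\<close> to \<open>D m\<close>, the bound being included.\<close>

definition comb :: "nat \<Rightarrow> nat \<Rightarrow> nat \<Rightarrow> (nat \<Rightarrow> (('m, 'a, 'k) tensor \<Rightarrow> ('n, 'a, 'k) tensor)
    \<Rightarrow> ('m, 'a, 'k) tensor \<Rightarrow> ('n, 'a, 'k) tensor)
    \<Rightarrow> (('m, 'a, 'k) tensor \<Rightarrow> ('n, 'a, 'k) tensor) \<Rightarrow> ('m, 'a, 'k) tensor \<Rightarrow> ('n, 'a, 'k) tensor" where
  "comb m n p D f = (\<lambda>X\<in>TM n. \<Sum>i = 0..m. ts (mscl N) p ((- 1) ^ i) (D i f X))"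

lemma comb_coch:
  assumes "\<And>i. i \<le> m \<Longrightarrow> cochain_linear A M N n p n' p' (D i)" "f \<in> coch n p"
  shows "comb m n' p' D f \<in> coch n' p'"
  unfolding comb_def
proof (intro restrict_coch lin_sum lin_ts)
  fix i assume "i \<in> {0..m}"
  then show "flin n' p' (D i f)"
    using assms(1)[of i] assms(2) coch_iff[of "D i f" n' p'] by (auto simp: cochain_linear_def)
qed simp_all

lemma comb_linear:
  assumes D: "\<And>i. i \<le> m \<Longrightarrow> cochain_linear A M N n p n' p' (D i)"
  shows "cochain_linear A M N n p n' p' (comb m n' p' D)"
proof -
  have T: "D i f X \<in> T (mscl N) p'" if "i \<le> m" "f \<in> coch n p" "X \<in> TM n'" for i f X
    using D[OF that(1)] that(2,3) by (auto simp: cochain_linear_def intro: coch_in_T)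
  have "comb m n' p' D (cochain_add A M n f g) X = cochain_add A M n' (comb m n' p' D f) (comb m n' p' D g) X"
    if "f \<in> coch n p" "g \<in> coch n p" for f g X
  proof (cases "X \<in> TM n'")
    case True
    have "ts (mscl N) p' ((- 1) ^ i) (D i (cochain_add A M n f g) X)
        = ts (mscl N) p' ((- 1) ^ i) (D i f X) + ts (mscl N) p' ((- 1) ^ i) (D i g X)" if "i \<le> m" for i
      using D[OF that] \<open>f \<in> coch n p\<close> \<open>g \<in> coch n p\<close> True T[OF that _ True]
      by (simp add: cochain_linear_def cochain_add_def ts_add)
    then show ?thesis
      using True by (simp add: comb_def cochain_add_def sum.distrib)
  qed (simp add: comb_def cochain_add_def)
  moreover have "comb m n' p' D (cochain_scale A M N n p c f) X
      = cochain_scale A M N n' p' c (comb m n' p' D f) X"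
    if "f \<in> coch n p" for f c X
  proof (cases "X \<in> TM n'")
    case True
    have "ts (mscl N) p' ((- 1) ^ i) (D i (cochain_scale A M N n p c f) X)
        = ts (mscl N) p' c (ts (mscl N) p' ((- 1) ^ i) (D i f X))" if "i \<le> m" for i
      using D[OF that] \<open>f \<in> coch n p\<close> True T[OF that _ True]
      by (simp add: cochain_linear_def cochain_scale_def ts_ts mult.commute)
    moreover have "ts (mscl N) p' c (\<Sum>i = 0..m. ts (mscl N) p' ((- 1) ^ i) (D i f X))
        = (\<Sum>i = 0..m. ts (mscl N) p' c (ts (mscl N) p' ((- 1) ^ i) (D i f X)))"
      by (rule ts_sum) (auto intro: T[OF _ that True])
    ultimately show ?thesis
      using True by (simp add: comb_def cochain_scale_def)
  qed (simp add: comb_def cochain_scale_def)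
  ultimately show ?thesis
    using comb_coch[OF D] by (auto simp: cochain_linear_def fun_eq_iff)
qed

lemma comb_comb:
  assumes D: "\<And>i. i \<le> m \<Longrightarrow> cochain_linear A M N n p n' p' (D i)"
    and E: "\<And>j. j \<le> m' \<Longrightarrow> cochain_linear A M N n' p' n'' p'' (E j)"
    and f: "f \<in> coch n p" and X: "X \<in> TM n''"
  shows "comb m' n'' p'' E (comb m n' p' D f) X
    = (\<Sum>j = 0..m'. \<Sum>i = 0..m. ts (mscl N) p'' ((- 1) ^ j) (ts (mscl N) p'' ((- 1) ^ i) (E j (D i f) X)))"
proof -
  have Df: "D i f \<in> coch n' p'" if "i \<le> m" for i
    using D[OF that] f by (auto simp: cochain_linear_def)
  have T: "E j (D i f) X \<in> T (mscl N) p''" if "i \<le> m" "j \<le> m'" for i j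
    using E[OF that(2)] Df[OF that(1)] X by (auto simp: cochain_linear_def intro: coch_in_T)
  have "ts (mscl N) p'' ((- 1) ^ j) (E j (comb m n' p' D f) X)
      = (\<Sum>i = 0..m. ts (mscl N) p'' ((- 1) ^ j) (ts (mscl N) p'' ((- 1) ^ i) (E j (D i f) X)))"
    if j: "j \<le> m'" for j
  proof -
    have "E j (comb m n' p' D f) X = (\<Sum>i = 0..m. ts (mscl N) p'' ((- 1) ^ i) (E j (D i f) X))"
      unfolding comb_def by (rule cochain_linear_sum[OF E[OF j] _ _ _ X]) (auto intro: Df)
    then show ?thesis
      by (simp only:) (rule ts_sum, auto intro: T j)
  qed
  then show ?thesis
    unfolding comb_def[of m'] using X by simp
qed

section \<open>The operators \<open>b_i\<close>\<close>

lemma b_map_0: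
  "X \<in> TM (Suc n) \<Longrightarrow> b_map A M N n p 0 f X = bindC (mscl M) (mscl N) p X (\<lambda>a Y. N.tri p a (f Y))"
  by (simp add: b_map_def bindC_def N.tri_def)

lemma b_map_0_cs:
  assumes f: "flin n p f" and Y: "Y \<in> TM n"
  shows "b_map A M N n p 0 f (cs (mscl M) n a Y) = N.tri p a (f Y)"
proof -
  have "bindC (mscl M) (mscl N) p (cs (mscl M) n a Y) (\<lambda>a Y. N.tri p a (f Y)) = N.tri p a (f Y)"
    by (rule bindC_cs) (assumption | rule linear_rules f Y lin_in_T[OF f])+
  then show ?thesis by (simp add: b_map_0 Y)
qed

text \<open>The linear map \<open>f\<close> can be pulled out of the Sweedler sum over
  \<open>X\<close>, which leaves the sum defining the face.\<close>

lemma b_map_face: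
  assumes f: "flin n p f" and X: "X \<in> TM (Suc n)" and i: "i \<noteq> 0" "i \<le> Suc n"
  shows "b_map A M N n p i f X = f (M.face n i X)"
proof -
  have "f (M.face n i X) = sw (mscl N) p X (\<lambda>(m, as). f (M.face_gen n i m as))"
    unfolding M.face_def
    by (rule tlin_sw_swap[OF f X]) (rule mlin_in_T[OF M.mlin_face_gen[OF i]])
  then show ?thesis
    using X i by (simp add: b_map_def M.face_gen_def if_distrib[where f = f])
qed

lemma b_map_tlin:
  assumes f: "flin n p f" and i: "i \<le> Suc n"
  shows "flin (Suc n) p (b_map A M N n p i f)"
proof (cases "i = 0")
  case True
  have "flin (Suc n) p (\<lambda>X. bindC (mscl M) (mscl N) p X (\<lambda>a Y. N.tri p a (f Y)))"
    by (assumption | rule linear_rules f lin_in_T[OF f])+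
  then show ?thesis by (rule tlin_cong) (simp add: True b_map_0)
next
  case False
  show ?thesis
    by (rule tlin_cong[OF lin_comp[OF f M.tlin_face[OF False i]]]) (rule b_map_face[OF f _ False i])
qed

lemma b_map_coch: "f \<in> coch n p \<Longrightarrow> i \<le> Suc n \<Longrightarrow> b_map A M N n p i f \<in> coch (Suc n) p"
  by (simp add: coch_iff b_map_tlin) (simp add: b_map_def)

lemma tri_add: "X \<in> T (mscl N) p \<Longrightarrow> Y \<in> T (mscl N) p \<Longrightarrow> N.tri p a (X + Y) = N.tri p a X + N.tri p a Y"
  and tri_ts: "X \<in> T (mscl N) p \<Longrightarrow> N.tri p a (ts (mscl N) p c X) = ts (mscl N) p c (N.tri p a X)"
  using N.tlin_tri[of p a] by (simp_all add: lin_def)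

text \<open>For \<open>i = 0\<close> the cochain sits inside a Sweedler sum; comparing on tensors
  \<open>a \<otimes> Y\<close>, where the value is the action of \<open>a\<close> on
  \<open>f Y\<close>, reduces the claim to linearity of the action.\<close>

lemma b_map_linear:
  assumes i: "i \<le> Suc n"
  shows "cochain_linear A M N n p (Suc n) p (b_map A M N n p i)"
proof -
  have "b_map A M N n p i (cochain_add A M n f g) = cochain_add A M (Suc n) (b_map A M N n p i f) (b_map A M N n p i g)"
    if fg: "f \<in> coch n p" "g \<in> coch n p" for f g
  proof (rule coch_eqI[OF b_map_coch[OF cochain_add_coch[OF fg] i]
        cochain_add_coch[OF b_map_coch[OF fg(1) i] b_map_coch[OF fg(2) i]]])
    fix X assume X: "X \<in> TM (Suc n)"
    have l: "flin n p f" "flin n p g" "flin n p (cochain_add A M n f g)"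
      using fg cochain_add_coch[OF fg] by (simp_all add: coch_iff)
    show "b_map A M N n p i (cochain_add A M n f g) X
        = cochain_add A M (Suc n) (b_map A M N n p i f) (b_map A M N n p i g) X"
    proof (cases "i = 0")
      case True
      have "b_map A M N n p i (cochain_add A M n f g) X = b_map A M N n p i f X + b_map A M N n p i g X"
      proof (rule tlin_cs_eqI[OF b_map_tlin[OF l(3) i] lin_add[OF b_map_tlin[OF l(1) i] b_map_tlin[OF l(2) i]] _ X])
        fix Y b assume Y: "Y \<in> TM n"
        show "b_map A M N n p i (cochain_add A M n f g) (cs (mscl M) n b Y)
          = b_map A M N n p i f (cs (mscl M) n b Y) + b_map A M N n p i g (cs (mscl M) n b Y)"
          using Y l lin_in_T[OF l(1) Y] lin_in_T[OF l(2) Y]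
          by (simp add: True b_map_0_cs) (simp add: cochain_add_def tri_add)
      qed
      then show ?thesis using X by (simp add: cochain_add_def)
    next
      case False
      then show ?thesis
        using X i by (simp add: b_map_face[OF l(3)]) (simp add: b_map_face l cochain_add_def)
    qed
  qed
  moreover have "b_map A M N n p i (cochain_scale A M N n p c f) = cochain_scale A M N (Suc n) p c (b_map A M N n p i f)"
    if f: "f \<in> coch n p" for f c
  proof (rule coch_eqI[OF b_map_coch[OF cochain_scale_coch[OF f] i]
        cochain_scale_coch[OF b_map_coch[OF f i]]])
    fix X assume X: "X \<in> TM (Suc n)"
    have l: "flin n p f" "flin n p (cochain_scale A M N n p c f)"
      using f cochain_scale_coch[OF f] by (simp_all add: coch_iff)
    show "b_map A M N n p i (cochain_scale A M N n p c f) X = cochain_scale A M N (Suc n) p c (b_map A M N n p i f) X"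
    proof (cases "i = 0")
      case True
      have "b_map A M N n p i (cochain_scale A M N n p c f) X = ts (mscl N) p c (b_map A M N n p i f X)"
      proof (rule tlin_cs_eqI[OF b_map_tlin[OF l(2) i] lin_ts[OF b_map_tlin[OF l(1) i]] _ X])
        fix Y b assume Y: "Y \<in> TM n"
        show "b_map A M N n p i (cochain_scale A M N n p c f) (cs (mscl M) n b Y)
          = ts (mscl N) p c (b_map A M N n p i f (cs (mscl M) n b Y))"
          using Y l lin_in_T[OF l(1) Y]
          by (simp add: True b_map_0_cs) (simp add: cochain_scale_def tri_ts)
      qed
      then show ?thesis using X by (simp add: cochain_scale_def)
    next
      case False
      then show ?thesis
        using X i by (simp add: b_map_face[OF l(2)]) (simp add: b_map_face l cochain_scale_def)
    qed
  qed
  ultimately show ?thesis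
    unfolding cochain_linear_def using b_map_coch[OF _ i] by blast
qed

section \<open>The operators \<open>c_j\<close>\<close>

lemma c_map_coface:
  assumes f: "flin n p f" and X: "X \<in> TM n" and i: "i \<le> p"
  shows "c_map A M N n p i f X = N.coface p i (f X)"
proof -
  have fX: "f X \<in> T (mscl N) p" by (rule lin_in_T[OF f X])
  have 0: "sw (mscl N) (Suc p) (coact N y) (\<lambda>(z, ws). pr (mscl N) z (ws @ bs))
      = bind1 (mscl N) (Suc p) (coact N y) (\<lambda>z w. pr (mscl N) z (w # bs))" for y bs
    unfolding bind1_def by (rule sw_cong[OF N.coact_in_T]) (auto simp: length_Suc_conv)
  have 1: "sw (mscl N) (Suc p) (comul A b) (\<lambda>(u, ws). pr (mscl N) y (xs @ u # ws @ ys))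
      = bind1 (mscl N) (Suc p) (comul A b) (\<lambda>u w. pr (mscl N) y (xs @ u # w # ys))" for b y xs ys
    unfolding bind1_def by (rule sw_cong[OF comul_in_T]) (auto simp: length_Suc_conv)
  show ?thesis
    using X i by (simp add: c_map_def N.coface_def N.coface_gen_def 0 1)
qed

text \<open>The two inner sums in \<open>c_map\<close> are \<open>f \<otimes> id\<close> written out
  on the codiagonal coaction of a pure tensor; as a linear map it can be pulled out of the sum over
  \<open>X\<close>.\<close>

lemma c_map_last:
  assumes f: "flin n p f" and X: "X \<in> TM n"
  shows "c_map A M N n p (Suc p) f X = rx (mscl M) (mscl N) p f (M.rho n X)"
proof -
  have "flin (Suc n) (Suc p) (rx (mscl M) (mscl N) p f)" by (rule linear_rules f)+
  then have "rx (mscl M) (mscl N) p f (M.rho n X)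
      = sw (mscl N) (Suc p) X (\<lambda>(m, as). rx (mscl M) (mscl N) p f (codiag A M as m))"
    unfolding M.rho_def by (rule tlin_sw_swap[OF _ X]) simp
  then show ?thesis
    using X by (simp add: c_map_def rx_def bindS_def sn_def)
qed

lemma c_map_tlin:
  assumes f: "flin n p f" and i: "i \<le> Suc p"
  shows "flin n (Suc p) (c_map A M N n p i f)"
proof (cases "i \<le> p")
  case True
  show ?thesis
    by (rule tlin_cong[OF N.lin_coface[OF f True]]) (rule c_map_coface[OF f _ True])
next
  case False
  then have i: "i = Suc p" using i by simp
  show ?thesis
    unfolding i by (rule tlin_cong[OF lin_rx[OF M.tlin_rho f]]) (rule c_map_last[OF f])
qed

lemma c_map_coch: "f \<in> coch n p \<Longrightarrow> i \<le> Suc p \<Longrightarrow> c_map A M N n p i f \<in> coch n (Suc p)"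
  by (simp add: coch_iff c_map_tlin) (simp add: c_map_def)

lemma coface_add: "X \<in> T (mscl N) p \<Longrightarrow> Y \<in> T (mscl N) p \<Longrightarrow> j \<le> p
    \<Longrightarrow> N.coface p j (X + Y) = N.coface p j X + N.coface p j Y"
  and coface_ts: "X \<in> T (mscl N) p \<Longrightarrow> j \<le> p
    \<Longrightarrow> N.coface p j (ts (mscl N) p c X) = ts (mscl N) (Suc p) c (N.coface p j X)"
  using N.tlin_coface[of j p] by (simp_all add: lin_def)

lemma c_map_linear:
  assumes i: "i \<le> Suc p"
  shows "cochain_linear A M N n p n (Suc p) (c_map A M N n p i)"
proof -
  have "c_map A M N n p i (cochain_add A M n f g) = cochain_add A M n (c_map A M N n p i f) (c_map A M N n p i g)"
    if fg: "f \<in> coch n p" "g \<in> coch n p" for f g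
  proof (rule coch_eqI[OF c_map_coch[OF cochain_add_coch[OF fg] i]
        cochain_add_coch[OF c_map_coch[OF fg(1) i] c_map_coch[OF fg(2) i]]])
    fix X assume X: "X \<in> TM n"
    have l: "flin n p f" "flin n p g" "flin n p (cochain_add A M n f g)"
      using fg cochain_add_coch[OF fg] by (simp_all add: coch_iff)
    have R: "M.rho n X \<in> TM (Suc n)" by (simp add: X)
    have "c_map A M N n p i (cochain_add A M n f g) X = c_map A M N n p i f X + c_map A M N n p i g X"
    proof (cases "i \<le> p")
      case True
      then show ?thesis using X lin_in_T[OF l(1) X] lin_in_T[OF l(2) X]
        by (simp add: c_map_coface[OF l(3)] c_map_coface[OF l(1)] c_map_coface[OF l(2)])
           (simp add: cochain_add_def coface_add)
    next
      case False
      then have i: "i = Suc p" using i by simp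
      \<comment> \<open>\<open>cochain_add\<close> is cut off outside the tensor space, but
        \<open>rx\<close> evaluates its argument on tensors only.\<close>
      have "rx (mscl M) (mscl N) p (cochain_add A M n f g) (M.rho n X)
        = rx (mscl M) (mscl N) p (\<lambda>X. f X + g X) (M.rho n X)"
        by (rule rx_cong[OF R]) (simp add: cochain_add_def)
      then show ?thesis
        by (simp add: i X c_map_last[OF l(3)] c_map_last[OF l(1)] c_map_last[OF l(2)] rx_add[OF l(1,2) R])
    qed
    then show "c_map A M N n p i (cochain_add A M n f g) X
        = cochain_add A M n (c_map A M N n p i f) (c_map A M N n p i g) X"
      using X by (simp add: cochain_add_def)
  qed
  moreover have "c_map A M N n p i (cochain_scale A M N n p c f) = cochain_scale A M N n (Suc p) c (c_map A M N n p i f)"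
    if f: "f \<in> coch n p" for f c
  proof (rule coch_eqI[OF c_map_coch[OF cochain_scale_coch[OF f] i]
        cochain_scale_coch[OF c_map_coch[OF f i]]])
    fix X assume X: "X \<in> TM n"
    have l: "flin n p f" "flin n p (cochain_scale A M N n p c f)"
      using f cochain_scale_coch[OF f] by (simp_all add: coch_iff)
    have R: "M.rho n X \<in> TM (Suc n)" by (simp add: X)
    have "c_map A M N n p i (cochain_scale A M N n p c f) X = ts (mscl N) (Suc p) c (c_map A M N n p i f X)"
    proof (cases "i \<le> p")
      case True
      then show ?thesis using X lin_in_T[OF l(1) X]
        by (simp add: c_map_coface[OF l(2)] c_map_coface[OF l(1)])
           (simp add: cochain_scale_def coface_ts)
    next
      case False
      then have i: "i = Suc p" using i by simp
      have "rx (mscl M) (mscl N) p (cochain_scale A M N n p c f) (M.rho n X)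
        = rx (mscl M) (mscl N) p (\<lambda>X. ts (mscl N) p c (f X)) (M.rho n X)"
        by (rule rx_cong[OF R]) (simp add: cochain_scale_def)
      then show ?thesis
        by (simp add: i X c_map_last[OF l(2)] c_map_last[OF l(1)] rx_ts[OF l(1) R])
    qed
    then show "c_map A M N n p i (cochain_scale A M N n p c f) X
        = cochain_scale A M N n (Suc p) c (c_map A M N n p i f) X"
      using X by (simp add: cochain_scale_def)
  qed
  ultimately show ?thesis
    unfolding cochain_linear_def using c_map_coch[OF _ i] by blast
qed

text \<open>For \<open>i > 0\<close> both operators are precompositions and the claim is
  \<open>face_face\<close>. For \<open>i = 0\<close> and \<open>j > 1\<close>, acting with the first
  factor commutes with a face of the remaining ones. For \<open>i = 0\<close> and
  \<open>j = 1\<close>, acting with a product is compared with acting twice.\<close>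

lemma b_map_b_map:
  assumes f: "flin n p f" and X: "X \<in> TM (Suc (Suc n))" and ij: "i < j" "j \<le> Suc (Suc n)"
  shows "b_map A M N (Suc n) p j (b_map A M N n p i f) X
    = b_map A M N (Suc n) p i (b_map A M N n p (j - 1) f) X"
proof (cases "i = 0")
  case False
  have b: "flin (Suc n) p (b_map A M N n p i f)" "flin (Suc n) p (b_map A M N n p (j - 1) f)"
    using ij by (auto intro: b_map_tlin[OF f])
  show ?thesis
    using False ij X
    by (simp add: b_map_face[OF b(1)] b_map_face[OF b(2)[unfolded One_nat_def]] b_map_face[OF f] M.face_face)
next
  case True
  have ij': "i \<le> Suc n" "j - 1 \<le> Suc n" "i \<le> Suc (Suc n)" using ij by auto
  note b = b_map_tlin[OF f ij'(1)] b_map_tlin[OF f ij'(2)]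
  note lins = b_map_tlin[OF b(1) ij(2)] b_map_tlin[OF b(2) ij'(3)]
  have cs: "tlin (mscl M) q (mscl M) (Suc q) (cs (mscl M) q a)" for q a
    by (rule linear_rules)+
  show ?thesis
  proof (rule tlin_cs_eqI[OF lins _ X])
    fix Y a assume Y: "Y \<in> TM (Suc n)"
    show "b_map A M N (Suc n) p j (b_map A M N n p i f) (cs (mscl M) (Suc n) a Y)
      = b_map A M N (Suc n) p i (b_map A M N n p (j - 1) f) (cs (mscl M) (Suc n) a Y)"
    proof (cases "j = Suc 0")
      case False
      then obtain k where k: "j = Suc k" "k \<noteq> 0" "k \<le> Suc n" using ij by (cases j) auto
      have bk: "flin (Suc n) p (b_map A M N n p k f)" by (rule b_map_tlin[OF f k(3)])
      show ?thesis
        using k(2,3) Y b(1)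
        by (simp add: k(1) True b_map_face[OF b(1)[unfolded True]] M.face_cs b_map_0_cs[OF f]
            b_map_0_cs[OF bk] b_map_face[OF f])
    next
      case j: True
      show ?thesis
      proof (rule tlin_cs_eqI[OF lin_comp[OF lins(1) cs] lin_comp[OF lins(2) cs] _ Y])
        fix Z c assume Z: "Z \<in> TM n"
        show "b_map A M N (Suc n) p j (b_map A M N n p i f) (cs (mscl M) (Suc n) a (cs (mscl M) n c Z))
          = b_map A M N (Suc n) p i (b_map A M N n p (j - 1) f) (cs (mscl M) (Suc n) a (cs (mscl M) n c Z))"
          using Z lin_in_T[OF f Z]
          by (simp add: j True b_map_face[OF b(1)[unfolded True]] b_map_0_cs[OF b(1)[unfolded True]]
              M.face_first_cs b_map_0_cs[OF f] N.tri_mult)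
      qed
    qed
  qed
qed

lemma coface_rx:
  assumes f: "flin n p f" and j: "j \<le> p" and Z: "Z \<in> TM (Suc n)"
  shows "N.coface (Suc p) j (rx (mscl M) (mscl N) p f Z)
    = rx (mscl M) (mscl N) (Suc p) (\<lambda>X. N.coface p j (f X)) Z"
proof (rule tlin_sn_eqI[OF _ _ _ Z])
  have c: "flin n (Suc p) (\<lambda>X. N.coface p j (f X))" by (rule N.lin_coface[OF f j])
  show "flin (Suc n) (Suc (Suc p)) (\<lambda>Z. N.coface (Suc p) j (rx (mscl M) (mscl N) p f Z))"
    by (rule linear_rules f le_SucI j)+
  show "flin (Suc n) (Suc (Suc p)) (rx (mscl M) (mscl N) (Suc p) (\<lambda>X. N.coface p j (f X)))"
    by (rule linear_rules f j)+
  show "N.coface (Suc p) j (rx (mscl M) (mscl N) p f (sn (mscl M) n X b))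
      = rx (mscl M) (mscl N) (Suc p) (\<lambda>X. N.coface p j (f X)) (sn (mscl M) n X b)"
    if "X \<in> TM n" for X b
    by (simp add: rx_sn[OF f that] rx_sn[OF c that] N.coface_sn lin_in_T[OF f that] j)
qed

text \<open>Both top cofaces comultiply the separate right factor, one over
  \<open>N \<otimes> A^p\<close> and one over \<open>A^n \<otimes> M\<close>, and \<open>f\<close>
  acts on the other factors only.\<close>

lemma coface_last_rx:
  assumes f: "flin n p f" and Z: "Z \<in> TM (Suc n)"
  shows "N.coface (Suc p) (Suc p) (rx (mscl M) (mscl N) p f Z)
    = rx (mscl M) (mscl N) (Suc p) (rx (mscl M) (mscl N) p f) (M.coface (Suc n) (Suc n) Z)"
proof (rule tlin_sn_eqI[OF _ _ _ Z])
  have r: "flin (Suc n) (Suc p) (rx (mscl M) (mscl N) p f)" by (rule linear_rules f)+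
  have rr: "flin (Suc (Suc n)) (Suc (Suc p)) (rx (mscl M) (mscl N) (Suc p) (rx (mscl M) (mscl N) p f))"
    by (rule linear_rules f)+
  show "flin (Suc n) (Suc (Suc p)) (\<lambda>Z. N.coface (Suc p) (Suc p) (rx (mscl M) (mscl N) p f Z))"
    by (rule linear_rules f order.refl)+
  show "flin (Suc n) (Suc (Suc p)) (\<lambda>Z. rx (mscl M) (mscl N) (Suc p) (rx (mscl M) (mscl N) p f)
      (M.coface (Suc n) (Suc n) Z))"
    by (rule linear_rules f order.refl)+
  show "N.coface (Suc p) (Suc p) (rx (mscl M) (mscl N) p f (sn (mscl M) n X b))
      = rx (mscl M) (mscl N) (Suc p) (rx (mscl M) (mscl N) p f) (M.coface (Suc n) (Suc n) (sn (mscl M) n X b))"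
    if "X \<in> TM n" for X b
    by (simp add: rx_sn[OF f that] rx_sn[OF r] rx_sn[OF f] that N.coface_last_sn M.coface_last_sn
        lin_in_T[OF f that] tlin_comul_swap[OF rr])
qed

text \<open>With \<open>j \<le> p + 1\<close> only cofaces of \<open>N \<otimes> A^p\<close> occur.
  If the coaction of the source enters once, it commutes with a coface of the target; if it enters
  twice, coassociativity of \<open>\<rho>\<close> trades the second coaction for a
  comultiplication.\<close>

lemma c_map_c_map:
  assumes f: "flin n p f" and X: "X \<in> TM n" and ij: "i < j" "j \<le> Suc (Suc p)"
  shows "c_map A M N n (Suc p) j (c_map A M N n p i f) X
    = c_map A M N n (Suc p) i (c_map A M N n p (j - 1) f) X"
proof -
  have ij': "i \<le> Suc p" "j - 1 \<le> Suc p" using ij by auto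
  note c = c_map_tlin[OF f ij'(1)] c_map_tlin[OF f ij'(2)]
  have fX: "f X \<in> T (mscl N) p" by (rule lin_in_T[OF f X])
  have R: "M.rho n X \<in> TM (Suc n)" by (simp add: X)
  have r: "flin (Suc n) (Suc p) (rx (mscl M) (mscl N) p f)" by (rule linear_rules f)+
  consider (lower) "j \<le> Suc p" | (top) "j = Suc (Suc p)" "i \<le> p" | (both) "j = Suc (Suc p)" "i = Suc p"
    using ij by linarith
  then show ?thesis
  proof cases
    case lower
    then have "i \<le> p" "j - 1 \<le> p" using ij by auto
    then show ?thesis
      using X ij lower fX
      by (simp add: c_map_coface[OF c(1)] c_map_coface[OF c(2)[unfolded One_nat_def]] c_map_coface[OF f]
          N.coface_coface)
  next
    case top
    have "c_map A M N n (Suc p) j (c_map A M N n p i f) X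
        = rx (mscl M) (mscl N) (Suc p) (c_map A M N n p i f) (M.rho n X)"
      unfolding top(1) by (rule c_map_last[OF c(1) X])
    also have "\<dots> = rx (mscl M) (mscl N) (Suc p) (\<lambda>X. N.coface p i (f X)) (M.rho n X)"
      by (rule rx_cong[OF R]) (rule c_map_coface[OF f _ top(2)])
    also have "\<dots> = N.coface (Suc p) i (rx (mscl M) (mscl N) p f (M.rho n X))"
      by (rule coface_rx[OF f top(2) R, symmetric])
    also have "\<dots> = c_map A M N n (Suc p) i (c_map A M N n p (j - 1) f) X"
      using X ij' by (simp add: top(1) c_map_coface[OF c(2)[unfolded top(1) diff_Suc_1]] c_map_last[OF f])
    finally show ?thesis .
  next
    case both
    have "c_map A M N n (Suc p) j (c_map A M N n p i f) X
        = rx (mscl M) (mscl N) (Suc p) (c_map A M N n p i f) (M.rho n X)"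
      unfolding both(1) by (rule c_map_last[OF c(1) X])
    also have "\<dots> = rx (mscl M) (mscl N) (Suc p) (\<lambda>X. rx (mscl M) (mscl N) p f (M.rho n X)) (M.rho n X)"
      unfolding both(2) by (rule rx_cong[OF R]) (rule c_map_last[OF f])
    also have "\<dots> = rx (mscl M) (mscl N) (Suc p) (rx (mscl M) (mscl N) p f)
        (rx (mscl M) (mscl M) (Suc n) (M.rho n) (M.rho n X))"
      by (rule rx_comp[OF M.tlin_rho r R, symmetric])
    also have "\<dots> = N.coface (Suc p) (Suc p) (rx (mscl M) (mscl N) p f (M.rho n X))"
      by (simp add: M.rho_coassoc X coface_last_rx[OF f R])
    also have "\<dots> = c_map A M N n (Suc p) i (c_map A M N n p (j - 1) f) X"
      using X by (simp add: both c_map_coface[OF c(1)[unfolded both(2)]] c_map_last[OF f])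
    finally show ?thesis .
  qed
qed

text \<open>Of the four combinations, a face with a coface is precomposition against
  postcomposition. A face with the coaction is colinearity, the action with a coface is linearity
  over \<open>A\<close>, and the action with the coaction is a direct comparison through
  \<open>tri_sn\<close>.\<close>

lemma c_map_b_map:
  assumes f: "flin n p f" and X: "X \<in> TM (Suc n)" and i: "i \<le> Suc n" and j: "j \<le> Suc p"
  shows "c_map A M N (Suc n) p j (b_map A M N n p i f) X = b_map A M N n (Suc p) i (c_map A M N n p j f) X"
proof -
  note b = b_map_tlin[OF f i] and c = c_map_tlin[OF f j]
  note lins = c_map_tlin[OF b j] b_map_tlin[OF c i]
  have R: "M.rho (Suc n) X \<in> TM (Suc (Suc n))" by (simp add: X)
  show ?thesis
  proof (cases "i = 0")
    case False
    have F: "M.face n i X \<in> TM n" using X False i by simp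
    show ?thesis
    proof (cases "j \<le> p")
      case True
      then show ?thesis
        using F by (simp add: c_map_coface[OF b X] b_map_face[OF f X False i] b_map_face[OF c X False i]
            c_map_coface[OF f])
    next
      case j': False
      then have j': "j = Suc p" using j by simp
      have "c_map A M N (Suc n) p j (b_map A M N n p i f) X
          = rx (mscl M) (mscl N) p (b_map A M N n p i f) (M.rho (Suc n) X)"
        unfolding j' by (rule c_map_last[OF b X])
      also have "\<dots> = rx (mscl M) (mscl N) p (\<lambda>X. f (M.face n i X)) (M.rho (Suc n) X)"
        by (rule rx_cong[OF R]) (rule b_map_face[OF f _ False i])
      also have "\<dots> = rx (mscl M) (mscl N) p f (rx (mscl M) (mscl M) n (M.face n i) (M.rho (Suc n) X))"
        by (rule rx_comp[OF M.tlin_face[OF False i] f R, symmetric])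
      also have "\<dots> = b_map A M N n (Suc p) i (c_map A M N n p j f) X"
        unfolding b_map_face[OF c X False i]
        by (simp add: j' c_map_last[OF f F] M.rho_face[OF X False i])
      finally show ?thesis .
    qed
  next
    case i0: True
    note b0 = b[unfolded i0]
    show ?thesis
    proof (rule tlin_cs_eqI[OF lins _ X])
      fix Y a assume Y: "Y \<in> TM n"
      have fY: "f Y \<in> T (mscl N) p" by (rule lin_in_T[OF f Y])
      show "c_map A M N (Suc n) p j (b_map A M N n p i f) (cs (mscl M) n a Y)
        = b_map A M N n (Suc p) i (c_map A M N n p j f) (cs (mscl M) n a Y)"
      proof (cases "j \<le> p")
        case True
        then show ?thesis
          using Y fY by (simp add: i0 c_map_coface[OF b0] b_map_0_cs[OF f] b_map_0_cs[OF c]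
              c_map_coface[OF f] N.coface_tri)
      next
        case False
        then have j': "j = Suc p" using j by simp
        let ?b = "b_map A M N n p 0 f"
        have r: "flin (Suc (Suc n)) (Suc p) (rx (mscl M) (mscl N) p ?b)"
          by (rule linear_rules b0)+
        \<comment> \<open>At \<open>Z = V \<otimes> h\<close> both sides sum
          \<open>u \<cdot> f V \<otimes> w * h\<close> over the coproduct of \<open>a\<close>: the
          codiagonal coaction and the diagonal action distribute \<open>a\<close> in the same
          way.\<close>
        have "bind1 (mscl N) (Suc p) (comul A a) (\<lambda>u w. rx (mscl M) (mscl N) p ?b (M.coact_cons n u w Z))
          = N.tri (Suc p) a (rx (mscl M) (mscl N) p f Z)" if Z: "Z \<in> TM (Suc n)" for Z
        proof (rule tlin_sn_eqI[OF _ _ _ Z])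
          show "flin (Suc n) (Suc p) (\<lambda>Z. bind1 (mscl N) (Suc p) (comul A a)
              (\<lambda>u w. rx (mscl M) (mscl N) p ?b (M.coact_cons n u w Z)))"
            by (rule linear_rules b0)+
          show "flin (Suc n) (Suc p) (\<lambda>Z. N.tri (Suc p) a (rx (mscl M) (mscl N) p f Z))"
            by (rule linear_rules f)+
          fix V h assume V: "V \<in> TM n"
          show "bind1 (mscl N) (Suc p) (comul A a)
              (\<lambda>u w. rx (mscl M) (mscl N) p ?b (M.coact_cons n u w (sn (mscl M) n V h)))
            = N.tri (Suc p) a (rx (mscl M) (mscl N) p f (sn (mscl M) n V h))"
            by (simp add: M.coact_cons_sn V rx_sn[OF b0] b_map_0_cs[OF f V] rx_sn[OF f V]
                N.tri_sn lin_in_T[OF f V])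
        qed
        then show ?thesis
          using Y by (simp add: i0 j' c_map_last[OF b0] M.rho_cs tlin_comul_swap[OF r]
              b_map_0_cs[OF c[unfolded j']] c_map_last[OF f])
      qed
    qed
  qed
qed

section \<open>The differentials\<close>

lemma d_m_eq: "d_m A M N n p = comb (Suc n) (Suc n) p (b_map A M N n p)"
  by (simp add: fun_eq_iff d_m_def comb_def)

lemma d_c_eq: "d_c A M N n p = comb (Suc p) n (Suc p) (c_map A M N n p)"
  by (simp add: fun_eq_iff d_c_def comb_def)

lemma d_m_linear: "cochain_linear A M N n p (Suc n) p (d_m A M N n p)"
  unfolding d_m_eq by (rule comb_linear) (rule b_map_linear)

lemma d_c_linear: "cochain_linear A M N n p n (Suc p) (d_c A M N n p)"
  unfolding d_c_eq by (rule comb_linear) (rule c_map_linear)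

lemma d_m_d_m:
  assumes "f \<in> coch n p"
  shows "d_m A M N (Suc n) p (d_m A M N n p f) = cochain_zero A M N (Suc (Suc n)) p"
proof (rule ext)
  fix X
  show "d_m A M N (Suc n) p (d_m A M N n p f) X = cochain_zero A M N (Suc (Suc n)) p X"
  \<comment> \<open>Outside the tensor space both sides are \<open>undefined\<close> by
    restriction.\<close>
  proof (cases "X \<in> TM (Suc (Suc n))")
    case True
    have f: "flin n p f" using assms by (simp add: coch_iff)
    have "(\<Sum>j = 0..Suc (Suc n). \<Sum>i = 0..Suc n. ts (mscl N) p ((- 1) ^ j)
        (ts (mscl N) p ((- 1) ^ i) (b_map A M N (Suc n) p j (b_map A M N n p i f) X))) = null (mscl N) p"
      by (rule alternating_sum_null)
         (assumption | rule b_map_b_map[OF f True] lin_in_T[OF b_map_tlin[OF b_map_tlin[OF f]] True])+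
    then show ?thesis
      using True unfolding d_m_eq
      by (simp only: comb_comb[OF b_map_linear b_map_linear assms True]) (simp add: cochain_zero_def)
  qed (simp add: d_m_def cochain_zero_def)
qed

lemma d_c_d_c:
  assumes "f \<in> coch n p"
  shows "d_c A M N n (Suc p) (d_c A M N n p f) = cochain_zero A M N n (Suc (Suc p))"
proof (rule ext)
  fix X
  show "d_c A M N n (Suc p) (d_c A M N n p f) X = cochain_zero A M N n (Suc (Suc p)) X"
  proof (cases "X \<in> TM n")
    case True
    have f: "flin n p f" using assms by (simp add: coch_iff)
    have "(\<Sum>j = 0..Suc (Suc p). \<Sum>i = 0..Suc p. ts (mscl N) (Suc (Suc p)) ((- 1) ^ j)
        (ts (mscl N) (Suc (Suc p)) ((- 1) ^ i) (c_map A M N n (Suc p) j (c_map A M N n p i f) X)))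
        = null (mscl N) (Suc (Suc p))"
      by (rule alternating_sum_null)
         (assumption | rule c_map_c_map[OF f True] lin_in_T[OF c_map_tlin[OF c_map_tlin[OF f]] True])+
    then show ?thesis
      using True unfolding d_c_eq
      by (simp only: comb_comb[OF c_map_linear c_map_linear assms True]) (simp add: cochain_zero_def)
  qed (simp add: d_c_def cochain_zero_def)
qed

text \<open>The operators of the two directions commute without any shift of indices, so the double
  sums agree term by term after exchanging the summations; the squares commute rather than
  anticommute.\<close>

lemma d_c_d_m:
  assumes "f \<in> coch n p"
  shows "d_c A M N (Suc n) p (d_m A M N n p f) = d_m A M N n (Suc p) (d_c A M N n p f)"
proof (rule ext)
  fix X
  show "d_c A M N (Suc n) p (d_m A M N n p f) X = d_m A M N n (Suc p) (d_c A M N n p f) X"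
  proof (cases "X \<in> TM (Suc n)")
    case True
    have f: "flin n p f" using assms by (simp add: coch_iff)
    let ?t = "\<lambda>k. ts (mscl N) (Suc p) ((- 1) ^ k)"
    have "d_c A M N (Suc n) p (d_m A M N n p f) X = (\<Sum>j = 0..Suc p. \<Sum>i = 0..Suc n.
        ?t j (?t i (c_map A M N (Suc n) p j (b_map A M N n p i f) X)))"
      unfolding d_c_eq d_m_eq by (rule comb_comb[OF b_map_linear c_map_linear assms True])
    also have "\<dots> = (\<Sum>i = 0..Suc n. \<Sum>j = 0..Suc p.
        ?t j (?t i (c_map A M N (Suc n) p j (b_map A M N n p i f) X)))"
      by (rule sum.swap)
    also have "\<dots> = (\<Sum>i = 0..Suc n. \<Sum>j = 0..Suc p.
        ?t i (?t j (b_map A M N n (Suc p) i (c_map A M N n p j f) X)))"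
    proof (intro sum.cong refl)
      fix i j assume "i \<in> {0..Suc n}" "j \<in> {0..Suc p}"
      then have ij: "i \<le> Suc n" "j \<le> Suc p" by auto
      have "b_map A M N n (Suc p) i (c_map A M N n p j f) X \<in> T (mscl N) (Suc p)"
        by (rule lin_in_T[OF b_map_tlin[OF c_map_tlin[OF f ij(2)] ij(1)] True])
      then show "?t j (?t i (c_map A M N (Suc n) p j (b_map A M N n p i f) X))
          = ?t i (?t j (b_map A M N n (Suc p) i (c_map A M N n p j f) X))"
        by (simp add: c_map_b_map[OF f True ij] ts_ts mult.commute)
    qed
    also have "\<dots> = d_m A M N n (Suc p) (d_c A M N n p f) X"
      unfolding d_c_eq d_m_eq by (rule comb_comb[OF c_map_linear b_map_linear assms True, symmetric])
    finally show ?thesis .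
  qed (simp add: d_m_def d_c_def)
qed

end

theorem mainTheorem5:
  fixes A :: "('k::field, 'a::ring_1) bialg"
    and M :: "('k, 'a, 'm::ab_group_add) hopf_mod"
    and N :: "('k, 'a, 'n::ab_group_add) hopf_mod"
    and n p :: nat
  assumes "bialgebra A" and "hopf_module A M" and "hopf_module A N"
  shows "cochain_linear A M N n p (n + 1) p (d_m A M N n p) \<and>
         cochain_linear A M N n p n (p + 1) (d_c A M N n p) \<and>
         (\<forall>f \<in> cochains A M N n p.
           d_m A M N (n + 1) p (d_m A M N n p f) = cochain_zero A M N (n + 2) p) \<and>
         (\<forall>f \<in> cochains A M N n p.
           d_c A M N n (p + 1) (d_c A M N n p f) = cochain_zero A M N n (p + 2)) \<and>
         (\<forall>f \<in> cochains A M N n p.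
           d_c A M N (n + 1) p (d_m A M N n p f) = d_m A M N n (p + 1) (d_c A M N n p f))"
proof -
  interpret hopf_pair A M N
    using assms by unfold_locales
  show ?thesis
    using d_m_linear d_c_linear d_m_d_m d_c_d_c d_c_d_m by simp
qed

end
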